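(* Let $E$ be a Banach space. For every projector $P\in\mathcal{P}(E)$, the homomorphisms $\operatorname{sf}_{2P-I}\colon\pi_1(e\mathcal{H}(E),2P-I)\to\mathbb{Z}$, $\varphi_P\colon\pi_1(\mathcal{P}(\mathcal{C}(E)),p(P))\to\mathbb{Z}$ and $\Psi_*\colon\pi_1(e\mathcal{H}(E),2P-I)\to\pi_1(\mathcal{P}(\mathcal{C}(E)),p(P))$ satisfy $$\operatorname{sf}_{2P-I}=-\varphi_P\circ\Psi_*.$$
   Context: $\mathcal{C}(E)=\mathcal{L}(E)/\mathcal{L}_c(E)$ is the Calkin algebra (bounded operators modulo compact operators), $p$ the quotient map. $\mathcal{P}(\mathcal{B})$ is the space of idempotents of a Banach algebra $\mathcal{B}$ with the norm topology, $\mathcal{P}(E)=\mathcal{P}(\mathcal{L}(E))$. $e\mathcal{H}(E)$ is the set of essentially hyperbolic operators: those $A\in\mathcal{L}(E)$ such that $A-\lambda I$ is Fredholm for all $\lambda\in i\mathbb{R}$, i.e. $\sigma(p(A))\cap i\mathbb{R}=\emptyset$; it carries the norm topology. For real $E$, spectra are those of the complexification. $\Psi\colon e\mathcal{H}(E)\to\mathcal{P}(\mathcal{C}(E))$ sends $A$ to the spectral idempotent of $p(A)$ associated with $\sigma(p(A))\cap\{\operatorname{Re}z>0\}$; $\Psi(2P-I)=p(P)$. For $A\in e\mathcal{H}(E)$, $\sigma(A)\cap i\mathbb{R}$ is a finite set of isolated points of $\sigma(A)$, and $P^+(A)$ denotes the spectral projector of $A$ associated with $\sigma(A)\cap\{\operatorname{Re}z>0\}$;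 one has $p(P^+(A))=\Psi(A)$. Relative dimension: for projectors $Q,R$ with $Q-R$ compact, $[Q-R]:=\operatorname{ind}\bigl(R|_{\operatorname{Range}Q}\colon\operatorname{Range}Q\to\operatorname{Range}R\bigr)$. The map $p\colon\mathcal{P}(E)\to\mathcal{P}(\mathcal{C}(E))$ is a locally trivial bundle. For a continuous path $A\colon[0,1]\to e\mathcal{H}(E)$ choose a continuous path $Q\colon[0,1]\to\mathcal{P}(E)$ with $p(Q(t))=\Psi(A(t))$; the spectral flow is $\operatorname{sf}(A)=[Q(0)-P^+(A(0))]-[Q(1)-P^+(A(1))]$, independent of $Q$. It induces a homomorphism $\operatorname{sf}_{2P-I}$ on $\pi_1(e\mathcal{H}(E),2P-I)$. For a loop $a$ in $\mathcal{P}(\mathcal{C}(E))$ based at $p(P)$, choose a continuous $\beta\colon[0,1]\to\mathcal{P}(E)$ with $\beta(0)=P$, $p\circ\beta=a$; then $\varphi_P([a])=[\beta(1)-\beta(0)]$, a well defined group homomorphism. *)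

theory Defs
  imports "HOL-Complex_Analysis.Complex_Analysis" "HOL-Algebra.Elementary_Groups"
begin

section \<open>Compact operators\<close>

definition compact_operator ::
    "('a::real_normed_vector \<Rightarrow>\<^sub>L 'b::real_normed_vector) \<Rightarrow> bool" where
  "compact_operator K \<longleftrightarrow> compact (closure (blinfun_apply K ` cball 0 1))"

lemma compact_closure_iff_totally_bounded:
  fixes S :: "'a::banach set"
  shows "compact (closure S) \<longleftrightarrow> (\<forall>e>0. \<exists>k. finite k \<and> S \<subseteq> (\<Union>x\<in>k. ball x e))"
proof
  assume "compact (closure S)"
  then have "\<forall>e>0. \<exists>k. finite k \<and> k \<subseteq> closure S \<and> closure S \<subseteq> (\<Union>x\<in>k. ball x e)"
    using compact_eq_totally_bounded
    by (metis seq_compact_imp_totally_bounded compact_imp_seq_compact)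
  then show "\<forall>e>0. \<exists>k. finite k \<and> S \<subseteq> (\<Union>x\<in>k. ball x e)"
    by (meson closure_subset order_trans)
next
  assume tb: "\<forall>e>0. \<exists>k. finite k \<and> S \<subseteq> (\<Union>x\<in>k. ball x e)"
  have "\<exists>k. finite k \<and> closure S \<subseteq> (\<Union>x\<in>k. ball x e)" if "e > 0" for e :: real
  proof -
    obtain k where k: "finite k" "S \<subseteq> (\<Union>x\<in>k. ball x (e/2))"
      using tb \<open>e > 0\<close> by (meson half_gt_zero)
    have "closure S \<subseteq> (\<Union>x\<in>k. cball x (e/2))"
      using k by (intro closure_minimal) (auto intro!: closed_UN dest!: subsetD)
    also have "\<dots> \<subseteq> (\<Union>x\<in>k. ball x e)"
      using \<open>e > 0\<close> by (force simp: mem_ball mem_cball)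
    finally show ?thesis using k by blast
  qed
  then show "compact (closure S)"
    unfolding compact_eq_totally_bounded by (simp add: complete_eq_closed)
qed

lemma compact_closure_subset:
  fixes S T :: "'a::t2_space set"
  assumes "S \<subseteq> T" "compact T"
  shows "compact (closure S)"
proof -
  have "closure S \<subseteq> T" using assms by (simp add: closure_minimal compact_imp_closed)
  then show ?thesis using compact_Int_closed[OF assms(2), of "closure S"] by (simp add: Int_absorb1)
qed

lemma compact_operator_zero: "compact_operator 0"
  unfolding compact_operator_def
  by (rule compact_closure_subset[of _ "{0}"]) auto

lemma compact_operator_scaleR:
  fixes K :: "'a::real_normed_vector \<Rightarrow>\<^sub>L 'b::real_normed_vector"
  assumes "compact_operator K"
  shows "compact_operator (r *\<^sub>R K)"
proof -
  have "blinfun_apply (r *\<^sub>R K) ` cball 0 1 \<subseteq> (*\<^sub>R) r ` closure (blinfun_apply K ` cball 0 1)"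
    using closure_subset by (fastforce simp: blinfun.scaleR_left)
  moreover have "compact ((*\<^sub>R) r ` closure (blinfun_apply K ` cball 0 1))"
    using assms unfolding compact_operator_def by (rule compact_scaling)
  ultimately show ?thesis
    unfolding compact_operator_def by (rule compact_closure_subset)
qed

lemma compact_operator_uminus: "compact_operator K \<Longrightarrow> compact_operator (- K)"
  using compact_operator_scaleR[of K "-1"] by simp

lemma compact_operator_add:
  fixes K L :: "'a::real_normed_vector \<Rightarrow>\<^sub>L 'b::banach"
  assumes "compact_operator K" "compact_operator L"
  shows "compact_operator (K + L)"
  unfolding compact_operator_def compact_closure_iff_totally_bounded
proof (intro allI impI)
  fix e :: real assume "e > 0"
  obtain k l where k: "finite k" "blinfun_apply K ` cball 0 1 \<subseteq> (\<Union>x\<in>k. ball x (e/2))"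
    and l: "finite l" "blinfun_apply L ` cball 0 1 \<subseteq> (\<Union>x\<in>l. ball x (e/2))"
    using assms \<open>e > 0\<close> unfolding compact_operator_def compact_closure_iff_totally_bounded
    by (meson half_gt_zero)
  have "blinfun_apply (K + L) ` cball 0 1
      \<subseteq> (\<Union>x\<in>(\<lambda>(u, v). u + v) ` (k \<times> l). ball x e)"
  proof (rule image_subsetI)
    fix x :: 'a assume "x \<in> cball 0 1"
    then obtain u v where uv: "u \<in> k" "v \<in> l" "dist u (K x) < e/2" "dist v (L x) < e/2"
      using k l by (force simp: mem_ball)
    have "dist (u + v) ((K + L) x) \<le> dist u (K x) + dist v (L x)"
      by (simp add: blinfun.add_left dist_triangle_add)
    with uv show "blinfun_apply (K + L) x \<in> (\<Union>x\<in>(\<lambda>(u, v). u + v) ` (k \<times> l). ball x e)"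
      by force
  qed
  with k l show "\<exists>k. finite k \<and> blinfun_apply (K + L) ` cball 0 1 \<subseteq> (\<Union>x\<in>k. ball x e)"
    by (meson finite_SigmaI finite_imageI)
qed

lemma compact_operator_diff:
  fixes K L :: "'a::real_normed_vector \<Rightarrow>\<^sub>L 'b::banach"
  shows "compact_operator K \<Longrightarrow> compact_operator L \<Longrightarrow> compact_operator (K - L)"
  using compact_operator_add[of K "- L"] compact_operator_uminus[of L] by simp

lemma compact_operator_compose_left:
  fixes K :: "'a::real_normed_vector \<Rightarrow>\<^sub>L 'b::real_normed_vector"
    and A :: "'b \<Rightarrow>\<^sub>L 'c::real_normed_vector"
  assumes "compact_operator K"
  shows "compact_operator (A o\<^sub>L K)"
proof -
  let ?S = "blinfun_apply K ` cball 0 1"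
  have "compact (blinfun_apply A ` closure ?S)"
    using assms by (intro compact_continuous_image)
      (auto simp: compact_operator_def intro: blinfun.continuous_on continuous_intros)
  moreover have "blinfun_apply (A o\<^sub>L K) ` cball 0 1 \<subseteq> blinfun_apply A ` closure ?S"
    using closure_subset by fastforce
  ultimately show ?thesis
    unfolding compact_operator_def by (metis compact_closure_subset)
qed

lemma compact_operator_compose_right:
  fixes K :: "'b::real_normed_vector \<Rightarrow>\<^sub>L 'c::real_normed_vector"
    and A :: "'a::real_normed_vector \<Rightarrow>\<^sub>L 'b"
  assumes "compact_operator K"
  shows "compact_operator (K o\<^sub>L A)"
proof -
  define m where "m = norm A + 1"
  have m: "m > 0" unfolding m_def by (smt (verit) norm_ge_zero)
  let ?S = "blinfun_apply (m *\<^sub>R K) ` cball 0 1"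
  have "compact (closure ?S)"
    using compact_operator_scaleR[OF assms] by (simp add: compact_operator_def)
  moreover have "blinfun_apply (K o\<^sub>L A) ` cball 0 1 \<subseteq> ?S"
  proof (rule image_subsetI)
    fix x :: 'a assume "x \<in> cball 0 1"
    then have "norm x \<le> 1" by simp
    then have "norm (A x) \<le> norm A"
      by (metis mult.right_neutral mult_left_mono norm_blinfun norm_ge_zero order_trans)
    then have "norm (A x /\<^sub>R m) \<le> 1"
      using m by (simp add: m_def field_simps)
    moreover have "blinfun_apply (K o\<^sub>L A) x = (m *\<^sub>R K) (A x /\<^sub>R m)"
      using m by (simp add: blinfun.scaleR_left blinfun.scaleR_right)
    ultimately show "blinfun_apply (K o\<^sub>L A) x \<in> ?S" by (metis image_eqI mem_cball_0)
  qed
  ultimately show ?thesis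
    unfolding compact_operator_def
    by (meson closure_subset compact_closure_subset order_trans)
qed

lemma compact_operator_limit:
  fixes A :: "'a::real_normed_vector \<Rightarrow>\<^sub>L 'b::banach"
  assumes "\<And>e. e > 0 \<Longrightarrow> \<exists>K. compact_operator K \<and> norm (A - K) < e"
  shows "compact_operator A"
  unfolding compact_operator_def compact_closure_iff_totally_bounded
proof (intro allI impI)
  fix e :: real assume "e > 0"
  obtain K where K: "compact_operator K" "norm (A - K) < e/2"
    using assms \<open>e > 0\<close> half_gt_zero by blast
  obtain k where k: "finite k" "blinfun_apply K ` cball 0 1 \<subseteq> (\<Union>x\<in>k. ball x (e/2))"
    using K \<open>e > 0\<close> unfolding compact_operator_def compact_closure_iff_totally_bounded
    by (meson half_gt_zero)
  have "blinfun_apply A ` cball 0 1 \<subseteq> (\<Union>x\<in>k. ball x e)"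
  proof (rule image_subsetI)
    fix x :: 'a assume x: "x \<in> cball 0 1"
    then obtain u where u: "u \<in> k" "dist u (K x) < e/2"
      using k by (force simp: mem_ball)
    have "dist (K x) (A x) = norm ((A - K) x)"
      by (simp add: dist_norm norm_minus_commute blinfun.diff_left)
    also have "\<dots> \<le> norm (A - K) * norm x" by (rule norm_blinfun)
    also have "\<dots> \<le> norm (A - K)" using x by (simp add: mult_left_le)
    finally have "dist u (A x) < e"
      using u K dist_triangle[of u "A x" "K x"] by linarith
    with u show "blinfun_apply A x \<in> (\<Union>x\<in>k. ball x e)" by auto
  qed
  with k show "\<exists>k. finite k \<and> blinfun_apply A ` cball 0 1 \<subseteq> (\<Union>x\<in>k. ball x e)" by blast
qed


section \<open>Bounded operators modulo compact operators\<close>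

quotient_type (overloaded) 'a calkin = "'a::banach \<Rightarrow>\<^sub>L 'a" / "\<lambda>A B. compact_operator (A - B)"
  morphisms rep_calkin quot
proof (rule equivpI)
  show "reflp (\<lambda>A B :: 'a \<Rightarrow>\<^sub>L 'a. compact_operator (A - B))"
    by (simp add: reflp_def compact_operator_zero)
  show "symp (\<lambda>A B :: 'a \<Rightarrow>\<^sub>L 'a. compact_operator (A - B))"
    by (metis (mono_tags, lifting) sympI compact_operator_uminus minus_diff_eq)
  show "transp (\<lambda>A B :: 'a \<Rightarrow>\<^sub>L 'a. compact_operator (A - B))"
  proof (rule transpI)
    fix A B C :: "'a \<Rightarrow>\<^sub>L 'a"
    assume "compact_operator (A - B)" "compact_operator (B - C)"
    then show "compact_operator (A - C)"
      using compact_operator_add[of "A - B" "B - C"] by simp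
  qed
qed

lemma quot_eq_iff: "quot A = quot B \<longleftrightarrow> compact_operator (A - B)"
  by (rule calkin.abs_eq_iff)

instantiation calkin :: (banach) "{real_vector, times, one}"
begin

lift_definition zero_calkin :: "'a calkin" is 0 .

lift_definition one_calkin :: "'a calkin" is id_blinfun .

lift_definition plus_calkin :: "'a calkin \<Rightarrow> 'a calkin \<Rightarrow> 'a calkin" is "(+)"
proof -
  fix A B C D :: "'a \<Rightarrow>\<^sub>L 'a"
  assume "compact_operator (A - B)" "compact_operator (C - D)"
  then show "compact_operator (A + C - (B + D))"
    using compact_operator_add[of "A - B" "C - D"] by (simp add: algebra_simps)
qed

lift_definition uminus_calkin :: "'a calkin \<Rightarrow> 'a calkin" is uminus
proof -
  fix A B :: "'a \<Rightarrow>\<^sub>L 'a"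
  assume "compact_operator (A - B)"
  then show "compact_operator (- A - - B)"
    using compact_operator_uminus[of "A - B"] by simp
qed

lift_definition minus_calkin :: "'a calkin \<Rightarrow> 'a calkin \<Rightarrow> 'a calkin" is "(-)"
proof -
  fix A B C D :: "'a \<Rightarrow>\<^sub>L 'a"
  assume "compact_operator (A - B)" "compact_operator (C - D)"
  then show "compact_operator (A - C - (B - D))"
    using compact_operator_diff[of "A - B" "C - D"] by (simp add: algebra_simps)
qed

lift_definition scaleR_calkin :: "real \<Rightarrow> 'a calkin \<Rightarrow> 'a calkin" is "(*\<^sub>R)"
proof -
  fix r and A B :: "'a \<Rightarrow>\<^sub>L 'a"
  assume "compact_operator (A - B)"
  then show "compact_operator (r *\<^sub>R A - r *\<^sub>R B)"
    using compact_operator_scaleR[of "A - B" r] by (simp add: scaleR_diff_right)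
qed

lift_definition times_calkin :: "'a calkin \<Rightarrow> 'a calkin \<Rightarrow> 'a calkin" is "(o\<^sub>L)"
proof -
  fix A B C D :: "'a \<Rightarrow>\<^sub>L 'a"
  assume *: "compact_operator (A - B)" "compact_operator (C - D)"
  have "(A o\<^sub>L C) - (B o\<^sub>L D) = ((A - B) o\<^sub>L C) + (B o\<^sub>L (C - D))"
    by (rule blinfun_eqI) (simp add: blinfun.diff_left blinfun.add_left blinfun.diff_right)
  then show "compact_operator ((A o\<^sub>L C) - (B o\<^sub>L D))"
    using * by (simp add: compact_operator_add compact_operator_compose_left
        compact_operator_compose_right)
qed

instance
  by standard (transfer; simp add: algebra_simps compact_operator_zero)+

end

lemma calkin_exhaust: obtains A where "X = quot A"
  by (metis Quotient3_abs_rep Quotient3_calkin)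

lemma calkin_surj: "\<exists>A. quot A = X"
  by (metis calkin_exhaust)

lemma quot_simps:
  "quot 0 = 0" "quot id_blinfun = 1" "quot A + quot B = quot (A + B)"
  "- quot A = quot (- A)" "quot A - quot B = quot (A - B)" "r *\<^sub>R quot A = quot (r *\<^sub>R A)"
  "quot A * quot B = quot (A o\<^sub>L B)"
  by (simp_all add: zero_calkin.abs_eq one_calkin.abs_eq plus_calkin.abs_eq
      uminus_calkin.abs_eq minus_calkin.abs_eq scaleR_calkin.abs_eq times_calkin.abs_eq)

instantiation calkin :: (banach) "{real_normed_algebra, monoid_mult}"
begin

definition norm_calkin :: "'a calkin \<Rightarrow> real" where
  "norm_calkin X = Inf (norm ` {A. quot A = X})"

definition dist_calkin :: "'a calkin \<Rightarrow> 'a calkin \<Rightarrow> real" where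
  "dist_calkin X Y = norm (X - Y)"

definition sgn_calkin :: "'a calkin \<Rightarrow> 'a calkin" where
  "sgn_calkin X = X /\<^sub>R norm X"

definition uniformity_calkin :: "('a calkin \<times> 'a calkin) filter" where
  "uniformity_calkin = (INF e\<in>{0 <..}. principal {(x, y). dist x y < e})"

definition open_calkin :: "'a calkin set \<Rightarrow> bool" where
  "open_calkin U \<longleftrightarrow> (\<forall>x\<in>U. eventually (\<lambda>(x', y). x' = x \<longrightarrow> y \<in> U) uniformity)"

lemma calkin_norm_le: "norm (quot A) \<le> norm A"
  unfolding norm_calkin_def by (rule cInf_lower) (auto intro!: bdd_belowI[of _ 0])

lemma calkin_norm_nonneg: "0 \<le> norm (X :: 'a calkin)"
  unfolding norm_calkin_def
  by (rule cInf_greatest) (use calkin_surj in auto)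

lemma calkin_norm_approx:
  assumes "norm (X :: 'a calkin) < e"
  obtains A where "X = quot A" "norm A < e"
proof -
  have "norm ` {A. quot A = X} \<noteq> {}" using calkin_surj by auto
  then obtain y where "y \<in> norm ` {A. quot A = X}" "y < e"
    using assms unfolding norm_calkin_def by (meson cInf_lessD)
  with that show ?thesis by auto
qed

instance
proof
  fix X Y Z :: "'a calkin" and r :: real
  show "dist X Y = norm (X - Y)" by (rule dist_calkin_def)
  show "sgn X = X /\<^sub>R norm X" by (rule sgn_calkin_def)
  show "uniformity = (INF e\<in>{0 <..}. principal {(x :: 'a calkin, y). dist x y < e})"
    by (rule uniformity_calkin_def)
  show "open U \<longleftrightarrow> (\<forall>x\<in>U. eventually (\<lambda>(x', y). x' = x \<longrightarrow> y \<in> U) uniformity)"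
    for U :: "'a calkin set" by (rule open_calkin_def)
  show "norm X = 0 \<longleftrightarrow> X = 0"
  proof
    assume "X = 0"
    then have "norm X \<le> 0" using calkin_norm_le[of 0] by (simp add: quot_simps)
    then show "norm X = 0" using calkin_norm_nonneg[of X] by simp
  next
    assume X0: "norm X = 0"
    obtain A where A: "X = quot A" by (rule calkin_exhaust)
    have "compact_operator A"
    proof (rule compact_operator_limit)
      fix e :: real assume "e > 0"
      then obtain B where B: "X = quot B" "norm B < e"
        using calkin_norm_approx[of X e] X0 by auto
      then have "compact_operator (A - B)" using A by (simp add: quot_eq_iff)
      with B show "\<exists>K. compact_operator K \<and> norm (A - K) < e"
        by (intro exI[of _ "A - B"]) simp
    qed
    then show "X = 0" using A quot_eq_iff[of A 0] by (simp add: quot_simps)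
  qed
  show "norm (X + Y) \<le> norm X + norm Y"
  proof (rule field_le_epsilon)
    fix e :: real assume "e > 0"
    obtain A where A: "X = quot A" "norm A < norm X + e/2"
      using \<open>e > 0\<close> by (auto intro: calkin_norm_approx[of X "norm X + e/2"])
    obtain B where B: "Y = quot B" "norm B < norm Y + e/2"
      using \<open>e > 0\<close> by (auto intro: calkin_norm_approx[of Y "norm Y + e/2"])
    have "norm (X + Y) \<le> norm (A + B)" using A B by (simp add: quot_simps calkin_norm_le)
    also have "\<dots> \<le> norm A + norm B" by (rule norm_triangle_ineq)
    finally show "norm (X + Y) \<le> norm X + norm Y + e" using A B by linarith
  qed
  have scale_le: "norm (s *\<^sub>R V) \<le> \<bar>s\<bar> * norm V" for s and V :: "'a calkin"
  proof (cases "s = 0")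
    case True
    then show ?thesis using calkin_norm_le[of 0] by (simp add: quot_simps)
  next
    case False
    show ?thesis
    proof (rule field_le_epsilon)
      fix e :: real assume "e > 0"
      obtain A where A: "V = quot A" "norm A < norm V + e/\<bar>s\<bar>"
        using \<open>e > 0\<close> False by (auto intro: calkin_norm_approx[of V "norm V + e/\<bar>s\<bar>"])
      have "norm (s *\<^sub>R V) \<le> norm (s *\<^sub>R A)" unfolding A(1) quot_simps by (rule calkin_norm_le)
      also have "\<dots> = \<bar>s\<bar> * norm A" by simp
      also have "\<dots> \<le> \<bar>s\<bar> * (norm V + e/\<bar>s\<bar>)" using A by (intro mult_left_mono) auto
      also have "\<dots> = \<bar>s\<bar> * norm V + e" using False by (simp add: field_simps)
      finally show "norm (s *\<^sub>R V) \<le> \<bar>s\<bar> * norm V + e" .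
    qed
  qed
  show "norm (r *\<^sub>R X) = \<bar>r\<bar> * norm X"
  proof (cases "r = 0")
    case True
    then show ?thesis
      using scale_le[of 0 X] calkin_norm_nonneg[of "0 *\<^sub>R X"] by simp
  next
    case False
    have "norm X \<le> \<bar>inverse r\<bar> * norm (r *\<^sub>R X)"
      using scale_le[of "inverse r" "r *\<^sub>R X"] False by simp
    then have "\<bar>r\<bar> * norm X \<le> norm (r *\<^sub>R X)"
      using False by (simp add: field_simps)
    with scale_le[of r X] show ?thesis by simp
  qed
  show "norm (X * Y) \<le> norm X * norm Y"
  proof (rule field_le_epsilon)
    fix e :: real assume "e > 0"
    define d where "d = min 1 (e / (norm X + norm Y + 1))"
    have pos: "norm X + norm Y + 1 > 0"
      using calkin_norm_nonneg[of X] calkin_norm_nonneg[of Y] by linarith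
    have "d \<le> e / (norm X + norm Y + 1)" by (simp add: d_def)
    then have "d * (norm X + norm Y + 1) \<le> e" using pos by (simp only: pos_le_divide_eq)
    moreover have "d > 0" "d \<le> 1" using \<open>e > 0\<close> pos by (simp_all add: d_def)
    ultimately have d: "d > 0" "d \<le> 1" "d * (norm X + norm Y + 1) \<le> e" by simp_all
    obtain A where A: "X = quot A" "norm A < norm X + d"
      using d by (auto intro: calkin_norm_approx[of X "norm X + d"])
    obtain B where B: "Y = quot B" "norm B < norm Y + d"
      using d by (auto intro: calkin_norm_approx[of Y "norm Y + d"])
    have "norm (X * Y) \<le> norm (A o\<^sub>L B)" using A B by (simp add: quot_simps calkin_norm_le)
    also have "\<dots> \<le> norm A * norm B" by (rule norm_blinfun_compose)
    also have "\<dots> \<le> (norm X + d) * (norm Y + d)"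
      using A B calkin_norm_nonneg[of X] d by (intro mult_mono) auto
    also have "\<dots> = norm X * norm Y + d * (norm X + norm Y + d)" by (simp add: algebra_simps)
    also have "\<dots> \<le> norm X * norm Y + d * (norm X + norm Y + 1)"
      using d by (intro add_left_mono mult_left_mono) auto
    also have "\<dots> \<le> norm X * norm Y + e" using d by simp
    finally show "norm (X * Y) \<le> norm X * norm Y + e" .
  qed
  obtain A B C where ABC: "X = quot A" "Y = quot B" "Z = quot C"
    by (metis calkin_exhaust)
  show "X * Y * Z = X * (Y * Z)"
    unfolding ABC quot_simps by (rule arg_cong[of _ _ quot], rule blinfun_eqI) simp
  show "(X + Y) * Z = X * Z + Y * Z"
    unfolding ABC quot_simps
    by (rule arg_cong[of _ _ quot], rule blinfun_eqI) (simp add: blinfun.add_left)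
  show "X * (Y + Z) = X * Y + X * Z"
    unfolding ABC quot_simps
    by (rule arg_cong[of _ _ quot], rule blinfun_eqI) (simp add: blinfun.bilinear_simps)
  show "r *\<^sub>R X * Y = r *\<^sub>R (X * Y)"
    unfolding ABC quot_simps
    by (rule arg_cong[of _ _ quot], rule blinfun_eqI) (simp add: blinfun.bilinear_simps)
  show "X * r *\<^sub>R Y = r *\<^sub>R (X * Y)"
    unfolding ABC quot_simps
    by (rule arg_cong[of _ _ quot], rule blinfun_eqI) (simp add: blinfun.bilinear_simps)
  show "1 * X = X"
    unfolding ABC quot_simps(2)[symmetric] quot_simps(7)
    by (rule arg_cong[of _ _ quot], rule blinfun_eqI) simp
  show "X * 1 = X"
    unfolding ABC quot_simps(2)[symmetric] quot_simps(7)
    by (rule arg_cong[of _ _ quot], rule blinfun_eqI) simp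
qed

end


section \<open>Banach spaces over the reals and over the complex numbers\<close>

text \<open>
  A Banach space E over a field K, real or complex, is described by data on top of its type 'a
  (a real Banach space): its scalar multiplication over K, and the operators on a complex Banach
  space, on a type 'c, which is the complexification of E if K is real and E itself if K is
  complex. \<open>im_unit\<close> is multiplication by the imaginary unit on that complex space, and \<open>cx_op\<close>
  sends an operator on E to the induced operator on it. Only \<open>real_space\<close> and \<open>complex_space\<close> below
  are meant as values.
\<close>

record (overloaded) ('k, 'a, 'c) kspace =
  scal :: "'k \<Rightarrow> 'a \<Rightarrow> 'a"
  im_unit :: "'c \<Rightarrow>\<^sub>L 'c"
  cx_op :: "('a \<Rightarrow>\<^sub>L 'a) \<Rightarrow> ('c \<Rightarrow>\<^sub>L 'c)"

text \<open>
  In the complexification, (x, y) stands for x + i y. The product norm of the library is only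
  equivalent to a complex norm, which is immaterial for spectra, Fredholm operators and integrals.
\<close>

definition real_space :: "(real, 'a::banach, 'a \<times> 'a) kspace" where
  "real_space = \<lparr>scal = (*\<^sub>R),
     im_unit = Blinfun (\<lambda>(x, y). (- y, x)),
     cx_op = (\<lambda>A. Blinfun (\<lambda>(x, y). (blinfun_apply A x, blinfun_apply A y)))\<rparr>"

locale complex_banach_space = vector_space s
  for s :: "complex \<Rightarrow> 'a::banach \<Rightarrow> 'a" +
  assumes scale_of_real: "s (of_real r) x = r *\<^sub>R x"
    and norm_scale: "norm (s z x) = cmod z * norm x"

definition complex_space ::
    "(complex \<Rightarrow> 'a::banach \<Rightarrow> 'a) \<Rightarrow> (complex, 'a, 'a) kspace" where
  "complex_space s = \<lparr>scal = s, im_unit = Blinfun (s \<i>), cx_op = (\<lambda>A. A)\<rparr>"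

lemma im_unit_real_space: "blinfun_apply (im_unit real_space) (x, y) = (- y, x)"
proof -
  have "bounded_linear (\<lambda>z :: 'a \<times> 'a. (- snd z, fst z))"
    by (intro bounded_linear_intros bounded_linear_Pair bounded_linear_minus
        bounded_linear_fst bounded_linear_snd)
  then show ?thesis
    by (simp add: real_space_def case_prod_unfold bounded_linear_Blinfun_apply)
qed

lemma cx_op_real_space:
  "blinfun_apply (cx_op real_space A) (x, y) = (blinfun_apply A x, blinfun_apply A y)"
proof -
  have "bounded_linear (\<lambda>z :: 'a \<times> 'a. (blinfun_apply A (fst z), blinfun_apply A (snd z)))"
    by (intro bounded_linear_Pair blinfun.bounded_linear_right
        bounded_linear_compose[OF blinfun.bounded_linear_right]
        bounded_linear_fst bounded_linear_snd)
  then show ?thesis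
    by (simp add: real_space_def case_prod_unfold bounded_linear_Blinfun_apply)
qed

lemma (in complex_banach_space) bounded_linear_scale: "bounded_linear (s z)"
proof (rule bounded_linear_intro)
  fix r x
  have "s z (s (of_real r) x) = s (of_real r) (s z x)"
    by (simp add: mult.commute)
  then show "s z (r *\<^sub>R x) = r *\<^sub>R s z x" by (simp only: scale_of_real)
  show "norm (s z x) \<le> norm x * cmod z" by (simp add: norm_scale)
qed (rule scale_right_distrib)

lemma (in complex_banach_space) im_unit_complex_space:
  "blinfun_apply (im_unit (complex_space s)) x = s \<i> x"
  by (simp add: complex_space_def bounded_linear_Blinfun_apply bounded_linear_scale)

definition operators :: "('k, 'a::banach, 'c) kspace \<Rightarrow> ('a \<Rightarrow>\<^sub>L 'a) set" where
  "operators E = {A. \<forall>k x. blinfun_apply A (scal E k x) = scal E k (blinfun_apply A x)}"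

text \<open>
  The quotient of the operators on E by the compact ones, realised as a subalgebra of the quotient
  of all real linear operators; see \<open>norm_quot_complex\<close> for the norm if E is complex.
\<close>

definition calkin_algebra :: "('k, 'a::banach, 'c) kspace \<Rightarrow> 'a calkin set" where
  "calkin_algebra E = quot ` operators E"

definition projectors :: "('k, 'a::banach, 'c) kspace \<Rightarrow> ('a \<Rightarrow>\<^sub>L 'a) set" where
  "projectors E = {P \<in> operators E. P o\<^sub>L P = P}"

definition calkin_projectors :: "('k, 'a::banach, 'c) kspace \<Rightarrow> 'a calkin set" where
  "calkin_projectors E = {e \<in> calkin_algebra E. e * e = e}"

lemma (in complex_banach_space) norm_quot_complex:
  assumes A: "A \<in> operators (complex_space s)"
  shows "norm (quot A) =
    Inf {norm (A - K) | K. K \<in> operators (complex_space s) \<and> compact_operator K}"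
    (is "_ = Inf ?S")
proof (rule antisym)
  have "norm (A - 0) \<in> ?S"
    using compact_operator_zero by (force simp: operators_def complex_space_def)
  then have ne: "?S \<noteq> {}" by blast
  show "norm (quot A) \<le> Inf ?S"
  proof (rule cInf_greatest[OF ne])
    fix y assume "y \<in> ?S"
    then obtain K where K: "y = norm (A - K)" "compact_operator K" by blast
    then have "quot A = quot (A - K)" by (simp add: quot_eq_iff)
    then show "norm (quot A) \<le> y" using K calkin_norm_le[of "A - K"] by simp
  qed
  show "Inf ?S \<le> norm (quot A)"
  proof (rule field_le_epsilon)
    fix e :: real assume "e > 0"
    obtain B where B: "quot A = quot B" "norm B < norm (quot A) + e"
      using \<open>e > 0\<close> by (auto intro: calkin_norm_approx[of "quot A" "norm (quot A) + e"])
    define J where "J = Blinfun (s \<i>)"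
    have J: "blinfun_apply J x = s \<i> x" for x
      by (simp add: J_def bounded_linear_Blinfun_apply bounded_linear_scale)
    have ii: "s \<i> (s \<i> x) = - x" for x
      using scale_of_real[of "- 1" x] by simp
    have nJ: "norm J \<le> 1" by (rule norm_blinfun_bound) (simp_all add: J norm_scale)
    define C where "C = (1/2) *\<^sub>R (B - (J o\<^sub>L B o\<^sub>L J))"
    have sadd: "s z x = Re z *\<^sub>R x + Im z *\<^sub>R s \<i> x" for z x
    proof -
      have "s z x = s (of_real (Re z) + of_real (Im z) * \<i>) x"
        by (simp add: complex_eq mult.commute)
      also have "\<dots> = s (of_real (Re z)) x + s (of_real (Im z)) (s \<i> x)"
        by (simp only: scale_left_distrib scale_scale)
      finally show ?thesis by (simp only: scale_of_real)
    qed
    have iadd: "s \<i> (x - y) = s \<i> x - s \<i> y" "s \<i> (r *\<^sub>R x) = r *\<^sub>R s \<i> x" "s \<i> (- x) = - s \<i> x"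
      for x y r
      using linear_simps[OF bounded_linear_scale[of \<i>]] by auto
    have Ci: "C (s \<i> x) = s \<i> (C x)" for x
      by (simp add: C_def blinfun.bilinear_simps J ii iadd)
    have "C (s z x) = s z (C x)" for z x
    proof -
      have "C (s z x) = C (Re z *\<^sub>R x + Im z *\<^sub>R s \<i> x)" by (subst sadd) (rule refl)
      also have "\<dots> = Re z *\<^sub>R C x + Im z *\<^sub>R s \<i> (C x)"
        by (simp only: blinfun.add_right blinfun.scaleR_right Ci)
      also have "\<dots> = s z (C x)" by (rule sadd[symmetric])
      finally show ?thesis .
    qed
    then have C: "C \<in> operators (complex_space s)"
      by (simp add: operators_def complex_space_def)
    have JAJ: "J o\<^sub>L A o\<^sub>L J = - A"
    proof (rule blinfun_eqI)
      fix x
      have "A (s \<i> x) = s \<i> (A x)" using A by (simp add: operators_def complex_space_def)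
      then show "(J o\<^sub>L A o\<^sub>L J) x = (- A) x" by (simp add: J ii blinfun.minus_left)
    qed
    have "compact_operator (A - B)" using B by (simp add: quot_eq_iff)
    moreover have "A - C = (1/2) *\<^sub>R ((A - B) - (J o\<^sub>L (A - B) o\<^sub>L J))"
    proof (rule blinfun_eqI)
      fix x
      have "s \<i> (A (s \<i> x)) = - A x" using JAJ
        by (metis J blinfun_apply_blinfun_compose blinfun.minus_left)
      then show "(A - C) x = ((1/2) *\<^sub>R ((A - B) - (J o\<^sub>L (A - B) o\<^sub>L J))) x"
        by (simp add: C_def blinfun.bilinear_simps J iadd algebra_simps)
           (simp add: scaleR_add_left[symmetric])
    qed
    ultimately have "compact_operator (A - C)"
      by (simp add: compact_operator_scaleR compact_operator_diff compact_operator_compose_left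
          compact_operator_compose_right)
    moreover have "A - C \<in> operators (complex_space s)"
      using A C by (simp add: operators_def complex_space_def blinfun.bilinear_simps
          scale_right_diff_distrib)
    ultimately have "norm (A - (A - C)) \<in> ?S" by blast
    moreover have "bdd_below ?S" by (auto intro!: bdd_belowI[of _ 0])
    ultimately have "Inf ?S \<le> norm C" by (metis (lifting) cInf_lower diff_diff_eq2 add_diff_cancel_left')
    also have "norm C \<le> (norm B + norm (J o\<^sub>L B o\<^sub>L J)) / 2"
      unfolding C_def by (simp add: norm_triangle_ineq4)
    also have "norm (J o\<^sub>L B o\<^sub>L J) \<le> (norm J * norm B) * norm J"
      by (meson norm_blinfun_compose mult_right_mono norm_ge_zero order_trans)
    also have "\<dots> \<le> (1 * norm B) * 1"
      using nJ by (intro mult_mono) auto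
    finally show "Inf ?S \<le> norm (quot A) + e" using B by simp
  qed
qed


section \<open>Spectra and spectral idempotents\<close>

text \<open>
  A complex unital algebra is given by its multiplicative monoid G, on a type which provides the
  real linear structure, and by the element j = i 1.
\<close>

definition cscalar :: "('b::real_vector) monoid \<Rightarrow> 'b \<Rightarrow> complex \<Rightarrow> 'b" where
  "cscalar G j z = Re z *\<^sub>R \<one>\<^bsub>G\<^esub> + Im z *\<^sub>R j"

definition spectrum :: "('b::real_vector) monoid \<Rightarrow> 'b \<Rightarrow> 'b \<Rightarrow> complex set" where
  "spectrum G j a = {z. cscalar G j z - a \<notin> Units G}"

text \<open>
  The Riesz integral of the resolvent divided by 2 pi i, for the part of the spectrum in the open
  right half plane. If this part is closed, a circle inside the half plane surrounds it.
\<close>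

definition spectral_idempotent ::
    "('b::real_normed_vector) monoid \<Rightarrow> 'b \<Rightarrow> 'b \<Rightarrow> 'b" where
  "spectral_idempotent G j a = (THE e. \<exists>c r. 0 < r \<and>
     cball c r \<subseteq> {z. 0 < Re z} \<and> spectrum G j a \<inter> {z. 0 < Re z} \<subseteq> ball c r \<and>
     ((\<lambda>t. cscalar G j (vector_derivative (circlepath c r) (at t) / (2 * of_real pi * \<i>))
            \<otimes>\<^bsub>G\<^esub> inv\<^bsub>G\<^esub> (cscalar G j (circlepath c r t) - a))
       has_integral e) {0..1})"

definition cx_operator_monoid :: "('k, 'a, 'c::banach) kspace \<Rightarrow> ('c \<Rightarrow>\<^sub>L 'c) monoid" where
  "cx_operator_monoid E =
     \<lparr>carrier = {T. T o\<^sub>L im_unit E = im_unit E o\<^sub>L T}, monoid.mult = (o\<^sub>L), one = id_blinfun\<rparr>"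

text \<open>For real E, the Calkin algebra of the complexification of E is the complexification of the
  Calkin algebra of E.\<close>

definition cx_calkin_monoid :: "('k, 'a, 'c::banach) kspace \<Rightarrow> 'c calkin monoid" where
  "cx_calkin_monoid E =
     \<lparr>carrier = quot ` carrier (cx_operator_monoid E), monoid.mult = (*), one = 1\<rparr>"


section \<open>Fredholm operators and relative dimension\<close>

definition finite_dimensional :: "('k::field \<Rightarrow> 'v::ab_group_add \<Rightarrow> 'v) \<Rightarrow> 'v set \<Rightarrow> bool" where
  "finite_dimensional s V \<longleftrightarrow> (\<exists>B. finite B \<and> module.span s B = V)"

definition is_complement ::
    "('k::field \<Rightarrow> 'v::ab_group_add \<Rightarrow> 'v) \<Rightarrow> 'v set \<Rightarrow> 'v set \<Rightarrow> 'v set \<Rightarrow> bool" where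
  "is_complement s V W C \<longleftrightarrow>
     module.subspace s C \<and> W \<inter> C = {0} \<and> {w + c | w c. w \<in> W \<and> c \<in> C} = V"

definition finite_codimensional ::
    "('k::field \<Rightarrow> 'v::ab_group_add \<Rightarrow> 'v) \<Rightarrow> 'v set \<Rightarrow> 'v set \<Rightarrow> bool" where
  "finite_codimensional s V W \<longleftrightarrow> (\<exists>C. is_complement s V W C \<and> finite_dimensional s C)"

text \<open>The dimension of V/W, all complements of W in V being isomorphic to V/W.\<close>

definition codimension :: "('k::field \<Rightarrow> 'v::ab_group_add \<Rightarrow> 'v) \<Rightarrow> 'v set \<Rightarrow> 'v set \<Rightarrow> nat" where
  "codimension s V W = (THE n. \<exists>C. is_complement s V W C \<and> vector_space.dim s C = n)"

definition fredholm ::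
    "('k::field \<Rightarrow> 'v::ab_group_add \<Rightarrow> 'v) \<Rightarrow> 'v set \<Rightarrow> 'v set \<Rightarrow> ('v \<Rightarrow> 'v) \<Rightarrow> bool" where
  "fredholm s V W T \<longleftrightarrow>
     finite_dimensional s {x \<in> V. T x = 0} \<and> finite_codimensional s W (T ` V)"

definition fredholm_index ::
    "('k::field \<Rightarrow> 'v::ab_group_add \<Rightarrow> 'v) \<Rightarrow> 'v set \<Rightarrow> 'v set \<Rightarrow> ('v \<Rightarrow> 'v) \<Rightarrow> int" where
  "fredholm_index s V W T =
     int (vector_space.dim s {x \<in> V. T x = 0}) - int (codimension s W (T ` V))"

definition relative_dimension ::
    "('k::field, 'a::banach, 'c) kspace \<Rightarrow> ('a \<Rightarrow>\<^sub>L 'a) \<Rightarrow> ('a \<Rightarrow>\<^sub>L 'a) \<Rightarrow> int" where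
  "relative_dimension E Q R =
     fredholm_index (scal E) (range (blinfun_apply Q)) (range (blinfun_apply R)) (blinfun_apply R)"

definition cx_scale :: "('k, 'a, 'c::banach) kspace \<Rightarrow> complex \<Rightarrow> 'c \<Rightarrow> 'c" where
  "cx_scale E z x = Re z *\<^sub>R x + Im z *\<^sub>R blinfun_apply (im_unit E) x"

definition ess_hyperbolic :: "('k, 'a::banach, 'c::banach) kspace \<Rightarrow> ('a \<Rightarrow>\<^sub>L 'a) set" where
  "ess_hyperbolic E = {A \<in> operators E. \<forall>z. Re z = 0 \<longrightarrow>
     fredholm (cx_scale E) UNIV UNIV (\<lambda>x. blinfun_apply (cx_op E A) x - cx_scale E z x)}"


section \<open>The map to idempotents of the Calkin algebra, and spectral flow\<close>

definition Psi :: "('k, 'a::banach, 'c::banach) kspace \<Rightarrow> ('a \<Rightarrow>\<^sub>L 'a) \<Rightarrow> 'a calkin" where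
  "Psi E A = (THE e. \<exists>B \<in> operators E. e = quot B \<and>
     quot (cx_op E B) =
       spectral_idempotent (cx_calkin_monoid E) (quot (im_unit E)) (quot (cx_op E A)))"

definition pos_projector ::
    "('k, 'a::banach, 'c::banach) kspace \<Rightarrow> ('a \<Rightarrow>\<^sub>L 'a) \<Rightarrow> ('a \<Rightarrow>\<^sub>L 'a)" where
  "pos_projector E A = (THE B. B \<in> operators E \<and>
     cx_op E B = spectral_idempotent (cx_operator_monoid E) (im_unit E) (cx_op E A))"

definition is_lift ::
    "('k, 'a::banach, 'c) kspace \<Rightarrow> (real \<Rightarrow> 'a calkin) \<Rightarrow> (real \<Rightarrow> 'a \<Rightarrow>\<^sub>L 'a) \<Rightarrow> bool" where
  "is_lift E a Q \<longleftrightarrow>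
     path Q \<and> path_image Q \<subseteq> projectors E \<and> (\<forall>t\<in>{0..1}. quot (Q t) = a t)"

definition spectral_flow ::
    "('k::field, 'a::banach, 'c::banach) kspace \<Rightarrow> (real \<Rightarrow> 'a \<Rightarrow>\<^sub>L 'a) \<Rightarrow> int" where
  "spectral_flow E A = (THE n. \<exists>Q. is_lift E (Psi E \<circ> A) Q \<and>
     n = relative_dimension E (Q 0) (pos_projector E (A 0))
       - relative_dimension E (Q 1) (pos_projector E (A 1)))"

definition lift_index ::
    "('k::field, 'a::banach, 'c) kspace \<Rightarrow> ('a \<Rightarrow>\<^sub>L 'a) \<Rightarrow> (real \<Rightarrow> 'a calkin) \<Rightarrow> int" where
  "lift_index E P a = (THE n. \<exists>\<beta>. is_lift E a \<beta> \<and> \<beta> 0 = P \<and>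
     n = relative_dimension E (\<beta> 1) (\<beta> 0))"


section \<open>Fundamental groups and the three homomorphisms\<close>

definition loops :: "'x::topological_space set \<Rightarrow> 'x \<Rightarrow> (real \<Rightarrow> 'x) set" where
  "loops S x = {p. path p \<and> path_image p \<subseteq> S \<and> pathstart p = x \<and> pathfinish p = x}"

definition path_class :: "'x::topological_space set \<Rightarrow> (real \<Rightarrow> 'x) \<Rightarrow> (real \<Rightarrow> 'x) set" where
  "path_class S p = {q. homotopic_paths S p q}"

definition fundamental_group ::
    "'x::topological_space set \<Rightarrow> 'x \<Rightarrow> (real \<Rightarrow> 'x) set monoid" where
  "fundamental_group S x =
     \<lparr>carrier = path_class S ` loops S x,
      monoid.mult = (\<lambda>c d. \<Union>p\<in>c. \<Union>q\<in>d. path_class S (p +++ q)),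
      one = path_class S (\<lambda>_. x)\<rparr>"

definition sf_hom ::
    "('k::field, 'a::banach, 'c::banach) kspace \<Rightarrow> (real \<Rightarrow> 'a \<Rightarrow>\<^sub>L 'a) set \<Rightarrow> int" where
  "sf_hom E c = the_elem (spectral_flow E ` c)"

definition phi_hom ::
    "('k::field, 'a::banach, 'c) kspace \<Rightarrow> ('a \<Rightarrow>\<^sub>L 'a) \<Rightarrow> (real \<Rightarrow> 'a calkin) set \<Rightarrow> int" where
  "phi_hom E P c = the_elem (lift_index E P ` c)"

definition Psi_star ::
    "('k, 'a::banach, 'c::banach) kspace \<Rightarrow> (real \<Rightarrow> 'a \<Rightarrow>\<^sub>L 'a) set \<Rightarrow> (real \<Rightarrow> 'a calkin) set" where
  "Psi_star E c = (\<Union>A\<in>c. path_class (calkin_projectors E) (Psi E \<circ> A))"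

end

theory Submission
  imports Defs
begin

text \<open>
  If Q is any lift of the loop \<open>\<Psi> \<circ> A\<close> to projectors and \<open>\<beta>\<close> the lift starting at P, then Q(t) and
  \<open>\<beta>(t)\<close> differ by a compact operator, so \<open>[Q(t) - \<beta>(t)]\<close> is locally constant and
  \<open>[Q(0) - P] - [Q(1) - P] = - [\<beta>(1) - P]\<close>; the same comparison shows that the right hand side does
  not depend on the choices and is additive. It rests on three facts. Relative dimension is additive
  and invariant under conjugation, by the product formula for the index and the Riesz theory of
  compact perturbations of the identity. A path of idempotents b close to a path a with lift
  \<open>\<alpha>\<close> lifts to \<open>U \<alpha> U\<^sup>-\<^sup>1\<close>, where U is a lift of \<open>b a + (1 - b) (1 - a)\<close> close to 1; small steps
  give lifts of paths and the homotopy invariance of their end points. Finally \<open>\<Psi>\<close> is well defined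
  and continuous, because Fredholm operators are invertible modulo compact ones and the Riesz
  integral of the resolvent does not depend on the circle and is an idempotent.
\<close>

section \<open>Hahn-Banach, finite rank projections, and open mappings\<close>

text \<open>The notions of the statement are descriptions with \<open>THE\<close>, so nothing can be
  computed before existence and uniqueness are settled: of circle integrals, of the operator under a
  complexified idempotent, of indices of lifts, of codimensions. Two obstacles shape the rest.
  First, real and complex scalars are treated at once, while \<open>calkin\<close> is built from all
  real linear operators. Hence spectral theory takes place in a real Banach algebra with an element
  j whose square is minus the unit, and a lift found over the reals is repaired by a bounded map
  \<open>av\<close> that keeps compact operators compact. Second, the lift of the conjugating path
  must stay near 1 at all times in order to be invertible. This calls for a continuous lifting of
  whole paths through \<open>quot\<close> with control of the norm; it comes from approximate lifts
  whose error is halved at each step, the same iteration as in the open mapping theorem. The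
  projector \<open>pos_projector\<close> is evaluated at the ends of loops, at 2P - I, where the
  resolvent is explicit.\<close>

definition sublinear :: "('a::real_vector \<Rightarrow> real) \<Rightarrow> bool" where
  "sublinear p \<longleftrightarrow> p 0 = 0 \<and> (\<forall>x y. p (x + y) \<le> p x + p y) \<and> (\<forall>r x. 0 < r \<longrightarrow> p (r *\<^sub>R x) \<le> r * p x)"

lemma sublinearD:
  assumes "sublinear p"
  shows "p 0 = 0" "p (x + y) \<le> p x + p y" "0 \<le> r \<Longrightarrow> p (r *\<^sub>R x) = r * p x" "- p (- x) \<le> p x"
proof -
  show 0: "p 0 = 0" and add: "p (x + y) \<le> p x + p y" for x y
    using assms by (auto simp: sublinear_def)
  show "- p (- x) \<le> p x" using add[of x "- x"] 0 by simp
  show "p (r *\<^sub>R x) = r * p x" if "0 \<le> r"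
  proof (cases "r = 0")
    case False
    with that have r: "0 < r" by simp
    have "p x \<le> inverse r * p (r *\<^sub>R x)"
    proof -
      have "p x = p (inverse r *\<^sub>R (r *\<^sub>R x))" using r by simp
      then show ?thesis using assms r by (simp add: sublinear_def del: scaleR_scaleR)
    qed
    then have "r * p x \<le> p (r *\<^sub>R x)" using r by (simp add: field_simps)
    moreover have "p (r *\<^sub>R x) \<le> r * p x" using assms r by (simp add: sublinear_def)
    ultimately show ?thesis by simp
  qed (simp add: 0)
qed

text \<open>The shift is the infimum over t >= 0 of \<open>p (x + t *\<^sub>R b) - t * p b\<close>.
  It exists since these values are at least \<open>- p (- x)\<close>; t = 0 puts it below p, and t =
  1 gives the bound at \<open>- b\<close>.\<close>

lemma sublinear_shift:
  assumes p: "sublinear p"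
  obtains q where "sublinear q" "\<And>x. q x \<le> p x" "q (- b) \<le> - p b"
proof -
  define F where "F x t = p (x + t *\<^sub>R b) - t * p b" for x t
  define q where "q x = (INF t\<in>{0..}. F x t)" for x
  have below: "- p (- x) \<le> F x t" if "0 \<le> t" for x t
    using sublinearD(2)[OF p, of "x + t *\<^sub>R b" "- x"] sublinearD(3)[OF p that, of b]
    by (simp add: F_def)
  have bdd: "bdd_below (F x ` {0..})" for x
    using below by (intro bdd_belowI2[of _ "- p (- x)"]) auto
  have q_le: "q x \<le> F x t" if "0 \<le> t" for x t
    unfolding q_def using that by (intro cINF_lower bdd) auto
  have q_ge: "c \<le> q x" if "\<And>t. 0 \<le> t \<Longrightarrow> c \<le> F x t" for c x
    unfolding q_def using that by (intro cINF_greatest) auto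
  have "sublinear q"
    unfolding sublinear_def
  proof (intro conjI allI impI)
    have "F 0 t = 0" if "0 \<le> t" for t
      using sublinearD(3)[OF p that, of b] by (simp add: F_def)
    then show "q 0 = 0" using q_le[of 0 0] q_ge[of 0 0] by fastforce
  next
    fix x y
    \<comment> \<open>The parameter t + u at x + y serves any pair t, u, so the two infima can be
      taken one after the other.\<close>
    have "q (x + y) \<le> F x t + F y u" if "0 \<le> t" "0 \<le> u" for t u
    proof -
      have "q (x + y) \<le> F (x + y) (t + u)" using that by (intro q_le) simp
      also have "\<dots> \<le> F x t + F y u"
        using sublinearD(2)[OF p, of "x + t *\<^sub>R b" "y + u *\<^sub>R b"]
        by (simp add: F_def algebra_simps)
      finally show ?thesis .
    qed
    then have "q (x + y) - F x t \<le> q y" if "0 \<le> t" for t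
      using that by (intro q_ge) (simp add: algebra_simps)
    then have "q (x + y) - q y \<le> q x" by (intro q_ge) (simp add: algebra_simps)
    then show "q (x + y) \<le> q x + q y" by simp
  next
    fix r :: real and x assume r: "0 < r"
    have "q (r *\<^sub>R x) / r \<le> F x t" if "0 \<le> t" for t
    proof -
      have "q (r *\<^sub>R x) \<le> F (r *\<^sub>R x) (r * t)" using that r by (intro q_le) simp
      also have "F (r *\<^sub>R x) (r * t) = r * F x t"
        using sublinearD(3)[OF p, of r "x + t *\<^sub>R b"] r by (simp add: F_def algebra_simps)
      finally show ?thesis using r by (simp add: field_simps)
    qed
    then have "q (r *\<^sub>R x) / r \<le> q x" by (rule q_ge)
    then show "q (r *\<^sub>R x) \<le> r * q x" using r by (simp add: field_simps)
  qed
  moreover have "q x \<le> p x" for x using q_le[of 0 x] by (simp add: F_def)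
  moreover have "q (- b) \<le> - p b"
    using q_le[of 1 "- b"] sublinearD(1)[OF p] by (simp add: F_def)
  ultimately show thesis using that by blast
qed

text \<open>A minimal sublinear functional agrees with all its shifts, hence is odd, hence linear.\<close>

lemma linear_minorant:
  assumes p: "sublinear p"
  shows "\<exists>f. linear f \<and> (\<forall>x. f x \<le> p x)"
proof -
  define A where "A = {q. sublinear q \<and> (\<forall>x. q x \<le> p x)}"
  \<comment> \<open>The order is reversed: a maximal element for P, as Zorn's lemma provides it, is
    a minimal functional.\<close>
  define P where "P = (\<lambda>f g :: 'a \<Rightarrow> real. \<forall>x. g x \<le> f x)"
  have "\<exists>m\<in>A. \<forall>a\<in>A. P m a \<longrightarrow> a = m"
  proof (rule predicate_Zorn)
    show "partial_order_on A (relation_of P A)"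
      by (rule partial_order_on_relation_ofI) (auto simp: P_def fun_eq_iff intro: order_trans antisym)
  next
    fix C assume C: "C \<in> Chains (relation_of P A)"
    then have CA: "q \<in> A" if "q \<in> C" for q
      using that by (auto simp: Chains_def relation_of_def)
    have chain: "P f g \<or> P g f" if "f \<in> C" "g \<in> C" for f g
      using C that by (auto simp: Chains_def relation_of_def)
    show "\<exists>u\<in>A. \<forall>a\<in>C. P a u"
    proof (cases "C = {}")
      case True
      then show ?thesis using p by (auto simp: A_def)
    next
      case False
      define u where "u x = (INF q\<in>C. q x)" for x
      have sl: "sublinear q" and qp: "q x \<le> p x" if "q \<in> C" for q x
        using CA[OF that] by (auto simp: A_def)
      have below: "- p (- x) \<le> q x" if "q \<in> C" for q x
        using sublinearD(4)[OF sl[OF that], of x] qp[OF that, of "- x"] by linarith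
      have u_le: "u x \<le> q x" if "q \<in> C" for q x
        unfolding u_def using that below by (intro cINF_lower bdd_belowI2[of _ "- p (- x)"]) auto
      have u_ge: "c \<le> u x" if "\<And>q. q \<in> C \<Longrightarrow> c \<le> q x" for c x
        unfolding u_def using that False by (intro cINF_greatest) auto
      have "sublinear u"
        unfolding sublinear_def
      proof (intro conjI allI impI)
        obtain q where "q \<in> C" using False by blast
        then have "u 0 \<le> 0" using u_le[of q 0] sublinearD(1)[OF sl, of q] by simp
        moreover have "0 \<le> u 0" by (rule u_ge) (simp add: sublinearD(1)[OF sl])
        ultimately show "u 0 = 0" by simp
      next
        fix x y
        \<comment> \<open>The smaller of f and g in the chain is evaluated at both points.\<close>
        have "u (x + y) \<le> f x + g y" if fg: "f \<in> C" "g \<in> C" for f g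
        proof (cases "P f g")
          case True
          then have "g x \<le> f x" by (simp add: P_def)
          then show ?thesis
            using u_le[OF fg(2), of "x + y"] sublinearD(2)[OF sl[OF fg(2)], of x y] by linarith
        next
          case False
          then have "f y \<le> g y" using chain fg by (auto simp: P_def)
          then show ?thesis
            using u_le[OF fg(1), of "x + y"] sublinearD(2)[OF sl[OF fg(1)], of x y] by linarith
        qed
        then have "u (x + y) - f x \<le> u y" if "f \<in> C" for f
          using that by (intro u_ge) (metis add.commute diff_le_eq)
        then have "u (x + y) - u y \<le> u x" by (intro u_ge) (metis add.commute diff_le_eq)
        then show "u (x + y) \<le> u x + u y" by simp
      next
        fix r :: real and x assume r: "0 < r"
        have "u (r *\<^sub>R x) / r \<le> u x"
        proof (rule u_ge)
          fix q assume "q \<in> C"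
          then show "u (r *\<^sub>R x) / r \<le> q x"
            using u_le[of q "r *\<^sub>R x"] sublinearD(3)[OF sl, of q r x] r by (simp add: field_simps)
        qed
        then show "u (r *\<^sub>R x) \<le> r * u x" using r by (simp add: field_simps)
      qed
      moreover have "u x \<le> p x" for x using False u_le qp by (meson all_not_in_conv order_trans)
      ultimately show ?thesis using u_le by (auto simp: A_def P_def)
    qed
  qed
  then obtain m where m: "m \<in> A" "\<And>a. a \<in> A \<Longrightarrow> P m a \<Longrightarrow> a = m" by blast
  then have sl: "sublinear m" by (simp add: A_def)
  have odd: "m (- b) = - m b" for b
  proof -
    obtain q where q: "sublinear q" "\<And>x. q x \<le> m x" "q (- b) \<le> - m b"
      using sublinear_shift[OF sl, of b] by blast
    then have "q = m" using m by (intro m(2)) (auto simp: A_def P_def intro: order_trans)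
    then show ?thesis using q(3) sublinearD(4)[OF sl, of b] by simp
  qed
  have "linear m"
  proof (rule linearI)
    fix x y
    have "- m (x + y) \<le> - m x - m y"
      using sublinearD(2)[OF sl, of "- x" "- y"] odd[of "x + y"] by (simp add: odd)
    then show "m (x + y) = m x + m y" using sublinearD(2)[OF sl, of x y] by simp
  next
    fix r x
    show "m (r *\<^sub>R x) = r *\<^sub>R m x"
      using sublinearD(3)[OF sl, of r x] sublinearD(3)[OF sl, of "- r" x] odd[of "r *\<^sub>R x"]
      by (cases "0 \<le> r") auto
  qed
  then show ?thesis using m(1) by (auto simp: A_def)
qed

text \<open>A linear minorant f of the shift q satisfies f(-b) <= q(-b) <= -p(b), which forces f(b)
  >= p(b).\<close>

lemma hahn_banach:
  assumes p: "sublinear p"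
  shows "\<exists>f. linear f \<and> (\<forall>x. f x \<le> p x) \<and> f b = p b"
proof -
  obtain q where q: "sublinear q" "\<And>x. q x \<le> p x" "q (- b) \<le> - p b"
    using sublinear_shift[OF p, of b] by blast
  obtain f where f: "linear f" "\<And>x. f x \<le> q x" using linear_minorant[OF q(1)] by blast
  have "f b = p b"
    using f(2)[of "- b"] f(2)[of b] q(2)[of b] q(3) linear_neg[OF f(1), of b] by simp
  then show ?thesis using f q(2) by (meson order_trans)
qed

text \<open>Hahn-Banach is applied to the distance from M. It vanishes at x and -x for x in M, hence
  so does the functional, and it is positive at b because M is closed; dividing by it gives the
  value 1.\<close>

lemma functional_vanishing_on_subspace:
  fixes M :: "'a::real_normed_vector set"
  assumes "closed M" "subspace M" "b \<notin> M"
  obtains g :: "'a \<Rightarrow>\<^sub>L real" where "blinfun_apply g b = 1" "\<And>x. x \<in> M \<Longrightarrow> blinfun_apply g x = 0"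
proof -
  have ne: "M \<noteq> {}" using subspace_0[OF assms(2)] by blast
  let ?p = "\<lambda>x. infdist x M"
  have "sublinear ?p"
    unfolding sublinear_def
  proof (intro conjI allI impI)
    show "?p 0 = 0" using subspace_0[OF assms(2)] by simp
  next
    fix x y
    show "?p (x + y) \<le> ?p x + ?p y"
    proof (rule field_le_epsilon)
      fix e :: real assume "0 < e"
      have "\<exists>m\<in>M. dist z m < ?p z + e / 2" for z
        using \<open>0 < e\<close> cInf_lessD[of "dist z ` M" "?p z + e / 2"] ne
        by (auto simp: infdist_notempty)
      then obtain m n where mn: "m \<in> M" "n \<in> M" "dist x m < ?p x + e/2" "dist y n < ?p y + e/2"
        by meson
      have "?p (x + y) \<le> dist (x + y) (m + n)"
        using mn subspace_add[OF assms(2)] by (intro infdist_le) auto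
      also have "\<dots> \<le> dist x m + dist y n" by (rule dist_triangle_add)
      finally show "?p (x + y) \<le> ?p x + ?p y + e" using mn by linarith
    qed
  next
    fix r :: real and x assume r: "0 < r"
    have "?p (r *\<^sub>R x) / r \<le> dist x m" if "m \<in> M" for m
    proof -
      have "?p (r *\<^sub>R x) \<le> dist (r *\<^sub>R x) (r *\<^sub>R m)"
        using that subspace_scale[OF assms(2)] by (intro infdist_le) auto
      also have "\<dots> = r * dist x m"
        using r by (simp add: dist_norm flip: scaleR_diff_right)
      finally show ?thesis using r by (simp add: field_simps)
    qed
    then have "?p (r *\<^sub>R x) / r \<le> ?p x" unfolding infdist_notempty[OF ne] by (intro cINF_greatest ne)
    then show "?p (r *\<^sub>R x) \<le> r * ?p x" using r by (simp add: field_simps)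
  qed
  then obtain f where f: "linear f" "\<And>x. f x \<le> ?p x" "f b = ?p b" using hahn_banach by blast
  have pb: "0 < ?p b"
    using assms ne by (metis in_closed_iff_infdist_zero infdist_nonneg order_le_less)
  have p_norm: "?p x \<le> norm x" for x
    using infdist_le[OF subspace_0[OF assms(2)], of x] by simp
  have "bounded_linear f"
  proof (rule bounded_linear_intro)
    show "f (x + y) = f x + f y" for x y by (rule linear_add[OF f(1)])
    show "f (r *\<^sub>R x) = r *\<^sub>R f x" for r x by (rule linear_scale[OF f(1)])
    show "norm (f x) \<le> norm x * 1" for x
      using f(2)[of x] f(2)[of "- x"] p_norm[of x] p_norm[of "- x"] linear_neg[OF f(1), of x]
      by (simp add: abs_le_iff)
  qed
  then have bl: "blinfun_apply (Blinfun f) = f" by (rule bounded_linear_Blinfun_apply)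
  have "f x = 0" if "x \<in> M" for x
    using f(2)[of x] f(2)[of "- x"] that subspace_neg[OF assms(2) that] linear_neg[OF f(1), of x]
    by simp
  then show thesis
    using that[of "inverse (?p b) *\<^sub>R Blinfun f"] pb f(3) by (simp add: bl blinfun.scaleR_left)
qed

section \<open>Finite-rank projections\<close>

lemma compact_operator_rank_one:
  fixes g :: "'a::real_normed_vector \<Rightarrow>\<^sub>L real" and v :: "'b::real_normed_vector"
  shows "compact_operator ((blinfun_scaleR_left v o\<^sub>L g))"
proof -
  have "blinfun_apply ((blinfun_scaleR_left v o\<^sub>L g)) ` cball 0 1 \<subseteq> (\<lambda>r. r *\<^sub>R v) ` cball 0 (norm g)"
  proof (rule image_subsetI)
    fix x :: 'a assume "x \<in> cball 0 1"
    then have "norm (g x) \<le> norm g"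
      using norm_blinfun[of g x] by (metis mem_cball_0 mult.right_neutral mult_left_mono norm_ge_zero order_trans)
    then show "blinfun_apply ((blinfun_scaleR_left v o\<^sub>L g)) x \<in> (\<lambda>r. r *\<^sub>R v) ` cball 0 (norm g)"
      by (intro image_eqI[of _ _ "g x"]) auto
  qed
  moreover have "compact ((\<lambda>r. r *\<^sub>R v) ` cball 0 (norm g))"
    by (intro compact_continuous_image continuous_intros) auto
  ultimately show ?thesis unfolding compact_operator_def by (rule compact_closure_subset)
qed

text \<open>The projection for B shows that its span is closed, as the equaliser of two continuous
  maps, so a functional g separates a new b from it. The rank-one term with g and
  \<open>b - \<pi> b\<close> then makes b a fixed point without disturbing the span of B.\<close>

lemma finite_rank_projection:
  fixes B :: "'a::banach set"
  assumes "finite B"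
  shows "\<exists>\<pi>::'a \<Rightarrow>\<^sub>L 'a. compact_operator \<pi> \<and> range (blinfun_apply \<pi>) \<subseteq> span B \<and> (\<forall>x\<in>span B. \<pi> x = x)"
  using assms
proof induction
  case empty
  show ?case by (rule exI[of _ 0]) (auto simp: compact_operator_zero)
next
  case (insert b B)
  then obtain \<pi> :: "'a \<Rightarrow>\<^sub>L 'a" where \<pi>: "compact_operator \<pi>" "range (blinfun_apply \<pi>) \<subseteq> span B" "\<And>x. x \<in> span B \<Longrightarrow> \<pi> x = x"
    by blast
  show ?case
  proof (cases "b \<in> span B")
    case True
    then show ?thesis using \<pi> by (metis span_redundant)
  next
    case False
    have "span B = {x. \<pi> x - x = 0}" using \<pi>(2,3) by (auto simp: image_subset_iff) metis
    moreover have "closed {x. \<pi> x - x = 0}"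
      by (intro closed_Collect_eq continuous_intros)
    ultimately have "closed (span B)" by simp
    then obtain g :: "'a \<Rightarrow>\<^sub>L real" where g: "g b = 1" "\<And>x. x \<in> span B \<Longrightarrow> g x = 0"
      using functional_vanishing_on_subspace[OF _ subspace_span False] by blast
    define \<rho> where "\<rho> = \<pi> + (blinfun_scaleR_left (b - \<pi> b) o\<^sub>L g)"
    have \<rho>: "\<rho> x = \<pi> x + g x *\<^sub>R (b - \<pi> b)" for x by (simp add: \<rho>_def blinfun.add_left)
    have sub: "span B \<subseteq> span (insert b B)" by (rule span_mono) auto
    have "compact_operator \<rho>"
      unfolding \<rho>_def by (intro compact_operator_add \<pi>(1) compact_operator_rank_one)
    moreover have "\<rho> x \<in> span (insert b B)" for x
    proof -
      have "\<pi> y \<in> span (insert b B)" for y using \<pi>(2) sub by auto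
      moreover have "b \<in> span (insert b B)" by (simp add: span_base)
      ultimately show ?thesis unfolding \<rho> by (intro span_add span_scale span_diff)
    qed
    moreover have "\<rho> x = x" if x: "x \<in> span (insert b B)" for x
    proof -
      obtain k where k: "x - k *\<^sub>R b \<in> span B" using x by (auto simp: span_insert)
      have "\<rho> (x - k *\<^sub>R b) = x - k *\<^sub>R b" using k by (simp add: \<rho> \<pi>(3) g(2))
      moreover have "\<rho> b = b" by (simp add: \<rho> g)
      ultimately show ?thesis by (simp add: blinfun.diff_right blinfun.scaleR_right)
    qed
    ultimately show ?thesis by blast
  qed
qed

lemma closed_span_finite:
  fixes B :: "'a::banach set"
  assumes "finite B"
  shows "closed (span B)"
proof -
  obtain \<pi> :: "'a \<Rightarrow>\<^sub>L 'a" where \<pi>: "range (blinfun_apply \<pi>) \<subseteq> span B" "\<And>x. x \<in> span B \<Longrightarrow> \<pi> x = x"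
    using finite_rank_projection[OF assms] by blast
  then have "span B = {x. \<pi> x = x}" by (auto simp: image_subset_iff) metis
  then show ?thesis by (simp add: closed_Collect_eq continuous_intros)
qed

lemma compact_operator_finite_rank:
  fixes F :: "'a::real_normed_vector \<Rightarrow>\<^sub>L 'b::banach"
  assumes "finite B" "range (blinfun_apply F) \<subseteq> span B"
  shows "compact_operator F"
proof -
  obtain \<pi> :: "'b \<Rightarrow>\<^sub>L 'b" where \<pi>: "compact_operator \<pi>" "\<And>x. x \<in> span B \<Longrightarrow> \<pi> x = x"
    using finite_rank_projection[OF assms(1)] by blast
  have "\<pi> o\<^sub>L F = F" using assms(2) by (intro blinfun_eqI) (auto intro!: \<pi>(2))
  then show ?thesis using compact_operator_compose_right[OF \<pi>(1), of F] by simp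
qed

text \<open>The correction \<open>y \<mapsto> y - f (g y)\<close> halves the error, so the corrections add up to a
  preimage.\<close>

lemma preimage_from_approximation:
  fixes f :: "'a::banach \<Rightarrow> 'b::real_normed_vector"
  assumes f: "bounded_linear f" and K: "0 \<le> K"
    and approx: "\<And>y. y \<in> V \<Longrightarrow> \<exists>x. norm x \<le> K * norm y \<and> y - f x \<in> V \<and> norm (y - f x) \<le> norm y / 2"
    and y: "y \<in> V"
  shows "\<exists>x. f x = y \<and> norm x \<le> 2 * K * norm y"
proof -
  obtain g where g: "\<And>y. y \<in> V \<Longrightarrow> norm (g y) \<le> K * norm y \<and> y - f (g y) \<in> V \<and> norm (y - f (g y)) \<le> norm y / 2"
    using approx by metis
  define Y where "Y n = ((\<lambda>y. y - f (g y)) ^^ n) y" for n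
  have Y0: "Y 0 = y" and YS: "Y (Suc n) = Y n - f (g (Y n))" for n by (simp_all add: Y_def)
  have YV: "Y n \<in> V \<and> norm (Y n) \<le> norm y * (1/2) ^ n" for n
  proof (induction n)
    case (Suc n)
    then show ?case using g[of "Y n"] by (auto simp: YS)
  qed (simp add: Y0 y)
  define x where "x n = g (Y n)" for n
  have nx: "norm (x n) \<le> K * norm y * (1/2) ^ n" for n
  proof -
    have "norm (x n) \<le> K * norm (Y n)" using g[of "Y n"] YV[of n] by (simp add: x_def)
    also have "\<dots> \<le> K * (norm y * (1/2) ^ n)" using YV[of n] K by (intro mult_left_mono) auto
    finally show ?thesis by (simp add: mult_ac)
  qed
  have sm: "(\<lambda>n. K * norm y * (1/2) ^ n) sums (2 * K * norm y)"
    using sums_mult[OF geometric_sums[of "1/2::real"], of "K * norm y"] by (simp add: mult_ac)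
  have sn: "summable (\<lambda>n. norm (x n))"
    using summable_comparison_test'[OF sums_summable[OF sm], of 0 "\<lambda>n. norm (x n)"] nx by simp
  then have s: "summable x" by (rule summable_norm_cancel)
  have "norm (suminf x) \<le> (\<Sum>n. norm (x n))" by (rule summable_norm[OF sn])
  also have "\<dots> \<le> 2 * K * norm y"
    using suminf_le[OF nx sn sums_summable[OF sm]] sums_unique[OF sm] by simp
  finally have bound: "norm (suminf x) \<le> 2 * K * norm y" .
  interpret f: bounded_linear f by fact
  have "(\<Sum>k<n. f (x k)) = y - Y n" for n
    by (induction n) (simp_all add: Y0 YS x_def)
  then have "(\<lambda>n. y - Y n) \<longlonglongrightarrow> f (suminf x)"
    using f.sums[OF summable_sums[OF s]] by (simp add: sums_def)
  moreover have "Y \<longlonglongrightarrow> 0"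
  proof (rule Lim_null_comparison)
    show "\<forall>\<^sub>F n in sequentially. norm (Y n) \<le> norm y * (1/2) ^ n" using YV by simp
    show "(\<lambda>n. norm y * (1/2) ^ n) \<longlonglongrightarrow> 0"
      using LIMSEQ_realpow_zero[of "1/2"] by (auto intro!: tendsto_mult_right_zero)
  qed
  then have "(\<lambda>n. y - Y n) \<longlonglongrightarrow> y - 0" by (intro tendsto_intros)
  ultimately have "f (suminf x) = y" using LIMSEQ_unique by fastforce
  with bound show ?thesis by blast
qed

text \<open>By Baire some closure of the image of a ball has an interior point y0. Differences of
  approximants solve the equation approximately for small y, scaling extends this to all y, and the
  halving iteration makes the solutions exact.\<close>

lemma open_mapping_bound:
  fixes f :: "'a::banach \<Rightarrow> 'b::banach"
  assumes f: "bounded_linear f" and "surj f"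
  shows "\<exists>M>0. \<forall>y. \<exists>x. f x = y \<and> norm x \<le> M * norm y"
proof -
  interpret f: bounded_linear f by fact
  let ?C = "\<lambda>n::nat. closure (f ` cball 0 (real n))"
  have "(\<Union>n. ?C n) = UNIV"
  proof -
    have "y \<in> (\<Union>n. ?C n)" for y
    proof -
      obtain x where "y = f x" using \<open>surj f\<close> by blast
      moreover obtain n :: nat where "norm x \<le> real n" using real_arch_simple by blast
      ultimately show ?thesis using closure_subset by fastforce
    qed
    then show ?thesis by blast
  qed
  then have "\<exists>n. interior (?C n) \<noteq> {}"
    using Met_TC.metric_Baire_category_alt[where 'a='b, of "range ?C"]
    by (fastforce simp: mtopology_is_euclidean complete_UNIV mcomplete_iff_complete)
  then obtain n y0 where "y0 \<in> interior (?C n)" by blast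
  then obtain e where e: "0 < e" "ball y0 e \<subseteq> ?C n" by (auto simp: mem_interior)
  have small: "\<exists>x. norm x \<le> 2 * real n \<and> norm (y - f x) < d" if "norm y < e" "0 < d" for y d
  proof -
    have "y0 \<in> ?C n" "y0 + y \<in> ?C n" using e that by (auto simp: subset_iff dist_norm)
    then obtain u v where u: "norm u \<le> real n" "dist (f u) y0 < d/2"
      and v: "norm v \<le> real n" "dist (f v) (y0 + y) < d/2"
      using \<open>0 < d\<close> unfolding closure_approachable by (fastforce dest: spec[of _ "d/2"])
    have "norm (v - u) \<le> 2 * real n" using u v norm_triangle_ineq4[of v u] by linarith
    moreover have "norm (y - f (v - u)) < d"
    proof -
      have eq: "y - f (v - u) = (f u - y0) - (f v - (y0 + y))" by (simp add: f.diff)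
      show ?thesis
        using u v norm_triangle_ineq4[of "f u - y0" "f v - (y0 + y)"] unfolding eq dist_norm by linarith
    qed
    ultimately show ?thesis by blast
  qed
  \<comment> \<open>y is scaled to norm e/2, where an approximate preimage of norm at most 2n
    exists; scaling back multiplies by 2 norm y / e.\<close>
  define K where "K = 4 * real n / e"
  have K: "0 \<le> K" using e by (simp add: K_def)
  have "\<exists>x. norm x \<le> K * norm y \<and> y - f x \<in> UNIV \<and> norm (y - f x) \<le> norm y / 2" for y
  proof (cases "y = 0")
    case True
    then show ?thesis by (intro exI[of _ 0]) (simp add: f.zero)
  next
    case False
    define c where "c = e / (2 * norm y)"
    have c: "0 < c" "norm (c *\<^sub>R y) = e / 2" using False e by (auto simp: c_def)
    obtain x where x: "norm x \<le> 2 * real n" "norm (c *\<^sub>R y - f x) < c * norm y / 2"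
      using small[of "c *\<^sub>R y" "c * norm y / 2"] c e False by auto
    have "norm (x /\<^sub>R c) \<le> K * norm y"
      using x(1) c e False by (simp add: K_def c_def field_simps)
    moreover have "c *\<^sub>R y - f x = c *\<^sub>R (y - f (x /\<^sub>R c))"
      using c by (simp add: f.scaleR scaleR_diff_right)
    then have "norm (y - f (x /\<^sub>R c)) \<le> norm y / 2" using x(2) c by simp
    ultimately show ?thesis by blast
  qed
  then have "\<exists>x. f x = y \<and> norm x \<le> 2 * K * norm y" for y
    using preimage_from_approximation[OF f K, of UNIV] by blast
  \<comment> \<open>The summand 1 makes the constant positive even for n = 0.\<close>
  moreover have "2 * K * norm y \<le> (2 * K + 1) * norm y" for y :: 'b
    by (intro mult_right_mono) auto
  ultimately have "\<exists>x. f x = y \<and> norm x \<le> (2 * K + 1) * norm y" for y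
    by (meson order_trans)
  then show ?thesis using K by (intro exI[of _ "2 * K + 1"]) auto
qed

section \<open>The index of linear maps between subspaces\<close>

context vector_space
begin

interpretation self: vector_space_pair scale scale
  by unfold_locales

lemma finite_dimensional_iff_basis:
  "finite_dimensional scale V \<longleftrightarrow> (\<exists>B. independent B \<and> finite B \<and> span B = V \<and> card B = dim V)"
proof
  assume "finite_dimensional scale V"
  then obtain A where A: "finite A" "span A = V" by (auto simp: finite_dimensional_def)
  obtain B where B: "B \<subseteq> A" "independent B" "A \<subseteq> span B" by (rule maximal_independent_subset)
  have "span B = V"
    using A B span_mono[OF B(1)] by (metis span_minimal subspace_span subset_antisym)
  then show "\<exists>B. independent B \<and> finite B \<and> span B = V \<and> card B = dim V"
    using A B by (metis dim_span_eq_card_independent finite_subset)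
qed (auto simp: finite_dimensional_def)

lemma finite_dimensional_subspace:
  assumes "finite_dimensional scale V" "subspace U" "U \<subseteq> V"
  shows "finite_dimensional scale U" "dim U \<le> dim V"
proof -
  obtain A where A: "finite A" "span A = V" "card A = dim V"
    using assms(1) finite_dimensional_iff_basis by auto
  obtain B where B: "B \<subseteq> U" "independent B" "U \<subseteq> span B" by (rule maximal_independent_subset)
  then have "finite B" "card B \<le> card A"
    using independent_span_bound[OF A(1) B(2)] A(2) assms(3) by auto
  moreover have "span B = U" using B assms(2) by (simp add: span_subspace)
  ultimately show "finite_dimensional scale U" "dim U \<le> dim V"
    using A(3) B(2) dim_span_eq_card_independent by (auto simp: finite_dimensional_def)
qed

lemma finite_dimensional_image:
  assumes T: "Vector_Spaces.linear scale scale T" and "finite_dimensional scale V"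
  shows "finite_dimensional scale (T ` V)"
  using assms(2) unfolding finite_dimensional_def
  by (metis finite_imageI self.linear_span_image[OF T])

lemma dim_image_inj:
  assumes T: "Vector_Spaces.linear scale scale T" and "finite_dimensional scale V" "inj_on T V"
  shows "dim (T ` V) = dim V"
proof -
  obtain B where B: "independent B" "finite B" "span B = V" "card B = dim V"
    using assms(2) finite_dimensional_iff_basis by auto
  have "independent (T ` B)"
    using self.linear_independent_injective_image[OF T B(1)] assms(3) B(3) by simp
  moreover have "span (T ` B) = T ` V" using self.linear_span_image[OF T] B(3) by simp
  moreover have "card (T ` B) = card B"
    using assms(3) B(3) by (metis card_image inj_on_subset span_superset)
  ultimately show ?thesis using B(4) dim_span_eq_card_independent by metis
qed

lemma independent_Un:
  assumes "independent A" "independent B" "span A \<inter> span B = {0}"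
  shows "independent (A \<union> B)" "A \<inter> B = {}"
proof -
  have half: False
    if ind: "independent X" and a: "a \<in> X" "a \<in> span (X \<union> Y - {a})" and int: "span X \<inter> span Y = {0}"
    for X Y a
  proof -
    have "X \<union> Y - {a} \<subseteq> (X - {a}) \<union> Y" by blast
    then have "a \<in> span ((X - {a}) \<union> Y)" using a(2) span_mono by blast
    then obtain x y where xy: "a = x + y" "x \<in> span (X - {a})" "y \<in> span Y" by (auto simp: span_Un)
    have "x \<in> span X" using xy(2) span_mono[of "X - {a}" X] by blast
    then have "y \<in> span X" using xy(1) a(1) span_diff[of a X x] by (simp add: span_base)
    then have "y = 0" using xy(3) int by blast
    then show False using xy ind a(1) unfolding dependent_def by auto
  qed
  show "independent (A \<union> B)"
    unfolding dependent_def
  proof safe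
    fix a assume "a \<in> span (A \<union> B - {a})"
    then show False if "a \<in> A" using half[OF assms(1) that _ assms(3)] by blast
    show False if "a \<in> B"
      using half[OF assms(2) that, of A] assms(3) \<open>a \<in> span (A \<union> B - {a})\<close>
      by (simp add: Int_commute sup_commute)
  qed
  have "0 \<notin> A" using assms(1) dependent_zero by blast
  moreover have "x = 0" if "x \<in> A" "x \<in> B" for x
    using assms(3) that span_superset[of A] span_superset[of B] by blast
  ultimately show "A \<inter> B = {}" by blast
qed

lemma direct_sum_dim:
  assumes "finite_dimensional scale C" "finite_dimensional scale D" "C \<inter> D = {0}"
  shows "finite_dimensional scale {x + y |x y. x \<in> C \<and> y \<in> D}"
    "dim {x + y |x y. x \<in> C \<and> y \<in> D} = dim C + dim D"
proof -
  obtain A where A: "independent A" "finite A" "span A = C" "card A = dim C"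
    using assms(1) finite_dimensional_iff_basis by auto
  obtain B where B: "independent B" "finite B" "span B = D" "card B = dim D"
    using assms(2) finite_dimensional_iff_basis by auto
  have u: "span (A \<union> B) = {x + y |x y. x \<in> C \<and> y \<in> D}"
    using A B by (simp add: span_Un)
  show "finite_dimensional scale {x + y |x y. x \<in> C \<and> y \<in> D}"
    unfolding u[symmetric] finite_dimensional_def using A B by blast
  have "independent (A \<union> B)" "A \<inter> B = {}"
    using independent_Un[OF A(1) B(1)] A(3) B(3) assms(3) by auto
  then show "dim {x + y |x y. x \<in> C \<and> y \<in> D} = dim C + dim D"
    unfolding u[symmetric] A(4)[symmetric] B(4)[symmetric]
    using dim_span_eq_card_independent[of "A \<union> B"] card_Un_disjoint[OF A(2) B(2)] by simp
qed

section \<open>Complements, codimension and the Fredholm index\<close>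

lemma is_complementD:
  assumes "is_complement scale V W C" "subspace W"
  shows "subspace C" "W \<inter> C = {0}" "W \<subseteq> V" "C \<subseteq> V" "\<And>v. v \<in> V \<Longrightarrow> \<exists>w\<in>W. \<exists>c\<in>C. v = w + c"
proof -
  have C: "subspace C" "W \<inter> C = {0}" and V: "{w + c | w c. w \<in> W \<and> c \<in> C} = V"
    using assms(1) by (auto simp: is_complement_def)
  show "subspace C" "W \<inter> C = {0}" by fact+
  show "W \<subseteq> V" using V subspace_0[OF C(1)] by force
  show "C \<subseteq> V" using V subspace_0[OF assms(2)] by force
  show "\<exists>w\<in>W. \<exists>c\<in>C. v = w + c" if "v \<in> V" for v using that unfolding V[symmetric] by blast
qed

lemma is_complementI:
  assumes "subspace V" "subspace C" "C \<subseteq> V" "W \<subseteq> V" "0 \<in> W" "\<And>x. x \<in> W \<Longrightarrow> x \<in> C \<Longrightarrow> x = 0"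
    "\<And>v. v \<in> V \<Longrightarrow> \<exists>w\<in>W. v - w \<in> C"
  shows "is_complement scale V W C"
  unfolding is_complement_def
proof (intro conjI)
  show "W \<inter> C = {0}" using assms(5,6) subspace_0[OF assms(2)] by auto
  show "{w + c | w c. w \<in> W \<and> c \<in> C} = V"
  proof safe
    fix w c assume "w \<in> W" "c \<in> C"
    then show "w + c \<in> V" using assms(1,3,4) by (meson subsetD subspace_add)
  next
    fix v assume "v \<in> V"
    then obtain w where "w \<in> W" "v - w \<in> C" using assms(7) by blast
    then show "\<exists>w c. v = w + c \<and> w \<in> W \<and> c \<in> C" by (intro exI[of _ w] exI[of _ "v - w"]) simp
  qed
qed fact

lemma is_complement_sym:
  assumes "is_complement scale V W C" "subspace W"
  shows "is_complement scale V C W"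
proof -
  have "{c + w | c w. c \<in> C \<and> w \<in> W} = {w + c | w c. w \<in> W \<and> c \<in> C}"
    by (metis (no_types, opaque_lifting) add.commute)
  then show ?thesis using assms by (simp add: is_complement_def Int_commute)
qed

text \<open>A basis A of W is extended to a basis B of V. The linear map p that fixes A and kills
  the new vectors shows that W meets their span trivially.\<close>

lemma complement_exists:
  assumes "subspace W" "subspace V" "W \<subseteq> V"
  shows "\<exists>C. is_complement scale V W C"
proof -
  obtain A where A: "A \<subseteq> W" "independent A" "W \<subseteq> span A" by (rule maximal_independent_subset)
  have sA: "span A = W" using A assms(1) by (simp add: span_subspace)
  have "A \<subseteq> V" using A assms by blast
  then obtain B where B: "A \<subseteq> B" "B \<subseteq> V" "independent B" "V \<subseteq> span B"
    using maximal_independent_subset_extend[OF _ A(2)] by blast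
  have sB: "span B = V" using B assms(2) by (simp add: span_subspace)
  obtain p where p: "Vector_Spaces.linear scale scale p" "\<And>x. x \<in> B \<Longrightarrow> p x = (if x \<in> A then x else 0)"
    using self.linear_independent_extend[OF B(3), of "\<lambda>x. if x \<in> A then x else 0"] by blast
  have pA: "p x = x" if "x \<in> W" for x
  proof (rule self.linear_eq_on[OF p(1), of "\<lambda>x. x", of _ A])
    show "Vector_Spaces.linear scale scale (\<lambda>x. x)"
      by unfold_locales auto
  qed (use that sA p B in auto)
  have pC: "p x = 0" if "x \<in> span (B - A)" for x
    using self.linear_eq_0_on_span[OF p(1) _ that] p(2) by auto
  have sub: "span (B - A) \<subseteq> V" using sB span_mono[of "B - A" B] by blast
  have "is_complement scale V W (span (B - A))"
  proof (rule is_complementI)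
    fix v assume v: "v \<in> V"
    have "A \<union> (B - A) = B" using B by blast
    then have "v \<in> span (A \<union> (B - A))" using v sB by simp
    then obtain x y where "v = x + y" "x \<in> W" "y \<in> span (B - A)" unfolding span_Un sA by blast
    then show "\<exists>w\<in>W. v - w \<in> span (B - A)" by force
  next
    fix x assume "x \<in> W" "x \<in> span (B - A)"
    then show "x = 0" by (metis pA pC)
  qed (use assms sub subspace_0 in auto)
  then show ?thesis by blast
qed

text \<open>The projection p onto C along W is injective on D, and symmetrically with C and D
  exchanged. This is what makes \<open>codimension\<close> well defined.\<close>

lemma complement_dim_unique:
  assumes C: "is_complement scale V W C" and D: "is_complement scale V W D" and W: "subspace W"
    and fC: "finite_dimensional scale C"
  shows "finite_dimensional scale D" "dim D = dim C"
proof -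
  have key: "\<exists>p. Vector_Spaces.linear scale scale p \<and> inj_on p D \<and> p ` D \<subseteq> C"
    if C: "is_complement scale V W C" and D: "is_complement scale V W D" for C D
  proof -
    note C' = is_complementD[OF C W] and D' = is_complementD[OF D W]
    obtain A where A: "A \<subseteq> W" "independent A" "W \<subseteq> span A" by (rule maximal_independent_subset)
    have sA: "span A = W" using A W by (simp add: span_subspace)
    obtain B where B: "B \<subseteq> C" "independent B" "C \<subseteq> span B" by (rule maximal_independent_subset)
    have sB: "span B = C" using B C'(1) by (simp add: span_subspace)
    have "independent (A \<union> B)" using independent_Un[OF A(2) B(2)] sA sB C'(2) by simp
    then obtain p where p: "Vector_Spaces.linear scale scale p"
      "\<And>x. x \<in> A \<union> B \<Longrightarrow> p x = (if x \<in> A then 0 else x)"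
      using self.linear_independent_extend[of "A \<union> B" "\<lambda>x. if x \<in> A then 0 else x"] by blast
    have disj: "A \<inter> B = {}" using independent_Un[OF A(2) B(2)] sA sB C'(2) by simp
    have pB: "p x = x" if "x \<in> C" for x
    proof (rule self.linear_eq_on[OF p(1), of "\<lambda>x. x", of _ B])
      show "Vector_Spaces.linear scale scale (\<lambda>x. x)"
        by unfold_locales auto
    qed (use that sB p disj in auto)
    have pA: "p x = 0" if "x \<in> W" for x
      using self.linear_eq_0_on_span[OF p(1), of A x] p(2) that sA by auto
    have dec: "\<exists>w\<in>W. \<exists>c\<in>C. d = w + c \<and> p d = c" if "d \<in> V" for d
      using C'(5)[OF that] self.linear_add[OF p(1)] pA pB by fastforce
    have "inj_on p D"
    proof (subst self.linear_inj_on_iff_eq_0[OF p(1) D'(1)], intro ballI impI)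
      fix d assume d: "d \<in> D" "p d = 0"
      then have "d \<in> W" using dec[of d] D'(4) by force
      then show "d = 0" using d D'(2) by blast
    qed
    moreover have "p ` D \<subseteq> C" using dec D'(4) by fastforce
    ultimately show ?thesis using p(1) by blast
  qed
  note C' = is_complementD[OF C W] and D' = is_complementD[OF D W]
  obtain p where p: "Vector_Spaces.linear scale scale p" "inj_on p D" "p ` D \<subseteq> C"
    using key[OF C D] by blast
  have "finite_dimensional scale (p ` D)"
    using finite_dimensional_subspace[OF fC] p self.linear_subspace_image[OF p(1) D'(1)] by blast
  obtain A where A: "A \<subseteq> D" "independent A" "D \<subseteq> span A" by (rule maximal_independent_subset)
  have sA: "span A = D" using A D'(1) by (simp add: span_subspace)
  obtain B where B: "finite B" "span B = C" using fC by (auto simp: finite_dimensional_def)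
  have "independent (p ` A)"
    using self.linear_independent_injective_image[OF p(1) A(2)] p(2) sA by simp
  moreover have "p ` A \<subseteq> span B" using p(3) A(1) B by auto
  ultimately have "finite (p ` A)" using independent_span_bound[OF B(1)] by blast
  then have "finite A" using p(2) A(1) by (meson finite_imageD inj_on_subset)
  then show fD: "finite_dimensional scale D" using sA by (auto simp: finite_dimensional_def)
  have le: "dim D \<le> dim C" if "finite_dimensional scale C" "finite_dimensional scale D"
    "Vector_Spaces.linear scale scale p" "inj_on p D" "p ` D \<subseteq> C" "subspace D" for C D p
    using finite_dimensional_subspace(2)[OF that(1) self.linear_subspace_image[OF that(3,6)] that(5)]
      dim_image_inj[OF that(3,2,4)] by simp
  obtain q where q: "Vector_Spaces.linear scale scale q" "inj_on q C" "q ` C \<subseteq> D"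
    using key[OF D C] by blast
  show "dim D = dim C"
    using le[OF fC fD p D'(1)] le[OF fD fC q C'(1)] by simp
qed

lemma codimension_eq:
  assumes "is_complement scale V W C" "subspace W" "finite_dimensional scale C"
  shows "codimension scale V W = dim C"
  unfolding codimension_def
proof (rule the_equality)
  show "\<exists>D. is_complement scale V W D \<and> dim D = dim C" using assms(1) by blast
  show "n = dim C" if "\<exists>D. is_complement scale V W D \<and> dim D = n" for n
    using that complement_dim_unique(2)[OF assms(1) _ assms(2,3)] by blast
qed

lemma finite_codimensional_iff:
  assumes "is_complement scale V W C" "subspace W"
  shows "finite_codimensional scale V W \<longleftrightarrow> finite_dimensional scale C"
  unfolding finite_codimensional_def
  using complement_dim_unique(1)[OF _ assms(1,2)] assms(1) by metis

lemma codimension_self: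
  assumes "subspace V"
  shows "finite_codimensional scale V V" "codimension scale V V = 0"
proof -
  have c: "is_complement scale V V {0}"
  proof (rule is_complementI)
    show "\<exists>w\<in>V. v - w \<in> {0}" if "v \<in> V" for v using that by (intro bexI[of _ v]) auto
  qed (use assms subspace_0 in auto)
  have f: "finite_dimensional scale {0}"
    unfolding finite_dimensional_def by (intro exI[of _ "{}"]) auto
  show "finite_codimensional scale V V" using c f by (auto simp: finite_codimensional_def)
  have "dim {0} = 0" using dim_span_eq_card_independent[OF independent_empty] by simp
  then show "codimension scale V V = 0" using codimension_eq[OF c assms f] by simp
qed

lemma complement_tower:
  assumes C: "is_complement scale V W C" and D: "is_complement scale W M D"
    and "subspace W" "subspace M" "subspace V"
  shows "is_complement scale V M {x + y |x y. x \<in> C \<and> y \<in> D}" "C \<inter> D = {0}"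
proof -
  note C' = is_complementD[OF C assms(3)] and D' = is_complementD[OF D assms(4)]
  show CD: "C \<inter> D = {0}"
    using C'(2) D'(4) subspace_0[OF C'(1)] subspace_0[OF D'(1)] by blast
  show "is_complement scale V M {x + y |x y. x \<in> C \<and> y \<in> D}"
  proof (rule is_complementI)
    show "subspace {x + y |x y. x \<in> C \<and> y \<in> D}" by (rule subspace_sums[OF C'(1) D'(1)])
    show "{x + y |x y. x \<in> C \<and> y \<in> D} \<subseteq> V"
      using C'(3,4) D'(4) subspace_add[OF assms(5)] by blast
  next
    fix z assume z: "z \<in> M" "z \<in> {x + y |x y. x \<in> C \<and> y \<in> D}"
    then obtain x y where xy: "z = x + y" "x \<in> C" "y \<in> D" by blast
    have "z - y \<in> W" using z xy D' assms(3) by (meson subsetD subspace_diff)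
    then have "x = 0" using xy C'(2) by auto
    then show "z = 0" using xy z D'(2) by auto
  next
    fix v assume "v \<in> V"
    then obtain w c where wc: "v = w + c" "w \<in> W" "c \<in> C" using C'(5) by blast
    obtain m d where "w = m + d" "m \<in> M" "d \<in> D" using D'(5) wc(2) by blast
    then show "\<exists>w\<in>M. v - w \<in> {x + y |x y. x \<in> C \<and> y \<in> D}"
      using wc by (intro bexI[of _ m]) (auto simp: algebra_simps)
  next
    show "M \<subseteq> V" using C'(3) D'(3) by blast
    show "0 \<in> M" by (rule subspace_0[OF assms(4)])
  qed fact
qed

text \<open>If C complements W in V and D complements M in W, then C + D complements M in V, and the
  sum is direct.\<close>

lemma finite_codimensional_mid:
  assumes "subspace M" "subspace W" "subspace V" "M \<subseteq> W" "W \<subseteq> V"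
  shows "finite_codimensional scale V M \<longleftrightarrow>
      finite_codimensional scale V W \<and> finite_codimensional scale W M"
    and "finite_codimensional scale V M \<Longrightarrow>
      codimension scale V M = codimension scale V W + codimension scale W M"
proof -
  obtain C where C: "is_complement scale V W C" using complement_exists assms by blast
  obtain D where D: "is_complement scale W M D" using complement_exists assms by blast
  note C' = is_complementD[OF C assms(2)] and D' = is_complementD[OF D assms(1)]
  let ?S = "{x + y |x y. x \<in> C \<and> y \<in> D}"
  note S = complement_tower[OF C D assms(2,1,3)]
  have sub: "C \<subseteq> ?S" "D \<subseteq> ?S"
  proof safe
    fix x assume "x \<in> C"
    then show "\<exists>c d. x = c + d \<and> c \<in> C \<and> d \<in> D"
      using subspace_0[OF D'(1)] by (intro exI[of _ x] exI[of _ 0]) simp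
  next
    fix x assume "x \<in> D"
    then show "\<exists>c d. x = c + d \<and> c \<in> C \<and> d \<in> D"
      using subspace_0[OF C'(1)] by (intro exI[of _ 0] exI[of _ x]) simp
  qed
  have iff: "finite_dimensional scale ?S \<longleftrightarrow> finite_dimensional scale C \<and> finite_dimensional scale D"
  proof
    assume "finite_dimensional scale ?S"
    then show "finite_dimensional scale C \<and> finite_dimensional scale D"
      using finite_dimensional_subspace(1)[OF _ C'(1) sub(1)]
        finite_dimensional_subspace(1)[OF _ D'(1) sub(2)] by simp
  next
    assume "finite_dimensional scale C \<and> finite_dimensional scale D"
    then show "finite_dimensional scale ?S" using direct_sum_dim(1)[OF _ _ S(2)] by simp
  qed
  then show fc: "finite_codimensional scale V M \<longleftrightarrow>
      finite_codimensional scale V W \<and> finite_codimensional scale W M"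
    using finite_codimensional_iff[OF C assms(2)] finite_codimensional_iff[OF D assms(1)]
      finite_codimensional_iff[OF S(1) assms(1)] by simp
  show "codimension scale V M = codimension scale V W + codimension scale W M"
    if "finite_codimensional scale V M"
  proof -
    have f: "finite_dimensional scale ?S" "finite_dimensional scale C" "finite_dimensional scale D"
      using that iff finite_codimensional_iff[OF S(1) assms(1)] by auto
    show ?thesis
      using codimension_eq[OF S(1) assms(1) f(1)] codimension_eq[OF C assms(2) f(2)]
        codimension_eq[OF D assms(1) f(3)] direct_sum_dim(2)[OF f(2,3) S(2)] by simp
  qed
qed

text \<open>As T is injective on all of V, it carries a complement of W in V to a complement of the
  images.\<close>

lemma codimension_image:
  assumes T: "Vector_Spaces.linear scale scale T" and "inj_on T V" "subspace V" "subspace W" "W \<subseteq> V"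
  shows "finite_codimensional scale (T ` V) (T ` W) \<longleftrightarrow> finite_codimensional scale V W"
    and "finite_codimensional scale V W \<Longrightarrow>
      codimension scale (T ` V) (T ` W) = codimension scale V W"
proof -
  obtain C where C: "is_complement scale V W C" using complement_exists assms by blast
  note C' = is_complementD[OF C assms(4)]
  note T' = self.linear_add[OF T] self.linear_diff[OF T] self.linear_0[OF T]
  have TC: "is_complement scale (T ` V) (T ` W) (T ` C)"
  proof (rule is_complementI)
    fix x assume "x \<in> T ` W" "x \<in> T ` C"
    then obtain w c where "x = T w" "x = T c" "w \<in> W" "c \<in> C" by blast
    then have "w = c" using assms(2,5) C'(4) by (metis inj_onD subsetD)
    then have "w = 0" using \<open>w \<in> W\<close> \<open>c \<in> C\<close> C'(2) by blast
    then show "x = 0" using \<open>x = T w\<close> T' by simp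
  next
    fix v assume "v \<in> T ` V"
    then obtain w c where "v = T (w + c)" "w \<in> W" "c \<in> C" using C'(5) by blast
    then show "\<exists>w\<in>T ` W. v - w \<in> T ` C" by (intro bexI[of _ "T w"]) (auto simp: T')
  next
    show "subspace (T ` V)" "subspace (T ` C)"
      using self.linear_subspace_image[OF T] assms(3) C'(1) by blast+
    show "T ` C \<subseteq> T ` V" "T ` W \<subseteq> T ` V" using C'(4) assms(5) by blast+
    show "0 \<in> T ` W" using T'(3) subspace_0[OF assms(4)] by force
  qed
  have sTW: "subspace (T ` W)" by (rule self.linear_subspace_image[OF T assms(4)])
  have inj: "inj_on T C" using assms(2) C'(4) inj_on_subset by blast
  obtain A where A: "A \<subseteq> C" "independent A" "C \<subseteq> span A" by (rule maximal_independent_subset)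
  have sA: "span A = C" using A C'(1) by (simp add: span_subspace)
  have fd: "finite_dimensional scale (T ` C) \<longleftrightarrow> finite_dimensional scale C"
  proof
    assume "finite_dimensional scale (T ` C)"
    then obtain B where B: "finite B" "span B = T ` C" by (auto simp: finite_dimensional_def)
    have "independent (T ` A)"
      using self.linear_independent_injective_image[OF T A(2)] inj sA by simp
    moreover have "T ` A \<subseteq> span B" using A(1) B by auto
    ultimately have "finite (T ` A)" using independent_span_bound[OF B(1)] by blast
    then have "finite A" using inj A(1) by (meson finite_imageD inj_on_subset)
    then show "finite_dimensional scale C" using sA by (auto simp: finite_dimensional_def)
  qed (rule finite_dimensional_image[OF T])
  show iff: "finite_codimensional scale (T ` V) (T ` W) \<longleftrightarrow> finite_codimensional scale V W"
    using fd finite_codimensional_iff[OF TC sTW] finite_codimensional_iff[OF C assms(4)] by simp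
  show "codimension scale (T ` V) (T ` W) = codimension scale V W" if "finite_codimensional scale V W"
  proof -
    have "finite_dimensional scale C" using that finite_codimensional_iff[OF C assms(4)] by simp
    then show ?thesis
      using fd codimension_eq[OF TC sTW] codimension_eq[OF C assms(4)] dim_image_inj[OF T _ inj] by simp
  qed
qed

text \<open>The index can be read off any finite-codimensional M on which T is injective. Let N be
  the kernel and D a complement of M + N in V. Then M has codimension dim N + dim D in V, and T M
  has codimension dim D in T V, so dim D cancels from the difference.\<close>

lemma fredholm_index_restrict:
  assumes T: "Vector_Spaces.linear scale scale T"
    and sub: "subspace V" "subspace W" "T ` V \<subseteq> W" "subspace M" "M \<subseteq> V" "inj_on T M"
    and fc: "finite_codimensional scale V M"
  shows "fredholm scale V W T \<longleftrightarrow> finite_codimensional scale W (T ` M)"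
    and "fredholm scale V W T \<Longrightarrow> fredholm_index scale V W T =
      int (codimension scale V M) - int (codimension scale W (T ` M))"
proof -
  define N where "N = {x \<in> V. T x = 0}"
  define L where "L = {m + n |m n. m \<in> M \<and> n \<in> N}"
  note T' = self.linear_add[OF T] self.linear_diff[OF T] self.linear_0[OF T] self.linear_scale[OF T]
  have N: "subspace N"
    unfolding N_def using sub(1) by (intro subspaceI) (auto simp: T' subspace_0 subspace_add subspace_scale)
  have L: "subspace L" unfolding L_def by (rule subspace_sums[OF sub(4) N])
  have MN: "M \<inter> N = {0}"
    using self.linear_inj_on_iff_eq_0[OF T sub(4)] sub(6) subspace_0[OF sub(4)] subspace_0[OF N]
    by (auto simp: N_def)
  have cLMN: "is_complement scale L M N" using MN N by (auto simp: is_complement_def L_def)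
  have MsubL: "M \<subseteq> L" and NL: "N \<subseteq> L" using is_complementD[OF cLMN sub(4)] by auto
  have LV: "L \<subseteq> V"
    using sub(5) subspace_add[OF sub(1)] by (auto simp: L_def N_def subset_iff)
  obtain D where D: "is_complement scale V L D" using complement_exists[OF L sub(1) LV] by blast
  note D' = is_complementD[OF D L]
  have fcs: "finite_codimensional scale V L" "finite_codimensional scale L M"
    using finite_codimensional_mid(1)[OF sub(4) L sub(1) MsubL LV] fc by auto
  have fN: "finite_dimensional scale N" using fcs(2) finite_codimensional_iff[OF cLMN sub(4)] by simp
  have dN: "codimension scale L M = dim N" by (rule codimension_eq[OF cLMN sub(4) fN])
  \<comment> \<open>S complements the kernel in V and contains M, so T maps it bijectively onto T
    V.\<close>
  define S where "S = {m + d |m d. m \<in> M \<and> d \<in> D}"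
  have S: "subspace S" unfolding S_def by (rule subspace_sums[OF sub(4) D'(1)])
  have "M \<inter> D = {0}" using D'(2) MsubL subspace_0[OF sub(4)] subspace_0[OF D'(1)] by blast
  then have cSMD: "is_complement scale S M D" using D'(1) by (auto simp: is_complement_def S_def)
  have MS: "M \<subseteq> S" and SV: "S \<subseteq> V"
    using is_complementD(3)[OF cSMD sub(4)] sub D' by (auto simp: S_def intro!: subspace_add)
  have injS: "inj_on T S"
  proof (subst self.linear_inj_on_iff_eq_0[OF T S], intro ballI impI)
    fix x assume x: "x \<in> S" "T x = 0"
    then obtain m d where md: "x = m + d" "m \<in> M" "d \<in> D" by (auto simp: S_def)
    have "x \<in> N" using x SV by (auto simp: N_def)
    then have "x - m \<in> L" using md MsubL NL L by (meson subsetD subspace_diff)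
    then have "d = 0" using md D'(2) by auto
    then show "x = 0" using md \<open>x \<in> N\<close> MN by auto
  qed
  have TS: "T ` S = T ` V"
  proof
    show "T ` V \<subseteq> T ` S"
    proof (rule image_subsetI)
      fix v assume "v \<in> V"
      then obtain l d where ld: "v = l + d" "l \<in> L" "d \<in> D" using D'(5) by blast
      then obtain m n where mn: "l = m + n" "m \<in> M" "n \<in> N" by (auto simp: L_def)
      have "T v = T (m + d)" using ld mn by (simp add: T' N_def)
      then show "T v \<in> T ` S" using ld mn by (auto simp: S_def)
    qed
  qed (use SV in auto)
  have fD: "finite_dimensional scale D" using fcs(1) finite_codimensional_iff[OF D L] by simp
  have fSM: "finite_codimensional scale S M" using finite_codimensional_iff[OF cSMD sub(4)] fD by simp
  have dD: "codimension scale V L = dim D" "codimension scale S M = dim D"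
    using codimension_eq[OF D L fD] codimension_eq[OF cSMD sub(4) fD] by auto
  have im: "finite_codimensional scale (T ` V) (T ` M)" "codimension scale (T ` V) (T ` M) = dim D"
    using codimension_image[OF T injS S sub(4) MS] fSM dD(2) TS by auto
  have sTM: "subspace (T ` M)" "subspace (T ` V)"
    using self.linear_subspace_image[OF T] sub by auto
  have "T ` M \<subseteq> T ` V" using sub by auto
  note mid = finite_codimensional_mid[OF sTM(1) sTM(2) sub(2) this sub(3)]
  show iff: "fredholm scale V W T \<longleftrightarrow> finite_codimensional scale W (T ` M)"
    using mid(1) im(1) fN by (simp add: fredholm_def N_def)
  show "fredholm_index scale V W T =
      int (codimension scale V M) - int (codimension scale W (T ` M))" if "fredholm scale V W T"
    using mid(2) iff that finite_codimensional_mid(2)[OF sub(4) L sub(1) MsubL LV fc] dN dD im(2)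
    by (simp add: fredholm_index_def N_def)
qed

text \<open>Restrict to a complement of the kernel of S T, on which T is injective and on whose image S is
  injective.\<close>

lemma fredholm_index_compose:
  assumes T: "Vector_Spaces.linear scale scale T" and S: "Vector_Spaces.linear scale scale S"
    and sub: "subspace V" "subspace W" "subspace U" "T ` V \<subseteq> W" "S ` W \<subseteq> U"
    and F: "fredholm scale V W T" "fredholm scale W U S" "fredholm scale V U (\<lambda>x. S (T x))"
  shows "fredholm_index scale V U (\<lambda>x. S (T x)) = fredholm_index scale V W T + fredholm_index scale W U S"
proof -
  note T' = self.linear_add[OF T] self.linear_diff[OF T] self.linear_0[OF T] self.linear_scale[OF T]
  note S' = self.linear_add[OF S] self.linear_diff[OF S] self.linear_0[OF S] self.linear_scale[OF S]
  have ST: "Vector_Spaces.linear scale scale (\<lambda>x. S (T x))"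
    by unfold_locales (simp_all add: T' S')
  define K where "K = {x \<in> V. S (T x) = 0}"
  have K: "subspace K" "K \<subseteq> V"
    unfolding K_def using sub(1) by (auto intro!: subspaceI simp: T' S' subspace_0 subspace_add subspace_scale)
  obtain M where M: "is_complement scale V K M" using complement_exists[OF K(1) sub(1) K(2)] by blast
  note M' = is_complementD[OF M K(1)]
  have fc: "finite_codimensional scale V M"
    using F(3) is_complement_sym[OF M K(1)] finite_codimensional_iff[OF _ M'(1)]
    by (auto simp: fredholm_def K_def)
  have inj: "inj_on (\<lambda>x. S (T x)) M"
    using M'(2,4) by (subst self.linear_inj_on_iff_eq_0[OF ST M'(1)]) (auto simp: K_def)
  then have injT: "inj_on T M" by (auto simp: inj_on_def)
  have injS: "inj_on S (T ` M)" using inj by (auto simp: inj_on_def)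
  have TM: "subspace (T ` M)" by (rule self.linear_subspace_image[OF T M'(1)])
  have TMW: "T ` M \<subseteq> W" using sub(4) M'(4) by blast
  have "(\<lambda>x. S (T x)) ` V \<subseteq> U" using sub by auto
  note r1 = fredholm_index_restrict[OF T sub(1,2,4) M'(1,4) injT fc]
  note r2 = fredholm_index_restrict[OF S sub(2,3,5) TM TMW injS]
  note r3 = fredholm_index_restrict[OF ST sub(1,3) \<open>_ ` V \<subseteq> U\<close> M'(1,4) inj fc]
  \<comment> \<open>The codimension of the image of M under T in W occurs with opposite signs for T
    and S and cancels.\<close>
  show ?thesis using r1 r2 r3 F by (simp add: image_image)
qed

lemma fredholm_bij:
  assumes T: "Vector_Spaces.linear scale scale T"
    and sub: "subspace V" "subspace W" "T ` V = W" "inj_on T V"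
  shows "fredholm scale V W T" "fredholm_index scale V W T = 0"
  using fredholm_index_restrict[OF T sub(1,2) _ sub(1) _ sub(4)] codimension_self sub by auto

text \<open>With M = R in \<open>fredholm_index_restrict\<close> both codimensions are that of R in
  V.\<close>

lemma fredholm_splitting:
  assumes T: "Vector_Spaces.linear scale scale T"
    and V: "subspace V" "is_complement scale V R N" "finite_dimensional scale N" "subspace R"
    and TV: "T ` V \<subseteq> V" and TR: "T ` R = R" "inj_on T R"
  shows "fredholm scale V V T" "fredholm_index scale V V T = 0"
proof -
  have fc: "finite_codimensional scale V R" using V by (auto simp: finite_codimensional_def)
  have RV: "R \<subseteq> V" using is_complementD[OF V(2,4)] by simp
  show "fredholm scale V V T" "fredholm_index scale V V T = 0"
    using fredholm_index_restrict[OF T V(1,1) TV V(4) RV TR(2) fc] fc TR(1) by auto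
qed

text \<open>For S between ranges of projectors, K will be the kernel and R the range of compressions
  of S that are known to be Fredholm.\<close>

lemma fredholm_between:
  assumes S: "Vector_Spaces.linear scale scale S"
    and sub: "subspace V" "subspace W" "S ` V \<subseteq> W"
    and ker: "finite_dimensional scale K" "{x \<in> V. S x = 0} \<subseteq> K"
    and ran: "subspace R" "R \<subseteq> S ` V" "finite_codimensional scale W R"
  shows "fredholm scale V W S"
proof -
  note S' = self.linear_add[OF S] self.linear_0[OF S] self.linear_scale[OF S]
  have "subspace {x \<in> V. S x = 0}"
    using sub(1) by (intro subspaceI) (auto simp: S' subspace_0 subspace_add subspace_scale)
  moreover have "subspace (S ` V)" by (rule self.linear_subspace_image[OF S sub(1)])
  ultimately show ?thesis
    using finite_dimensional_subspace(1)[OF ker(1) _ ker(2)]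
      finite_codimensional_mid(1)[OF ran(1) _ sub(2) ran(2) sub(3)] ran(3)
    by (simp add: fredholm_def)
qed

lemma fredholm_index_conjugate:
  assumes U: "Vector_Spaces.linear scale scale U" "inj U" and S: "Vector_Spaces.linear scale scale S"
    and sub: "subspace V" "subspace W" "S ` V \<subseteq> W" and F: "fredholm scale V W S"
    and conj: "\<And>x. x \<in> V \<Longrightarrow> S' (U x) = U (S x)"
  shows "fredholm_index scale (U ` V) (U ` W) S' = fredholm_index scale V W S"
proof -
  note S' = self.linear_add[OF S] self.linear_0[OF S] self.linear_scale[OF S]
  note U' = self.linear_0[OF U(1)]
  have inj: "inj_on U A" for A using U(2) by (simp add: inj_on_def inj_def)
  have "U y = 0 \<longleftrightarrow> y = 0" for y using U(2) U' by (metis injD)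
  then have "S' (U x) = 0 \<longleftrightarrow> S x = 0" if "x \<in> V" for x using conj[OF that] by simp
  then have ker: "{x \<in> U ` V. S' x = 0} = U ` {x \<in> V. S x = 0}" by auto
  have im: "S' ` U ` V = U ` (S ` V)" using conj by (force simp: image_image)
  have "dim (U ` {x \<in> V. S x = 0}) = dim {x \<in> V. S x = 0}"
    using F by (intro dim_image_inj U(1) inj) (simp add: fredholm_def)
  moreover have "codimension scale (U ` W) (U ` (S ` V)) = codimension scale W (S ` V)"
    using codimension_image(2)[OF U(1) inj sub(2) self.linear_subspace_image[OF S sub(1)] sub(3)] F
    by (simp add: fredholm_def)
  ultimately show ?thesis by (simp add: fredholm_index_def ker im)
qed

end

section \<open>Riesz theory of compact perturbations of the identity\<close>

lemma compact_operator_convergent_subsequence: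
  fixes K :: "'a::real_normed_vector \<Rightarrow>\<^sub>L 'b::real_normed_vector"
  assumes K: "compact_operator K" and x: "\<And>n. norm (x n) \<le> 1"
  obtains l r where "strict_mono (r :: nat \<Rightarrow> nat)" "(\<lambda>n. K (x (r n))) \<longlonglongrightarrow> l"
proof -
  have "K (x n) \<in> blinfun_apply K ` cball 0 1" for n using x[of n] by (intro imageI) simp
  then have *: "\<forall>n. K (x n) \<in> closure (blinfun_apply K ` cball 0 1)"
    using closure_subset[of "blinfun_apply K ` cball 0 1"] by blast
  have "seq_compact (closure (blinfun_apply K ` cball 0 1))"
    using K unfolding compact_operator_def by (rule compact_imp_seq_compact)
  from seq_compactE[OF this *] show thesis using that unfolding o_def by blast
qed

lemma compact_operator_no_separated_sequence:
  fixes K :: "'a::real_normed_vector \<Rightarrow>\<^sub>L 'b::real_normed_vector"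
  assumes K: "compact_operator K" and x: "\<And>n. norm (x n) \<le> 1"
    and sep: "\<And>m n. m < (n::nat) \<Longrightarrow> 1/2 \<le> norm (K (x n) - K (x m))"
  shows False
proof -
  obtain l r where r: "strict_mono (r :: nat \<Rightarrow> nat)" "(\<lambda>n. K (x (r n))) \<longlonglongrightarrow> l"
    by (rule compact_operator_convergent_subsequence[OF K x])
  have "Cauchy (\<lambda>n. K (x (r n)))" using r(2) by (rule LIMSEQ_imp_Cauchy)
  then obtain M where M: "\<And>m n. m \<ge> M \<Longrightarrow> n \<ge> M \<Longrightarrow> dist (K (x (r m))) (K (x (r n))) < 1/2"
    using metric_CauchyD[OF \<open>Cauchy _\<close>, of "1/2"] by auto
  have "r M < r (Suc M)" using r(1) by (simp add: strict_monoD)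
  then show False using M[of "Suc M" M] sep[of "r M" "r (Suc M)"] by (simp add: dist_norm)
qed

text \<open>Riesz's lemma with constant 1/2: as M is closed, y has positive distance d from it. Some
  m0 in M is at distance c < 2d from y, and dividing y - m0 by c leaves a distance of at least d/c >
  1/2.\<close>

lemma riesz_almost_orthogonal:
  fixes L M :: "'a::real_normed_vector set"
  assumes M: "closed M" "subspace M" and L: "subspace L" "M \<subseteq> L" "M \<noteq> L"
  shows "\<exists>x\<in>L. norm x \<le> 1 \<and> (\<forall>m\<in>M. 1/2 \<le> norm (x - m))"
proof -
  obtain y where y: "y \<in> L" "y \<notin> M" using L by blast
  have ne: "M \<noteq> {}" using subspace_0[OF M(2)] by blast
  define d where "d = infdist y M"
  have d: "0 < d" unfolding d_def
    using M(1) y(2) ne by (metis in_closed_iff_infdist_zero infdist_nonneg order_le_less)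
  obtain m0 where m0: "m0 \<in> M" "dist y m0 < 2 * d"
    using cInf_lessD[of "dist y ` M" "2 * d"] ne d by (auto simp: d_def infdist_notempty)
  define c where "c = norm (y - m0)"
  have c: "0 < c" "c < 2 * d" using m0 y by (auto simp: c_def dist_norm)
  define x where "x = (y - m0) /\<^sub>R c"
  have "x \<in> L" using y m0 L by (auto simp: x_def intro!: subspace_scale subspace_diff)
  moreover have "norm x \<le> 1" using c by (simp add: x_def c_def)
  moreover have "1/2 \<le> norm (x - m)" if m: "m \<in> M" for m
  proof -
    have "d \<le> dist y (m0 + c *\<^sub>R m)"
      unfolding d_def using m m0 M by (intro infdist_le subspace_add subspace_scale)
    also have "y - (m0 + c *\<^sub>R m) = c *\<^sub>R (x - m)" using c by (simp add: x_def algebra_simps)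
    then have "dist y (m0 + c *\<^sub>R m) = c * norm (x - m)" using c by (simp add: dist_norm)
    finally have *: "d \<le> c * norm (x - m)" .
    show ?thesis
    proof (rule ccontr)
      assume "\<not> ?thesis"
      then have "c * norm (x - m) \<le> c * (1/2)" using c by (intro mult_left_mono) auto
      then show False using * c by linarith
    qed
  qed
  ultimately show ?thesis by blast
qed

text \<open>In a strict chain, almost orthogonal unit vectors would have images under K that are 1/2
  apart, because 1 - K lowers the index; a compact K does not allow this.\<close>

lemma ascending_chain_stops:
  fixes K :: "'a::banach \<Rightarrow>\<^sub>L 'a"
  assumes K: "compact_operator K" and M: "\<And>n. closed (M n)" "\<And>n. subspace (M n)"
    and mono: "\<And>n. M n \<subseteq> M (Suc n)" and t: "\<And>n x. x \<in> M (Suc n) \<Longrightarrow> x - K x \<in> M n"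
  shows "\<exists>n. M n = M (Suc n)"
proof (rule ccontr)
  assume "\<not> ?thesis"
  then have "\<forall>n. \<exists>x\<in>M (Suc n). norm x \<le> 1 \<and> (\<forall>m\<in>M n. 1/2 \<le> norm (x - m))"
    using riesz_almost_orthogonal[OF M M(2) mono] by blast
  then obtain x where x: "\<And>n. x n \<in> M (Suc n)" "\<And>n. norm (x n) \<le> 1"
    "\<And>n m. m \<in> M n \<Longrightarrow> 1/2 \<le> norm (x n - m)" by metis
  have inc: "M m \<subseteq> M n" if "m \<le> n" for m n using lift_Suc_mono_le[of M, OF mono that] .
  show False
  proof (rule compact_operator_no_separated_sequence[OF K x(2)])
    fix m n :: nat assume mn: "m < n"
    \<comment> \<open>Subtracting this vector from \<open>x n\<close> leaves exactly
      \<open>K (x n) - K (x m)\<close>.\<close>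
    have "(x n - K (x n)) + x m - (x m - K (x m)) \<in> M n"
    proof -
      have "x m \<in> M n" "x m - K (x m) \<in> M n"
        using t[OF x(1)[of m]] x(1)[of m] inc[of "Suc m" n] inc[of m n] mn by auto
      then show ?thesis using t[OF x(1)[of n]] M(2) by (metis subspace_add subspace_diff)
    qed
    from x(3)[OF this] show "1/2 \<le> norm (K (x n) - K (x m))" by (simp add: algebra_simps)
  qed
qed

text \<open>The mirror image of the ascending case: now the vector with the smaller index lies in
  the larger space and plays the leading role.\<close>

lemma descending_chain_stops:
  fixes K :: "'a::banach \<Rightarrow>\<^sub>L 'a"
  assumes K: "compact_operator K" and M: "\<And>n. closed (M n)" "\<And>n. subspace (M n)"
    and mono: "\<And>n. M (Suc n) \<subseteq> M n" and t: "\<And>n x. x \<in> M n \<Longrightarrow> x - K x \<in> M (Suc n)"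
  shows "\<exists>n. M n = M (Suc n)"
proof (rule ccontr)
  assume "\<not> ?thesis"
  then have "\<forall>n. \<exists>x\<in>M n. norm x \<le> 1 \<and> (\<forall>m\<in>M (Suc n). 1/2 \<le> norm (x - m))"
    using riesz_almost_orthogonal[OF M M(2) mono] by blast
  then obtain x where x: "\<And>n. x n \<in> M n" "\<And>n. norm (x n) \<le> 1"
    "\<And>n m. m \<in> M (Suc n) \<Longrightarrow> 1/2 \<le> norm (x n - m)" by metis
  have dec: "M n \<subseteq> M m" if "m \<le> n" for m n using lift_Suc_antimono_le[of M, OF mono that] .
  show False
  proof (rule compact_operator_no_separated_sequence[OF K x(2)])
    fix m n :: nat assume mn: "m < n"
    have "(x m - K (x m)) + x n - (x n - K (x n)) \<in> M (Suc m)"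
    proof -
      have "x n \<in> M (Suc m)" "x n - K (x n) \<in> M (Suc m)"
        using t[OF x(1)[of n]] x(1)[of n] dec[of "Suc m" n] dec[of "Suc m" "Suc n"] mn by auto
      then show ?thesis using t[OF x(1)[of m]] M(2) by (metis subspace_add subspace_diff)
    qed
    from x(3)[OF this] show "1/2 \<le> norm (K (x n) - K (x m))"
      by (simp add: algebra_simps norm_minus_commute)
  qed
qed

lemma bounded_linear_id_minus: "bounded_linear (\<lambda>x. x - blinfun_apply K x)"
  by (intro bounded_linear_sub bounded_linear_ident blinfun.bounded_linear_right)

text \<open>Otherwise kernel vectors could be adjoined forever. The spans form a strict chain of
  closed subspaces, which 1 - K maps to 0, against \<open>ascending_chain_stops\<close>.\<close>

lemma kernel_finite_dimensional:
  fixes K :: "'a::banach \<Rightarrow>\<^sub>L 'a"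
  assumes K: "compact_operator K"
  shows "\<exists>B. finite B \<and> span B = {x. x - K x = 0}"
proof (rule ccontr)
  assume neg: "\<not> ?thesis"
  let ?N = "{x. x - K x = 0}"
  interpret t: bounded_linear "\<lambda>x. x - K x" by (rule bounded_linear_id_minus)
  have N: "subspace ?N" using linear_subspace_kernel[OF t.linear] .
  have "\<exists>b\<in>?N. b \<notin> span B" if "finite B" "B \<subseteq> ?N" for B
    using neg that span_minimal[OF that(2) N] by blast
  then obtain g where g: "\<And>B. finite B \<Longrightarrow> B \<subseteq> ?N \<Longrightarrow> g B \<in> ?N \<and> g B \<notin> span B" by metis
  define S where "S n = ((\<lambda>B. insert (g B) B) ^^ n) {}" for n
  have S: "finite (S n) \<and> S n \<subseteq> ?N" for n
    by (induction n) (use g in \<open>auto simp: S_def\<close>)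
  have "\<exists>n. span (S n) = span (S (Suc n))"
  proof (rule ascending_chain_stops[OF K])
    fix n x assume "x \<in> span (S (Suc n))"
    then have "x \<in> ?N" using span_minimal[OF _ N] S by blast
    then show "x - K x \<in> span (S n)" by (simp add: span_zero)
  next
    fix n
    show "closed (span (S n))" by (rule closed_span_finite) (use S in blast)
    show "span (S n) \<subseteq> span (S (Suc n))" by (rule span_mono) (auto simp: S_def)
  qed simp
  then obtain n where "span (S n) = span (S (Suc n))" ..
  moreover have "g (S n) \<in> span (S (Suc n))" by (simp add: S_def span_base)
  ultimately show False using g S by blast
qed

text \<open>On the closed complement Z of the kernel, 1 - K is bounded below: unit vectors w in Z
  with w - K w tending to 0 would have a subsequence converging to a unit vector that lies both in Z
  and in the kernel. Hence the image of Z, which is the whole range, is complete.\<close>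

lemma closed_range_id_minus_compact:
  fixes K :: "'a::banach \<Rightarrow>\<^sub>L 'a"
  assumes K: "compact_operator K"
  shows "closed (range (\<lambda>x. x - K x))"
proof -
  obtain B where B: "finite B" "span B = {x. x - K x = 0}"
    using kernel_finite_dimensional[OF K] by blast
  obtain \<pi> :: "'a \<Rightarrow>\<^sub>L 'a" where \<pi>: "range (blinfun_apply \<pi>) \<subseteq> span B" "\<And>x. x \<in> span B \<Longrightarrow> \<pi> x = x"
    using finite_rank_projection[OF B(1)] by blast
  interpret t: bounded_linear "\<lambda>x. x - K x" by (rule bounded_linear_id_minus)
  let ?Z = "{x. \<pi> x = 0}"
  have Z: "subspace ?Z" "closed ?Z"
    by (auto intro!: subspaceI closed_Collect_eq continuous_intros simp: blinfun.bilinear_simps)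
  have "\<exists>e>0. \<forall>x\<in>?Z. e * norm x \<le> norm (x - K x)"
  proof (rule ccontr)
    assume neg: "\<not> ?thesis"
    have "\<exists>w\<in>?Z. norm w = 1 \<and> norm (w - K w) < inverse (real (Suc n))" for n
    proof -
      obtain x where x: "\<pi> x = 0" "norm (x - K x) < inverse (real (Suc n)) * norm x"
        using neg by (metis (mono_tags, lifting) mem_Collect_eq inverse_positive_iff_positive
            linorder_not_le of_nat_0_less_iff zero_less_Suc)
      then have "x \<noteq> 0" by auto
      then have nx: "0 < norm x" by simp
      have "x /\<^sub>R norm x - K (x /\<^sub>R norm x) = (1 / norm x) *\<^sub>R (x - K x)"
        by (simp add: blinfun.scaleR_right scaleR_diff_right divide_inverse)
      then have "norm (x /\<^sub>R norm x - K (x /\<^sub>R norm x)) = norm (x - K x) / norm x"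
        by (simp add: divide_inverse mult.commute)
      also have "\<dots> < inverse (real (Suc n))" using x(2) nx by (simp only: pos_divide_less_eq)
      finally have "norm (x /\<^sub>R norm x - K (x /\<^sub>R norm x)) < inverse (real (Suc n))" .
      then show ?thesis using x nx by (intro bexI[of _ "x /\<^sub>R norm x"]) (auto simp: blinfun.scaleR_right)
    qed
    then obtain w where w: "\<And>n. \<pi> (w n) = 0" "\<And>n. norm (w n) = 1"
      "\<And>n. norm (w n - K (w n)) < inverse (real (Suc n))" by (metis (mono_tags, lifting) mem_Collect_eq)
    obtain l r where r: "strict_mono (r :: nat \<Rightarrow> nat)" "(\<lambda>n. K (w (r n))) \<longlonglongrightarrow> l"
      by (rule compact_operator_convergent_subsequence[OF K, of w]) (auto simp: w(2))
    have "(\<lambda>n. w n - K (w n)) \<longlonglongrightarrow> 0"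
      by (rule Lim_null_comparison[OF _ LIMSEQ_inverse_real_of_nat]) (intro always_eventually allI less_imp_le w(3))
    then have *: "(\<lambda>n. w (r n) - K (w (r n))) \<longlonglongrightarrow> 0"
      using r(1) LIMSEQ_subseq_LIMSEQ[of "\<lambda>n. w n - K (w n)" 0 r] by (simp add: o_def)
    have wl: "(\<lambda>n. w (r n)) \<longlonglongrightarrow> l"
      using tendsto_add[OF * r(2)] by simp
    have "(\<lambda>n. w (r n) - K (w (r n))) \<longlonglongrightarrow> l - K l" by (rule t.tendsto[OF wl])
    then have "l - K l = 0" using * LIMSEQ_unique by blast
    then have "\<pi> l = l" using \<pi>(2) B(2) by blast
    moreover have "(\<lambda>n. \<pi> (w (r n))) \<longlonglongrightarrow> \<pi> l" by (intro tendsto_intros wl)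
    then have "\<pi> l = 0" by (simp add: w(1) LIMSEQ_const_iff)
    moreover have "norm l = 1" using tendsto_norm[OF wl] by (simp add: w(2) LIMSEQ_const_iff)
    ultimately show False by simp
  qed
  then obtain e where e: "0 < e" "\<forall>x\<in>?Z. e * norm x \<le> norm (x - K x)" by blast
  have "complete ((\<lambda>x. x - K x) ` ?Z)"
    using complete_isometric_image[OF e(1) Z(1) bounded_linear_id_minus e(2)] Z(2)
    by (simp add: complete_eq_closed)
  moreover have "(\<lambda>x. x - K x) ` ?Z = range (\<lambda>x. x - K x)"
  proof (intro equalityI subsetI)
    fix y assume "y \<in> range (\<lambda>x. x - K x)"
    then obtain x where x: "y = x - K x" by blast
    have 1: "\<pi> x \<in> span B" using \<pi>(1) by blast
    then have "\<pi> (x - \<pi> x) = 0" using \<pi>(2) by (simp add: blinfun.diff_right)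
    moreover have "\<pi> x - K (\<pi> x) = 0" using 1 B(2) by blast
    then have "y = (x - \<pi> x) - K (x - \<pi> x)" using x by (simp add: blinfun.diff_right algebra_simps)
    ultimately show "y \<in> (\<lambda>x. x - K x) ` ?Z" by blast
  qed auto
  ultimately show ?thesis by (simp add: complete_eq_closed)
qed

text \<open>Each power of t is again the identity minus a compact operator. So its kernels and
  ranges form chains of closed subspaces that stop, and beyond both stopping indices the space
  splits into kernel and range of the power.\<close>

lemma riesz_decomposition:
  fixes K :: "'a::banach \<Rightarrow>\<^sub>L 'a"
  assumes K: "compact_operator K"
  defines "t \<equiv> \<lambda>x. x - blinfun_apply K x"
  obtains n B where "finite B" "span B = {x. (t ^^ n) x = 0}"
    "\<And>x. (t ^^ n) x = 0 \<Longrightarrow> x \<in> range (t ^^ n) \<Longrightarrow> x = 0"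
    "\<And>x. \<exists>y. (t ^^ n) (x - (t ^^ n) y) = 0"
    "t ` range (t ^^ n) = range (t ^^ n)" "inj_on t (range (t ^^ n))"
proof -
  have t: "bounded_linear t" unfolding t_def by (rule bounded_linear_id_minus)
  have iter: "\<exists>L. compact_operator L \<and> (t ^^ n) = (\<lambda>x. x - blinfun_apply L x)" for n
  proof (induction n)
    case 0
    show ?case by (intro exI[of _ 0]) (auto simp: compact_operator_zero)
  next
    case (Suc n)
    then obtain L where L: "compact_operator L" "(t ^^ n) = (\<lambda>x. x - blinfun_apply L x)" by blast
    have "compact_operator (L + K - (K o\<^sub>L L))"
      by (intro compact_operator_diff compact_operator_add compact_operator_compose_left L K)
    moreover have "(t ^^ Suc n) = (\<lambda>x. x - (L + K - (K o\<^sub>L L)) x)"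
    proof
      fix x
      have "t z = z - K z" for z by (simp add: t_def)
      then show "(t ^^ Suc n) x = x - (L + K - (K o\<^sub>L L)) x"
        using fun_cong[OF L(2), of x] by (simp add: blinfun.bilinear_simps)
    qed
    ultimately show ?case by blast
  qed
  have lin: "linear (t ^^ n)" for n
  proof -
    obtain L where L: "(t ^^ n) = (\<lambda>x. x - blinfun_apply L x)" using iter[of n] by blast
    show ?thesis unfolding L by (rule bounded_linear.linear[OF bounded_linear_id_minus])
  qed
  note lin' = linear_0[OF lin] linear_diff[OF lin]
  let ?N = "\<lambda>n. {x. (t ^^ n) x = 0}" and ?R = "\<lambda>n. range (t ^^ n)"
  have Suc': "(t ^^ Suc n) x = t ((t ^^ n) x)" "(t ^^ Suc n) x = (t ^^ n) (t x)" for n x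
    by (simp_all add: funpow_swap1)
  have "\<exists>n. ?N n = ?N (Suc n)"
  proof (rule ascending_chain_stops[OF K])
    fix n
    show "closed (?N n)"
      using iter[of n] by (auto intro!: closed_Collect_eq continuous_intros)
    show "subspace (?N n)" using lin by (rule linear_subspace_kernel)
    show "?N n \<subseteq> ?N (Suc n)" using linear_0[OF bounded_linear.linear[OF t]] by auto
    show "x - K x \<in> ?N n" if "x \<in> ?N (Suc n)" for x
      using that unfolding mem_Collect_eq Suc'(2) by (simp add: t_def)
  qed
  then obtain n1 where n1: "?N n1 = ?N (Suc n1)" by blast
  have Nst: "?N m = ?N n1" if "n1 \<le> m" for m
    using that
  proof (induction m rule: dec_induct)
    case (step m)
    then obtain k where k: "m = n1 + k" using le_Suc_ex by blast
    have "(t ^^ Suc m) x = (t ^^ Suc n1) ((t ^^ k) x)" "(t ^^ m) x = (t ^^ n1) ((t ^^ k) x)" for x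
      unfolding k by (metis add_Suc comp_apply funpow_add) (metis comp_apply funpow_add)
    moreover have "(t ^^ Suc n1) y = 0 \<longleftrightarrow> (t ^^ n1) y = 0" for y using n1 by blast
    ultimately have "?N (Suc m) = ?N m" by simp
    then show ?case using step by simp
  qed simp
  have "\<exists>n. ?R n = ?R (Suc n)"
  proof (rule descending_chain_stops[OF K])
    fix n
    show "closed (?R n)" using iter[of n] closed_range_id_minus_compact by auto
    show "subspace (?R n)" using lin by (intro linear_subspace_image) auto
    show "?R (Suc n) \<subseteq> ?R n" unfolding image_subset_iff Suc'(2) by blast
    show "x - K x \<in> ?R (Suc n)" if x: "x \<in> ?R n" for x
    proof -
      obtain y where "x = (t ^^ n) y" using x by blast
      then have "x - K x = (t ^^ Suc n) y" unfolding Suc'(1) by (simp add: t_def)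
      then show ?thesis by blast
    qed
  qed
  then obtain n2 where n2: "?R n2 = ?R (Suc n2)" by blast
  have Rst: "?R m = ?R n2" if "n2 \<le> m" for m
    using that
  proof (induction m rule: dec_induct)
    case (step m)
    then obtain k where k: "m = k + n2" by (metis add.commute le_Suc_ex)
    have "?R (k + p) = (t ^^ k) ` ?R p" for p by (simp add: funpow_add image_comp)
    then have "?R (Suc m) = ?R m" using n2 by (metis add_Suc_right k)
    then show ?case using step by simp
  qed simp
  \<comment> \<open>The sum dominates both stopping indices, so from n on neither kernels nor ranges
    change.\<close>
  define n where "n = n1 + n2"
  have Nn: "?N (n + k) = ?N n" and Rn: "?R (n + k) = ?R n" for k
    using Nst[of n] Nst[of "n + k"] Rst[of n] Rst[of "n + k"] by (simp_all add: n_def)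
  obtain L where L: "compact_operator L" "(t ^^ n) = (\<lambda>x. x - blinfun_apply L x)"
    using iter by blast
  obtain B where B: "finite B" "span B = ?N n"
    using kernel_finite_dimensional[OF L(1)] L(2) by auto
  have twice: "(t ^^ (n + n)) x = (t ^^ n) ((t ^^ n) x)" for x by (simp add: funpow_add)
  show thesis
  proof (rule that[OF B])
    fix x assume x: "(t ^^ n) x = 0" "x \<in> ?R n"
    then obtain y where y: "x = (t ^^ n) y" by blast
    then have "y \<in> ?N (n + n)" using x by (simp add: twice)
    then show "x = 0" using y Nn[of n] by auto
  next
    fix x
    have "(t ^^ n) x \<in> ?R (n + n)" using Rn[of n] by blast
    then obtain y where "(t ^^ n) x = (t ^^ n) ((t ^^ n) y)" by (auto simp: twice)
    then show "\<exists>y. (t ^^ n) (x - (t ^^ n) y) = 0" by (auto simp: lin')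
  next
    have "t ` ?R n = ?R (n + 1)" by (auto simp: image_image)
    then show "t ` ?R n = ?R n" using Rn[of 1] by simp
  next
    show "inj_on t (?R n)"
    proof (rule inj_onI)
      fix x y assume xy: "x \<in> ?R n" "y \<in> ?R n" "t x = t y"
      then obtain a b where ab: "x = (t ^^ n) a" "y = (t ^^ n) b" by blast
      have "t (x - y) = 0" using xy linear_diff[OF bounded_linear.linear[OF t]] by simp
      then have "a - b \<in> ?N (n + 1)" using ab by (simp add: lin')
      then have "a - b \<in> ?N n" using Nn[of 1] by blast
      then show "x = y" using ab by (simp add: lin')
    qed
  qed
qed

section \<open>Inverses in Banach algebras\<close>

text \<open>The norm of \<open>unit\<close> is left open, because the Calkin algebra of a
  finite-dimensional space is zero.\<close>

locale banach_algebra = bounded_bilinear mult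
  for mult :: "'b::banach \<Rightarrow> 'b \<Rightarrow> 'b" (infixl "\<odot>" 70) +
  fixes unit :: 'b
  assumes assoc: "x \<odot> y \<odot> z = x \<odot> (y \<odot> z)"
    and unit_left [simp]: "unit \<odot> x = x"
    and unit_right [simp]: "x \<odot> unit = x"
    and norm_mult_le: "norm (x \<odot> y) \<le> norm x * norm y"
begin

lemmas bilinear = add_left add_right diff_left diff_right minus_left minus_right
  scaleR_left scaleR_right zero_left zero_right

definition inverse_of :: "'b \<Rightarrow> 'b \<Rightarrow> bool" where
  "inverse_of x y \<longleftrightarrow> x \<odot> y = unit \<and> y \<odot> x = unit"

definition invertible :: "'b \<Rightarrow> bool" where
  "invertible x \<longleftrightarrow> (\<exists>y. inverse_of x y)"

definition inver :: "'b \<Rightarrow> 'b" where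
  "inver x = (THE y. inverse_of x y)"

lemma inverse_of_unique: "inverse_of x y \<Longrightarrow> inverse_of x z \<Longrightarrow> y = z"
  unfolding inverse_of_def by (metis assoc unit_left unit_right)

lemma inver_eq: "inverse_of x y \<Longrightarrow> inver x = y"
  unfolding inver_def by (rule the_equality) (auto intro: inverse_of_unique)

lemma inverse_of_inver: "invertible x \<Longrightarrow> inverse_of x (inver x)"
  unfolding invertible_def using inver_eq by auto

lemma invertibleI: "inverse_of x y \<Longrightarrow> invertible x"
  by (auto simp: invertible_def)

lemma inver_cancel:
  assumes "invertible x"
  shows "x \<odot> inver x = unit" "inver x \<odot> x = unit" "x \<odot> (inver x \<odot> y) = y" "inver x \<odot> (x \<odot> y) = y"
    "y \<odot> inver x \<odot> x = y" "y \<odot> x \<odot> inver x = y"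
proof -
  show *: "x \<odot> inver x = unit" "inver x \<odot> x = unit"
    using inverse_of_inver[OF assms] by (auto simp: inverse_of_def)
  show "x \<odot> (inver x \<odot> y) = y" "inver x \<odot> (x \<odot> y) = y"
    "y \<odot> inver x \<odot> x = y" "y \<odot> x \<odot> inver x = y"
    using * by (simp_all add: assoc flip: assoc[of x "inver x" y] assoc[of "inver x" x y])
qed

lemma inverse_of_mult: "inverse_of x y \<Longrightarrow> inverse_of u v \<Longrightarrow> inverse_of (x \<odot> u) (v \<odot> y)"
  unfolding inverse_of_def by (metis assoc unit_left)

lemma inver_commute:
  assumes "invertible x" "x \<odot> y = y \<odot> x"
  shows "inver x \<odot> y = y \<odot> inver x"
  using inver_cancel[OF assms(1)] assms(2) by (metis assoc)

text \<open>The fixed points of the contractions y -> 1 + x y and z -> 1 + z x are a right and a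
  left inverse of 1 - x, hence equal.\<close>

lemma neumann:
  assumes "norm x < 1"
  shows "\<exists>y. inverse_of (unit - x) y"
proof -
  have "\<forall>u v. dist (unit + x \<odot> u) (unit + x \<odot> v) \<le> norm x * dist u v"
    by (simp add: dist_norm norm_mult_le flip: diff_right)
  then obtain y where y: "unit + x \<odot> y = y"
    using banach_fix_type[of "norm x" "\<lambda>y. unit + x \<odot> y"] assms by auto
  have "\<forall>u v. dist (unit + u \<odot> x) (unit + v \<odot> x) \<le> norm x * dist u v"
    by (simp add: dist_norm flip: diff_left) (metis mult.commute norm_mult_le)
  then obtain z where z: "unit + z \<odot> x = z"
    using banach_fix_type[of "norm x" "\<lambda>y. unit + y \<odot> x"] assms by auto
  have 1: "(unit - x) \<odot> y = unit" using y by (simp add: diff_left algebra_simps)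
  have 2: "z \<odot> (unit - x) = unit" using z by (simp add: diff_right algebra_simps)
  have "z = y" using 1 2 by (metis assoc unit_left unit_right)
  then show ?thesis using 1 2 by (auto simp: inverse_of_def)
qed

text \<open>x' is x times a factor covered by \<open>neumann\<close>. With y' the inverse of x', the
  identity y' - y = y' (x - x') y first gives norm y' <= 2 norm y and then the estimate with the
  square of norm y.\<close>

lemma inverse_of_perturb:
  assumes xy: "inverse_of x y" and small: "norm (x' - x) * norm y \<le> 1/2"
  shows "invertible x'" "norm (inver x' - y) \<le> 2 * (norm y)\<^sup>2 * norm (x' - x)"
proof -
  have "norm (- (y \<odot> (x' - x))) < 1"
    using norm_mult_le[of y "x' - x"] small by (simp add: mult.commute)
  then obtain w where "inverse_of (unit - (- (y \<odot> (x' - x)))) w" using neumann by blast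
  then have "inverse_of (x \<odot> (unit - (- (y \<odot> (x' - x))))) (w \<odot> y)"
    by (rule inverse_of_mult[OF xy])
  moreover have "x \<odot> (unit - (- (y \<odot> (x' - x)))) = x'"
    using xy by (simp add: bilinear inverse_of_def flip: assoc)
  ultimately show inv: "invertible x'" by (simp add: invertibleI)
  define y' where "y' = inver x'"
  have y': "inverse_of x' y'" unfolding y'_def by (rule inverse_of_inver[OF inv])
  have "y' - y = y' \<odot> (x - x') \<odot> y"
    using xy y' by (simp add: bilinear inverse_of_def assoc)
  then have "norm (y' - y) \<le> norm (y' \<odot> (x - x')) * norm y" using norm_mult_le by metis
  also have "\<dots> \<le> norm y' * norm (x - x') * norm y"
    by (intro mult_right_mono norm_mult_le) simp
  finally have d: "norm (y' - y) \<le> norm y' * (norm (x' - x) * norm y)"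
    by (simp add: norm_minus_commute mult.assoc)
  also have "\<dots> \<le> norm y' * (1/2)" using small by (intro mult_left_mono) auto
  finally have "norm y' \<le> 2 * norm y" using norm_triangle_sub[of y' y] by simp
  then have "norm y' * (norm (x' - x) * norm y) \<le> 2 * norm y * (norm (x' - x) * norm y)"
    by (intro mult_right_mono) auto
  then show "norm (inver x' - y) \<le> 2 * (norm y)\<^sup>2 * norm (x' - x)"
    using d by (simp add: y'_def power2_eq_square mult_ac)
qed

lemma inverse_of_perturb_dist:
  assumes xy: "inverse_of x y"
  shows "\<exists>d>0. \<forall>x'. dist x' x < d \<longrightarrow>
    invertible x' \<and> norm (inver x' - y) \<le> 2 * (norm y)\<^sup>2 * norm (x' - x)"
\<comment> \<open>Without the summand 1 the radius would be 0 for y = 0, which occurs in the zero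
  algebra.\<close>
proof (intro exI[of _ "1 / (2 * (norm y + 1))"] conjI allI impI)
  show "0 < 1 / (2 * (norm y + 1))" by (simp add: add_nonneg_pos)
  have small: "norm (x' - x) * norm y \<le> 1/2" if "dist x' x < 1 / (2 * (norm y + 1))" for x'
  proof -
    have "norm (x' - x) * (2 * (norm y + 1)) < 1"
      using that by (simp add: dist_norm pos_less_divide_eq add_nonneg_pos)
    then have "2 * norm (x' - x) + 2 * (norm (x' - x) * norm y) < 1" by (simp add: algebra_simps)
    then show ?thesis using norm_ge_zero[of "x' - x"] by linarith
  qed
  show "invertible x'" "norm (inver x' - y) \<le> 2 * (norm y)\<^sup>2 * norm (x' - x)"
    if "dist x' x < 1 / (2 * (norm y + 1))" for x'
    using inverse_of_perturb[OF xy small[OF that]] by auto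
qed

lemma open_invertible: "open {x. invertible x}"
  unfolding open_dist
  using inverse_of_perturb_dist inverse_of_inver by (metis mem_Collect_eq)

lemma continuous_on_inver: "continuous_on {x. invertible x} inver"
proof (rule continuous_at_imp_continuous_on, safe)
  fix x assume "invertible x"
  then have xy: "inverse_of x (inver x)" by (rule inverse_of_inver)
  obtain d where d: "0 < d"
    "\<forall>x'. dist x' x < d \<longrightarrow> norm (inver x' - inver x) \<le> 2 * (norm (inver x))\<^sup>2 * norm (x' - x)"
    using inverse_of_perturb_dist[OF xy] by blast
  have "((\<lambda>x'. inver x' - inver x) \<longlongrightarrow> 0) (at x)"
  proof (rule Lim_null_comparison)
    show "\<forall>\<^sub>F x' in at x. norm (inver x' - inver x) \<le> 2 * (norm (inver x))\<^sup>2 * norm (x' - x)"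
      unfolding eventually_at using d by blast
    show "((\<lambda>x'. 2 * (norm (inver x))\<^sup>2 * norm (x' - x)) \<longlongrightarrow> 0) (at x)"
      by (rule tendsto_eq_intros refl | simp)+
  qed
  then show "isCont inver x" unfolding isCont_def by (simp add: LIM_zero_iff)
qed

end

section \<open>Riesz idempotents\<close>

text \<open>The offset of a circle from its centre. The derivative of the circle is 2 pi i times
  this offset, so the normalising factor of the Riesz integral cancels and \<open>circ r t\<close>
  remains as the weight of the resolvent.\<close>

definition circ :: "real \<Rightarrow> real \<Rightarrow> complex" where
  "circ r t = of_real r * exp (2 * of_real pi * \<i> * of_real t)"

lemma circlepath_circ: "circlepath c r t = c + circ r t"
  by (simp add: circlepath circ_def)

lemma norm_circ [simp]: "0 \<le> r \<Longrightarrow> cmod (circ r t) = r"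
  by (simp add: circ_def norm_mult)

lemma continuous_on_circ [continuous_intros]:
  "continuous_on S f \<Longrightarrow> continuous_on S (\<lambda>x. circ r (f x))"
  unfolding circ_def by (intro continuous_intros)

lemma circlepath_derivative: "vector_derivative (circlepath c r) (at t) = 2 * of_real pi * \<i> * circ r t"
  by (simp add: vector_derivative_circlepath circ_def mult_ac)

lemma has_contour_integral_circ:
  "(f has_contour_integral (2 * of_real pi * \<i> * v)) (circlepath c r) \<longleftrightarrow>
   ((\<lambda>t. circ r t * f (c + circ r t)) has_integral v) {0..1}"
proof -
  have eq: "(\<lambda>t. f (circlepath c r t) * vector_derivative (circlepath c r) (at t)) =
      (\<lambda>t. (2 * of_real pi * \<i>) * (circ r t * f (c + circ r t)))"
    by (simp add: circlepath_derivative circlepath_circ mult_ac)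
  show ?thesis
    unfolding has_contour_integral eq
    using has_integral_mult_right[of "\<lambda>t. circ r t * f (c + circ r t)" v "{0..1}" "2 * of_real pi * \<i>"]
      has_integral_mult_right[of "\<lambda>t. (2 * of_real pi * \<i>) * (circ r t * f (c + circ r t))"
        "(2 * of_real pi * \<i>) * v" "{0..1}" "1 / (2 * of_real pi * \<i>)"]
    by auto
qed

lemma circ_integral_inside:
  assumes "cmod (w - c) < r"
  shows "((\<lambda>t. circ r t * (1 / (c + circ r t - w))) has_integral 1) {0..1}"
proof -
  have "((\<lambda>u. 1 / (u - w)) has_contour_integral (2 * of_real pi * \<i> * 1)) (circlepath c r)"
    using Cauchy_integral_circlepath_simple[of "\<lambda>_. 1" c r w] assms by simp
  then show ?thesis by (simp only: has_contour_integral_circ)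
qed

lemma circ_integral_outside:
  assumes "r < cmod (w - c)" "0 \<le> r"
  shows "((\<lambda>t. circ r t * (1 / (c + circ r t - w))) has_integral 0) {0..1}"
proof -
  have "((\<lambda>u. 1 / (u - w)) has_contour_integral (2 * of_real pi * \<i> * 0)) (circlepath c r)"
    using assms
    by (simp, intro Cauchy_theorem_disc_simple[of _ c "cmod (w - c)"] holomorphic_intros)
      (auto simp: dist_norm norm_minus_commute)
  then show ?thesis by (simp only: has_contour_integral_circ)
qed

text \<open>Complex scalars act through left multiplication by j. As j need not be central, the
  complex algebra proper consists of the elements commuting with j; among real linear operators
  these are the complex linear ones.\<close>

locale complex_algebra = banach_algebra mult unit
  for mult :: "'b::banach \<Rightarrow> 'b \<Rightarrow> 'b" (infixl "\<odot>" 70) and unit :: 'b +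
  fixes j :: 'b
  assumes j_square: "j \<odot> j = - unit"
begin

definition commutant :: "'b monoid" where
  "commutant = \<lparr>carrier = {x. x \<odot> j = j \<odot> x}, monoid.mult = (\<odot>), one = unit\<rparr>"

definition cs :: "complex \<Rightarrow> 'b \<Rightarrow> 'b" (infixr "\<cdot>" 75) where
  "z \<cdot> x = Re z *\<^sub>R x + Im z *\<^sub>R (j \<odot> x)"

lemma j_j: "j \<odot> (j \<odot> x) = - x"
  using assoc[of j j x] by (simp add: j_square minus_left)

lemma cscalar_eq: "cscalar commutant j z = z \<cdot> unit"
  by (simp add: cscalar_def commutant_def cs_def)

text \<open>The norm need not be homogeneous for complex factors: on a complexification it comes
  from a product norm. Hence the factor \<open>1 + norm j\<close>, which reappears in later
  bounds.\<close>

lemma norm_cs: "norm (z \<cdot> x) \<le> cmod z * ((1 + norm j) * norm x)"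
proof -
  have "norm (z \<cdot> x) \<le> \<bar>Re z\<bar> * norm x + \<bar>Im z\<bar> * norm (j \<odot> x)"
    unfolding cs_def by (metis norm_scaleR norm_triangle_ineq)
  also have "\<dots> \<le> cmod z * norm x + cmod z * (norm j * norm x)"
    by (intro add_mono mult_mono abs_Re_le_cmod abs_Im_le_cmod norm_mult_le) auto
  finally show ?thesis by (simp add: algebra_simps)
qed

lemma cs_bilinear: "bounded_bilinear (\<cdot>)"
proof
  show "\<exists>K. \<forall>z x. norm (z \<cdot> x) \<le> norm z * norm x * K"
    using norm_cs by (intro exI[of _ "1 + norm j"]) (simp add: mult_ac)
qed (simp_all add: cs_def bilinear algebra_simps)

interpretation cs: bounded_bilinear "(\<cdot>)" by (rule cs_bilinear)

lemma cs_cs: "z \<cdot> w \<cdot> x = (z * w) \<cdot> x"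
  by (simp add: cs_def bilinear j_j algebra_simps)

lemma cs_one [simp]: "1 \<cdot> x = x"
  by (simp add: cs_def)

lemma cs_mult_left: "(z \<cdot> x) \<odot> y = z \<cdot> (x \<odot> y)"
  by (simp add: cs_def bilinear assoc)

definition comm :: "'b \<Rightarrow> bool" where
  "comm x \<longleftrightarrow> x \<odot> j = j \<odot> x"

lemma cs_mult_right: "comm x \<Longrightarrow> x \<odot> (z \<cdot> y) = z \<cdot> (x \<odot> y)"
  unfolding comm_def cs_def by (simp add: bilinear) (metis assoc)

lemma comm_intros:
  "comm unit" "comm x \<Longrightarrow> comm y \<Longrightarrow> comm (x + y)" "comm x \<Longrightarrow> comm y \<Longrightarrow> comm (x - y)"
  "comm x \<Longrightarrow> comm y \<Longrightarrow> comm (x \<odot> y)" "comm x \<Longrightarrow> comm (z \<cdot> x)" "comm x \<Longrightarrow> comm (r *\<^sub>R x)"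
  "comm x \<Longrightarrow> invertible x \<Longrightarrow> comm (inver x)"
  unfolding comm_def cs_def
  by (auto simp: bilinear assoc inver_commute) (metis assoc)+

lemma inverse_of_comm: "comm x \<Longrightarrow> inverse_of x y \<Longrightarrow> comm y"
  using comm_intros(7) inver_eq invertibleI by metis

text \<open>The inverse of an element commuting with j commutes with j as well, so the spectrum in
  \<open>commutant\<close> can be computed with inverses in the full algebra.\<close>

lemma Units_commutant: "x \<in> Units commutant \<longleftrightarrow> comm x \<and> invertible x"
proof -
  have "x \<in> Units commutant \<longleftrightarrow> comm x \<and> (\<exists>y. comm y \<and> inverse_of x y)"
    by (auto simp: Units_def commutant_def comm_def inverse_of_def)
  then show ?thesis using inverse_of_comm by (auto simp: invertible_def)
qed

lemma m_inv_commutant: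
  assumes "comm x" "invertible x"
  shows "inv\<^bsub>commutant\<^esub> x = inver x"
  unfolding m_inv_def
proof (rule the_equality)
  show "inver x \<in> carrier commutant \<and> x \<otimes>\<^bsub>commutant\<^esub> inver x = \<one>\<^bsub>commutant\<^esub> \<and>
      inver x \<otimes>\<^bsub>commutant\<^esub> x = \<one>\<^bsub>commutant\<^esub>"
    using comm_intros(7)[OF assms] inver_cancel[OF assms(2)] by (auto simp: commutant_def comm_def)
  show "y = inver x" if "y \<in> carrier commutant \<and> x \<otimes>\<^bsub>commutant\<^esub> y = \<one>\<^bsub>commutant\<^esub> \<and>
      y \<otimes>\<^bsub>commutant\<^esub> x = \<one>\<^bsub>commutant\<^esub>" for y
    using that inver_eq[of x y] by (auto simp: commutant_def inverse_of_def)
qed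

definition resolvent_set :: "'b \<Rightarrow> complex set" where
  "resolvent_set a = {z. invertible (z \<cdot> unit - a)}"

definition R :: "'b \<Rightarrow> complex \<Rightarrow> 'b" where
  "R a z = inver (z \<cdot> unit - a)"

lemma comm_resolvent_arg: "comm a \<Longrightarrow> comm (z \<cdot> unit - a)"
  by (intro comm_intros)

lemma comm_R: "comm a \<Longrightarrow> z \<in> resolvent_set a \<Longrightarrow> comm (R a z)"
  unfolding R_def resolvent_set_def by (intro comm_intros) auto

lemma spectrum_commutant: "comm a \<Longrightarrow> spectrum commutant j a = - resolvent_set a"
  by (auto simp: spectrum_def resolvent_set_def cscalar_eq Units_commutant comm_resolvent_arg)

lemma open_resolvent_set: "open (resolvent_set a)"
proof -
  have "continuous_on UNIV (\<lambda>z. z \<cdot> unit - a)" by (intro continuous_intros cs.continuous_on)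
  from continuous_open_preimage[OF this open_UNIV open_invertible]
  show ?thesis by (simp add: resolvent_set_def vimage_def)
qed

lemma continuous_on_R:
  assumes "continuous_on S f" "\<And>x. x \<in> S \<Longrightarrow> f x \<in> resolvent_set a"
  shows "continuous_on S (\<lambda>x. R a (f x))"
  unfolding R_def using assms
  by (intro continuous_on_compose2[OF continuous_on_inver] continuous_intros cs.continuous_on)
    (auto simp: resolvent_set_def)

lemma resolvent_identity:
  assumes "comm a" "z \<in> resolvent_set a" "w \<in> resolvent_set a"
  shows "R a z - R a w = (w - z) \<cdot> (R a z \<odot> R a w)"
proof -
  have z: "inverse_of (z \<cdot> unit - a) (R a z)" and w: "inverse_of (w \<cdot> unit - a) (R a w)"
    using assms inverse_of_inver by (auto simp: resolvent_set_def R_def)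
  have "R a z \<odot> (w \<cdot> unit - a) \<odot> R a w - R a z \<odot> (z \<cdot> unit - a) \<odot> R a w
      = R a z \<odot> ((w - z) \<cdot> unit) \<odot> R a w"
    by (simp add: bilinear cs.diff_left)
  also have "\<dots> = (w - z) \<cdot> (R a z \<odot> R a w)"
    using comm_R[OF assms(1,2)] by (simp add: cs_mult_left cs_mult_right)
  also have "R a z \<odot> (w \<cdot> unit - a) \<odot> R a w = R a z"
    using w by (simp add: inverse_of_def assoc)
  also have "R a z \<odot> (z \<cdot> unit - a) \<odot> R a w = R a w"
    using z by (simp add: inverse_of_def)
  finally show ?thesis .
qed

lemma resolvent_set_far:
  assumes "(1 + norm j) * norm a < cmod z"
  shows "z \<in> resolvent_set a"
proof -
  have "0 \<le> (1 + norm j) * norm a" by simp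
  then have "0 < cmod z" using assms by linarith
  then have z: "z \<noteq> 0" by simp
  have "norm ((1 / z) \<cdot> a) \<le> cmod (1 / z) * ((1 + norm j) * norm a)" by (rule norm_cs)
  also have "\<dots> < 1" using assms z by (simp add: norm_divide field_simps)
  finally obtain y where y: "inverse_of (unit - (1 / z) \<cdot> a) y" using neumann by blast
  have "inverse_of (z \<cdot> unit) ((1 / z) \<cdot> unit)"
    using z by (simp add: inverse_of_def cs_mult_left cs_cs)
  from inverse_of_mult[OF this y]
  have "invertible ((z \<cdot> unit) \<odot> (unit - (1 / z) \<cdot> a))" by (rule invertibleI)
  also have "(z \<cdot> unit) \<odot> (unit - (1 / z) \<cdot> a) = z \<cdot> unit - a"
    using z by (simp add: cs_mult_left cs.diff_right cs_cs)
  finally show ?thesis by (simp add: resolvent_set_def)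
qed

text \<open>Complex linear for the action of j; such functionals reduce integrals in the algebra to the
  scalar Cauchy theorem.\<close>

definition cfun :: "('b \<Rightarrow>\<^sub>L real) \<Rightarrow> 'b \<Rightarrow> complex" where
  "cfun f x = Complex (f x) (- f (j \<odot> x))"

lemma cfun_cs: "cfun f (z \<cdot> x) = z * cfun f x"
  by (simp add: cfun_def cs_def complex_eq_iff bilinear j_j blinfun.bilinear_simps algebra_simps)

lemma bounded_linear_cfun: "bounded_linear (cfun f)"
proof -
  have "bounded_linear (\<lambda>x. of_real (f x) + \<i> * of_real (- f (j \<odot> x)) :: complex)"
    by (intro bounded_linear_add bounded_linear_of_real[THEN bounded_linear_compose]
        bounded_linear_const_mult bounded_linear_minus blinfun.bounded_linear_right
        blinfun.bounded_linear_right[THEN bounded_linear_compose] bounded_linear_right)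
  moreover have "(\<lambda>x. of_real (f x) + \<i> * of_real (- f (j \<odot> x)) :: complex) = cfun f"
    by (auto simp: cfun_def complex_eq_iff)
  ultimately show ?thesis by simp
qed

text \<open>The resolvent identity turns the difference quotient at z into
  \<open>- cfun f (R a w \<odot> R a z)\<close>, which is continuous in w.\<close>

lemma holomorphic_cfun_R:
  assumes "comm a"
  shows "(\<lambda>z. cfun f (R a z)) holomorphic_on resolvent_set a"
proof (rule holomorphic_onI)
  fix z assume z: "z \<in> resolvent_set a"
  interpret c: bounded_linear "cfun f" by (rule bounded_linear_cfun)
  have "((\<lambda>w. - cfun f (R a w \<odot> R a z)) \<longlongrightarrow> - cfun f (R a z \<odot> R a z)) (at z)"
  proof -
    have "isCont (\<lambda>w. R a w) z"
      using continuous_on_R[OF continuous_on_id, of "resolvent_set a" a] open_resolvent_set[of a] z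
      by (simp add: continuous_on_eq_continuous_at)
    then have "(R a \<longlongrightarrow> R a z) (at z)" by (simp add: isCont_def)
    then show ?thesis by (intro tendsto_intros c.tendsto tendsto)
  qed
  moreover have "- cfun f (R a w \<odot> R a z) = (cfun f (R a w) - cfun f (R a z)) / (w - z)"
    if "w \<in> resolvent_set a" "w \<noteq> z" for w
  proof -
    have "cfun f (R a w) - cfun f (R a z) = (z - w) * cfun f (R a w \<odot> R a z)"
      by (simp only: c.diff[symmetric] resolvent_identity[OF assms that(1) z] cfun_cs)
    then show ?thesis using that by (simp add: field_simps)
  qed
  ultimately have "((\<lambda>w. (cfun f (R a w) - cfun f (R a z)) / (w - z)) \<longlongrightarrow> - cfun f (R a z \<odot> R a z)) (at z)"
    by (rule Lim_transform_within_open[OF _ open_resolvent_set z]) auto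
  then have "((\<lambda>z. cfun f (R a z)) has_field_derivative - cfun f (R a z \<odot> R a z)) (at z)"
    by (simp add: has_field_derivative_iff)
  then show "(\<lambda>z. cfun f (R a z)) field_differentiable at z within resolvent_set a"
    using field_differentiable_at_within field_differentiable_def by blast
qed

lemma cfun_separates:
  assumes "\<And>f. cfun f x = cfun f y"
  shows "x = y"
proof (rule ccontr)
  assume "x \<noteq> y"
  then obtain g :: "'b \<Rightarrow>\<^sub>L real" where "g (x - y) = 1"
    using functional_vanishing_on_subspace[of "{0}" "x - y"] by (auto simp: subspace_0)
  moreover have "g x = g y" using assms[of g] by (simp add: cfun_def)
  ultimately show False by (simp add: blinfun.diff_right)
qed

section \<open>Integrals of the resolvent over circles\<close>

definition integrand :: "'b \<Rightarrow> complex \<Rightarrow> real \<Rightarrow> real \<Rightarrow> 'b" where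
  "integrand a c r t = circ r t \<cdot> R a (c + circ r t)"

definition riesz :: "'b \<Rightarrow> complex \<Rightarrow> real \<Rightarrow> 'b" where
  "riesz a c r = integral {0..1} (integrand a c r)"

definition good_circle :: "'b \<Rightarrow> complex \<Rightarrow> real \<Rightarrow> bool" where
  "good_circle a c r \<longleftrightarrow> 0 < r \<and> cball c r \<subseteq> {z. 0 < Re z} \<and> {z. 0 < Re z} - resolvent_set a \<subseteq> ball c r"

lemma good_circleD:
  assumes "good_circle a c r"
  shows "c + circ r t \<in> resolvent_set a" "0 < Re (c + circ r t)" "0 < r"
proof -
  show r: "0 < r" using assms by (simp add: good_circle_def)
  have 1: "c + circ r t \<in> cball c r" using r by (simp add: dist_norm)
  then show 2: "0 < Re (c + circ r t)" using assms by (auto simp: good_circle_def)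
  have "c + circ r t \<notin> ball c r" using r by (simp add: dist_norm)
  then show "c + circ r t \<in> resolvent_set a" using assms 2 unfolding good_circle_def by blast
qed

lemma continuous_on_integrand:
  assumes "good_circle a c r"
  shows "continuous_on S (integrand a c r)"
  unfolding integrand_def using good_circleD[OF assms]
  by (intro cs.continuous_on continuous_on_R continuous_intros) auto

lemma integrand_integral:
  assumes "good_circle a c r"
  shows "(integrand a c r has_integral riesz a c r) {0..1}"
  unfolding riesz_def
  by (intro integrable_integral integrable_continuous_interval continuous_on_integrand assms)

text \<open>The straight-line homotopy between two good circles avoids the spectrum and stays in the
  half plane, so Cauchy's theorem gives equal values under every \<open>cfun f\<close>, and these
  functionals separate points.\<close>

lemma riesz_circle_independent:
  assumes a: "comm a" and g: "good_circle a c r" "good_circle a c' r'"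
  shows "riesz a c r = riesz a c' r'"
proof (rule cfun_separates)
  fix f
  let ?S = "{z. 0 < Re z} \<inter> resolvent_set a"
  have S: "open ?S" by (intro open_Int open_resolvent_set open_halfspace_Re_gt)
  let ?\<phi> = "\<lambda>z. cfun f (R a z)"
  have hol: "?\<phi> holomorphic_on ?S"
    by (rule holomorphic_on_subset[OF holomorphic_cfun_R[OF a]]) auto
  have ci: "(?\<phi> has_contour_integral 2 * of_real pi * \<i> * cfun f (riesz a c r)) (circlepath c r)"
    if "good_circle a c r" for c r
    using has_integral_linear[OF integrand_integral[OF that] bounded_linear_cfun[of f]]
    unfolding has_contour_integral_circ by (simp add: o_def integrand_def cfun_cs)
  have "homotopic_loops ?S (circlepath c r) (circlepath c' r')"
  proof (rule homotopic_loops_linear)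
    fix t :: real assume "t \<in> {0..1}"
    show "closed_segment (circlepath c r t) (circlepath c' r' t) \<subseteq> ?S"
    proof
      fix z assume "z \<in> closed_segment (circlepath c r t) (circlepath c' r' t)"
      then obtain u where u: "0 \<le> u" "u \<le> 1"
        "z = (1 - u) *\<^sub>R (c + circ r t) + u *\<^sub>R (c' + circ r' t)"
        by (auto simp: closed_segment_def circlepath_circ)
      have "0 < (1 - u) * Re (c + circ r t) + u * Re (c' + circ r' t)"
      proof (cases "u = 0")
        case False
        then show ?thesis using good_circleD(2)[OF g(1), of t] good_circleD(2)[OF g(2), of t] u(1,2)
          by (intro add_nonneg_pos mult_nonneg_nonneg mult_pos_pos) auto
      qed (use good_circleD(2)[OF g(1), of t] in simp)
      then have Re: "0 < Re z" using u(3) by simp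
      moreover have "z \<in> resolvent_set a"
      proof (rule ccontr)
        assume "z \<notin> resolvent_set a"
        \<comment> \<open>A spectral point of the half plane lies in both open discs. By convexity
          it lies strictly inside the interpolated disc with centre \<open>cc\<close> and radius
          \<open>rr\<close>, whereas z lies on the boundary of that disc.\<close>
        then have b: "cmod (z - c) < r" "cmod (z - c') < r'"
          using g Re by (auto simp: good_circle_def dist_norm norm_minus_commute subset_iff)
        define cc rr where "cc = (1 - u) *\<^sub>R c + u *\<^sub>R c'" and "rr = (1 - u) * r + u * r'"
        have "z - cc = circ rr t"
          using u(3) by (simp add: cc_def rr_def circ_def scaleR_conv_of_real algebra_simps)
        moreover have rr: "0 \<le> rr" using u good_circleD(3)[OF g(1)] good_circleD(3)[OF g(2)]
          by (auto simp: rr_def)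
        ultimately have "cmod (z - cc) = rr" by simp
        moreover have "z - cc = (1 - u) *\<^sub>R (z - c) + u *\<^sub>R (z - c')"
          by (simp add: cc_def algebra_simps)
        then have "cmod (z - cc) \<le> (1 - u) * cmod (z - c) + u * cmod (z - c')"
          using u norm_triangle_ineq[of "(1 - u) *\<^sub>R (z - c)" "u *\<^sub>R (z - c')"] by simp
        moreover have "(1 - u) * cmod (z - c) + u * cmod (z - c') < rr"
        proof (cases "u = 0")
          case False
          then have "u * cmod (z - c') < u * r'" using u b by simp
          moreover have "(1 - u) * cmod (z - c) \<le> (1 - u) * r" using u b by (intro mult_left_mono) auto
          ultimately show ?thesis by (simp add: rr_def)
        qed (use b in \<open>simp add: rr_def\<close>)
        ultimately show False by simp
      qed
      ultimately show "z \<in> ?S" by simp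
    qed
  qed auto
  from Cauchy_theorem_homotopic_loops[OF this S hol]
  have "contour_integral (circlepath c r) ?\<phi> = contour_integral (circlepath c' r') ?\<phi>" by simp
  then show "cfun f (riesz a c r) = cfun f (riesz a c' r')"
    using contour_integral_unique[OF ci[OF g(1)]] contour_integral_unique[OF ci[OF g(2)]] by simp
qed

lemma spectral_idempotent_eq:
  assumes a: "comm a" and g: "good_circle a c r"
  shows "spectral_idempotent commutant j a = riesz a c r"
proof -
  have gc: "0 < r \<and> cball c r \<subseteq> {z. 0 < Re z} \<and> spectrum commutant j a \<inter> {z. 0 < Re z} \<subseteq> ball c r
      \<longleftrightarrow> good_circle a c r" for c r
    by (auto simp: good_circle_def spectrum_commutant[OF a])
  have ig: "(\<lambda>t. cscalar commutant j (vector_derivative (circlepath c r) (at t) / (2 * of_real pi * \<i>))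
      \<otimes>\<^bsub>commutant\<^esub> inv\<^bsub>commutant\<^esub> (cscalar commutant j (circlepath c r t) - a)) = integrand a c r"
    if "good_circle a c r" for c r
  proof
    fix t
    have "invertible ((c + circ r t) \<cdot> unit - a)"
      using good_circleD(1)[OF that] by (simp add: resolvent_set_def)
    then show "cscalar commutant j (vector_derivative (circlepath c r) (at t) / (2 * of_real pi * \<i>))
      \<otimes>\<^bsub>commutant\<^esub> inv\<^bsub>commutant\<^esub> (cscalar commutant j (circlepath c r t) - a) = integrand a c r t"
      using a m_inv_commutant[OF comm_resolvent_arg[OF a, of "c + circ r t"]]
      by (simp add: cscalar_eq circlepath_derivative circlepath_circ integrand_def R_def cs_mult_left)
         (simp add: commutant_def cs_mult_left)
  qed
  show ?thesis
    unfolding spectral_idempotent_def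
  proof (rule the_equality, goal_cases)
    case 1
    show ?case
      using g gc ig[OF g] integrand_integral[OF g] by (intro exI[of _ c] exI[of _ r]) auto
  next
    case (2 e)
    from 2 obtain c' r' where *: "0 < r'" "cball c' r' \<subseteq> {z. 0 < Re z}"
      "spectrum commutant j a \<inter> {z. 0 < Re z} \<subseteq> ball c' r'"
      and "((\<lambda>t. cscalar commutant j (vector_derivative (circlepath c' r') (at t) / (2 * of_real pi * \<i>))
        \<otimes>\<^bsub>commutant\<^esub> inv\<^bsub>commutant\<^esub> (cscalar commutant j (circlepath c' r' t) - a)) has_integral e) {0..1}"
      by (elim exE conjE)
    moreover have g': "good_circle a c' r'" using * gc by blast
    ultimately have e: "(integrand a c' r' has_integral e) {0..1}" by (simp only: ig)
    have "e = riesz a c' r'" using has_integral_unique[OF e integrand_integral[OF g']] .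
    then show "e = riesz a c r" using riesz_circle_independent[OF a g' g] by simp
  qed
qed

end

context complex_algebra
begin

interpretation cs: bounded_bilinear "(\<cdot>)" by (rule cs_bilinear)

lemma bounded_linear_zero_riesz:
  assumes "bounded_linear h" "good_circle a c r" "\<And>t. h (integrand a c r t) = 0"
  shows "h (riesz a c r) = 0"
  using has_integral_linear[OF integrand_integral[OF assms(2)] assms(1)] assms(3)
  by (simp add: o_def)

lemma comm_riesz:
  assumes a: "comm a" and g: "good_circle a c r"
  shows "comm (riesz a c r)"
proof -
  have "(\<lambda>x. x \<odot> j - j \<odot> x) (riesz a c r) = 0"
  proof (rule bounded_linear_zero_riesz[OF _ g])
    show "bounded_linear (\<lambda>x. x \<odot> j - j \<odot> x)"
      by (intro bounded_linear_sub bounded_linear_left bounded_linear_right)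
    show "integrand a c r t \<odot> j - j \<odot> integrand a c r t = 0" for t
      using comm_intros(5)[OF comm_R[OF a good_circleD(1)[OF g]]] by (simp add: integrand_def comm_def)
  qed
  then show ?thesis by (simp add: comm_def)
qed

text \<open>By the resolvent identity, the product of the integrals over two concentric circles splits
  into scalar Cauchy integrals.\<close>

lemma riesz_idempotent:
  assumes a: "comm a" and g: "good_circle a c r"
  shows "riesz a c r \<odot> riesz a c r = riesz a c r"
proof -
  note gD = good_circleD[OF g]
  \<comment> \<open>The leftmost point of the closed disc lies in the open half plane, so r < Re c;
    the midpoint is a larger radius whose disc still fits.\<close>
  define r2 where "r2 = (r + Re c) / 2"
  have "c - of_real r \<in> cball c r" using gD(3) by (simp add: dist_norm)
  then have "0 < Re (c - of_real r)" using g unfolding good_circle_def by blast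
  then have rc: "r < r2" "r2 < Re c" by (auto simp: r2_def)
  have g2: "good_circle a c r2"
    unfolding good_circle_def
  proof (intro conjI)
    show "0 < r2" using rc gD(3) by linarith
    show "cball c r2 \<subseteq> {z. 0 < Re z}"
    proof safe
      fix z assume "z \<in> cball c r2"
      then have "Re (c - z) \<le> r2" using complex_Re_le_cmod[of "c - z"] by (simp add: dist_norm)
      then show "0 < Re z" using rc by simp
    qed
    show "{z. 0 < Re z} - resolvent_set a \<subseteq> ball c r2" using g rc by (auto simp: good_circle_def)
  qed
  note gD2 = good_circleD[OF g2]
  let ?A = "integrand a c r" and ?B = "integrand a c r2"
  define k where "k s t = 1 / (circ r2 t - circ r s)" for s t
  have ne: "circ r2 t \<noteq> circ r s" for s t
    using norm_circ[of r s] norm_circ[of r2 t] rc gD(3) by (metis less_irrefl less_imp_le less_trans)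
  \<comment> \<open>The term of the product that carries the resolvent on the outer circle. Its
    s-integral is 0, since for each t the pole lies outside the inner circle; its t-integral is
    found from \<open>split\<close>, where the pole of the other term lies inside the outer
    circle.\<close>
  define X where "X s t = (circ r s * k s t) \<cdot> ?B t" for s t
  have split: "?A s \<odot> ?B t = (circ r2 t * k s t) \<cdot> ?A s - X s t" for s t
  proof -
    have "?A s \<odot> ?B t = (circ r s * circ r2 t) \<cdot> (R a (c + circ r s) \<odot> R a (c + circ r2 t))"
      using comm_R[OF a gD(1)] by (simp add: integrand_def cs_mult_left cs_mult_right cs_cs)
    also have "R a (c + circ r s) \<odot> R a (c + circ r2 t) = k s t \<cdot> (R a (c + circ r s) - R a (c + circ r2 t))"
      using resolvent_identity[OF a gD(1)[of s] gD2(1)[of t]] ne[of t s]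
      by (simp add: cs_cs k_def)
    finally show ?thesis
      by (simp add: X_def integrand_def cs_cs cs.diff_right mult_ac)
  qed
  have X0: "integral {0..1} (\<lambda>s. X s t) = 0" for t
  proof -
    have "((\<lambda>s. circ r s * (1 / (c + circ r s - (c + circ r2 t)))) has_integral 0) {0..1}"
      using rc gD(3) gD2(3) by (intro circ_integral_outside) auto
    then have "((\<lambda>s. - (circ r s * (1 / (c + circ r s - (c + circ r2 t))))) has_integral - 0) {0..1}"
      by (rule has_integral_neg)
    moreover have "- (circ r s * (1 / (c + circ r s - (c + circ r2 t)))) = circ r s * k s t" for s
      using ne[of t s] by (simp add: k_def field_simps)
    ultimately have "((\<lambda>s. circ r s * k s t) has_integral 0) {0..1}" by simp
    from has_integral_linear[OF this cs.bounded_linear_left[of "?B t"]]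
    show ?thesis by (simp add: X_def o_def cs.zero_left integral_unique)
  qed
  have contX: "continuous_on S (\<lambda>(s, t). X s t)" for S
  proof -
    have "continuous_on S (\<lambda>p. ?B (snd p))"
      by (rule continuous_on_compose2[OF continuous_on_integrand[OF g2, of UNIV]]) (auto intro: continuous_intros)
    then show ?thesis unfolding X_def k_def split_def
      by (intro cs.continuous_on continuous_intros) (use ne in auto)
  qed
  have inner: "integral {0..1} (X s) = ?A s - ?A s \<odot> riesz a c r2" for s
  proof -
    have "((\<lambda>t. circ r2 t * (1 / (c + circ r2 t - (c + circ r s)))) has_integral 1) {0..1}"
      using rc gD(3) by (intro circ_integral_inside) auto
    then have "((\<lambda>t. circ r2 t * k s t) has_integral 1) {0..1}" by (simp add: k_def)
    from has_integral_linear[OF this cs.bounded_linear_left[of "?A s"]]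
    have 1: "((\<lambda>t. (circ r2 t * k s t) \<cdot> ?A s) has_integral ?A s) {0..1}" by (simp add: o_def)
    have 2: "((\<lambda>t. ?A s \<odot> ?B t) has_integral ?A s \<odot> riesz a c r2) {0..1}"
      using has_integral_linear[OF integrand_integral[OF g2] bounded_linear_right[of "?A s"]]
      by (simp add: o_def)
    show ?thesis
      using integral_unique[OF has_integral_diff[OF 1 2]] by (simp add: split)
  qed
  have "integral {0..1} (\<lambda>s. ?A s - ?A s \<odot> riesz a c r2) = integral {0..1} (\<lambda>s. integral {0..1} (X s))"
    by (simp add: inner)
  \<comment> \<open>Exchanging the order of integration makes the vanishing s-integral of X the
    inner one.\<close>
  also have "\<dots> = integral {0..1} (\<lambda>t. integral {0..1} (\<lambda>s. X s t))"
    using integral_swap_continuous[of 0 0 1 1 X] contX by (simp add: cbox_interval)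
  also have "\<dots> = 0" by (simp add: X0)
  finally have z: "integral {0..1} (\<lambda>s. ?A s - ?A s \<odot> riesz a c r2) = 0" .
  have "((\<lambda>s. ?A s - ?A s \<odot> riesz a c r2) has_integral riesz a c r - riesz a c r \<odot> riesz a c r2) {0..1}"
    using has_integral_diff[OF integrand_integral[OF g]
        has_integral_linear[OF integrand_integral[OF g] bounded_linear_left[of "riesz a c r2"]]]
    by (simp add: o_def)
  then have "riesz a c r - riesz a c r \<odot> riesz a c r2 = 0" using z integral_unique by metis
  then show ?thesis using riesz_circle_independent[OF a g2 g] by simp
qed

section \<open>Spectral idempotents of hyperbolic elements\<close>

definition hyperbolic :: "'b \<Rightarrow> bool" where
  "hyperbolic a \<longleftrightarrow> comm a \<and> (\<forall>z. Re z = 0 \<longrightarrow> z \<in> resolvent_set a)"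

text \<open>A large circle, centred on the positive real axis, almost fills the right half plane.\<close>

lemma good_circle_exists:
  assumes "hyperbolic a"
  shows "\<exists>c r. good_circle a (of_real c) r"
proof -
  define M where "M = (1 + norm j) * norm a + 1"
  have M: "0 < M" unfolding M_def by (intro add_nonneg_pos) auto
  define K where "K = {z. 0 \<le> Re z} \<inter> cball 0 M - resolvent_set a"
  have K: "compact K"
    unfolding K_def Diff_eq
    by (intro compact_Int_closed closed_Int_compact closed_halfspace_Re_ge compact_cball)
      (simp add: open_resolvent_set flip: open_closed)
  have far: "z \<in> resolvent_set a" if "M \<le> cmod z" for z
    using that by (intro resolvent_set_far) (simp add: M_def)
  have "\<exists>d>0. \<forall>z\<in>K. d \<le> Re z"
  proof (cases "K = {}")
    case False
    have "continuous_on K Re" by (intro continuous_intros)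
    then obtain z0 where z0: "z0 \<in> K" "\<forall>z\<in>K. Re z0 \<le> Re z"
      using continuous_attains_inf[OF K False] by blast
    then have "Re z0 \<noteq> 0" "0 \<le> Re z0" using assms by (auto simp: K_def hyperbolic_def)
    then show ?thesis using z0 by (intro exI[of _ "Re z0"]) auto
  qed (auto intro: exI[of _ 1])
  then obtain d where d: "0 < d" "\<And>z. z \<in> K \<Longrightarrow> d \<le> Re z" by blast
  \<comment> \<open>Points of K satisfy Re z >= d and |z| <= M, so |c - z|^2 <= c^2 - 2cd + M^2. The
    choice gives cd > M^2, which puts this below c^2 - cd and hence below (c - d/2)^2; r < c keeps
    the disc in the half plane.\<close>
  define c where "c = M\<^sup>2 / d + d"
  define r where "r = c - d / 2"
  have c: "0 < c" "M\<^sup>2 < c * d" using d(1) M by (auto simp: c_def field_simps add_pos_pos)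
  have r: "0 < r" "r < c" using d(1) M by (auto simp: r_def c_def add_pos_pos intro: add_pos_pos)
  have "good_circle a (of_real c) r"
    unfolding good_circle_def
  proof (intro conjI)
    show "0 < r" by fact
    show "cball (of_real c) r \<subseteq> {z. 0 < Re z}"
    proof safe
      fix z assume "z \<in> cball (complex_of_real c) r"
      then have "Re (of_real c - z) \<le> r"
        using complex_Re_le_cmod[of "of_real c - z"] by (simp add: dist_norm)
      then show "0 < Re z" using r by simp
    qed
    show "{z. 0 < Re z} - resolvent_set a \<subseteq> ball (of_real c) r"
    proof safe
      fix z assume z: "0 < Re z" "z \<notin> resolvent_set a"
      then have zM: "cmod z \<le> M" using far by force
      then have "z \<in> K" using z by (simp add: K_def)
      then have dz: "d \<le> Re z" by (rule d(2))
      have "(cmod (of_real c - z))\<^sup>2 = c\<^sup>2 - 2 * c * Re z + (cmod z)\<^sup>2"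
        unfolding cmod_power2 by (simp add: power2_eq_square algebra_simps)
      also have "\<dots> \<le> c\<^sup>2 - 2 * c * d + M\<^sup>2"
        using zM dz c by (intro add_mono diff_mono power_mono) auto
      also have "\<dots> < c\<^sup>2 - c * d" using c by simp
      also have "\<dots> \<le> r\<^sup>2" by (simp add: r_def power2_eq_square algebra_simps)
      finally have "cmod (of_real c - z) < r" using r by (simp add: power2_less_imp_less)
      then show "z \<in> ball (of_real c) r" by (simp add: dist_norm)
    qed
  qed
  then show ?thesis by blast
qed

lemma spectral_idempotent_properties:
  assumes "hyperbolic a"
  shows "comm (spectral_idempotent commutant j a)"
    "spectral_idempotent commutant j a \<odot> spectral_idempotent commutant j a = spectral_idempotent commutant j a"
proof -
  have a: "comm a" using assms by (simp add: hyperbolic_def)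
  obtain c r where g: "good_circle a c r" using good_circle_exists[OF assms] by blast
  show "comm (spectral_idempotent commutant j a)"
    "spectral_idempotent commutant j a \<odot> spectral_idempotent commutant j a = spectral_idempotent commutant j a"
    unfolding spectral_idempotent_eq[OF a g] by (rule comm_riesz[OF a g] riesz_idempotent[OF a g])+
qed

text \<open>For a complexification, complex conjugation is such a map.\<close>

lemma spectral_idempotent_invariant:
  assumes a: "hyperbolic a" and \<sigma>: "bounded_linear \<sigma>" "\<And>x y. \<sigma> (x \<odot> y) = \<sigma> x \<odot> \<sigma> y" "\<sigma> unit = unit"
    "\<sigma> j = - j" "\<sigma> a = a"
  shows "\<sigma> (spectral_idempotent commutant j a) = spectral_idempotent commutant j a"
proof -
  interpret \<sigma>: bounded_linear \<sigma> by fact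
  have c: "comm a" using a by (simp add: hyperbolic_def)
  \<comment> \<open>The centre is real, so complex conjugation maps the circle to itself with
    reversed direction, and the substitution t -> 1 - t undoes the reversal.\<close>
  obtain x r where g: "good_circle a (of_real x) r" using good_circle_exists[OF a] by blast
  have cs: "\<sigma> (z \<cdot> y) = cnj z \<cdot> \<sigma> y" for z y
    by (simp add: cs_def \<sigma>.add \<sigma>.scaleR \<sigma>(2,4) minus_left)
  have "inverse_of (cnj z \<cdot> unit - a) (\<sigma> (R a z))" if "z \<in> resolvent_set a" for z
  proof -
    have i: "inverse_of (z \<cdot> unit - a) (R a z)"
      using that inverse_of_inver by (auto simp: resolvent_set_def R_def)
    have "\<sigma> (z \<cdot> unit - a) = cnj z \<cdot> unit - a" by (simp add: \<sigma>.diff cs \<sigma>(3,5))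
    then show ?thesis using i \<sigma>(2,3) unfolding inverse_of_def by metis
  qed
  then have R: "\<sigma> (R a z) = R a (cnj z)" if "z \<in> resolvent_set a" for z
    using that inver_eq unfolding R_def by metis
  have circ: "cnj (circ r t) = circ r (1 - t)" for t
  proof -
    have "exp (2 * of_real pi * \<i> * of_real (1 - t)) = exp (- (2 * of_real pi * \<i> * of_real t) + 2 * of_real pi * \<i>)"
      by (rule arg_cong[of _ _ exp]) (simp add: algebra_simps)
    also have "\<dots> = exp (- (2 * of_real pi * \<i> * of_real t))"
      unfolding exp_add by simp
    finally show ?thesis by (simp add: circ_def exp_cnj)
  qed
  let ?I = "integrand a (of_real x) r"
  have "\<sigma> (?I t) = ?I (1 - t)" for t
    using R[OF good_circleD(1)[OF g]] by (simp add: integrand_def cs circ)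
  then have "((\<lambda>t. ?I (1 - t)) has_integral \<sigma> (riesz a (of_real x) r)) {0..1}"
    using has_integral_linear[OF integrand_integral[OF g] \<sigma>(1)] by (simp add: o_def)
  moreover have "((\<lambda>t. ?I (1 - t)) has_integral riesz a (of_real x) r) {0..1}"
  proof -
    have "(\<lambda>x::real. 1 - x) ` {0..1} = {0..1}" by (auto intro: image_eqI[of _ _ "1 - _"])
    then show ?thesis
      using has_integral_affinity[of ?I "riesz a (of_real x) r" 0 1 "-1" 1] integrand_integral[OF g]
      by simp
  qed
  ultimately show ?thesis
    unfolding spectral_idempotent_eq[OF c g] by (rule has_integral_unique)
qed

text \<open>A good circle for a stays good for every nearby hyperbolic b, and on it the resolvents
  are uniformly close. The reason is that spectra of nearby elements are bounded by a common M, and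
  on the compact remainder K of the half plane outside the disc the resolvent of a is
  bounded.\<close>

lemma continuous_on_spectral_idempotent:
  "continuous_on {a. hyperbolic a} (spectral_idempotent commutant j)"
  unfolding continuous_on_iff
proof safe
  fix a and e :: real assume a: "hyperbolic a" and e: "0 < e"
  have ca: "comm a" using a by (simp add: hyperbolic_def)
  obtain c r where g: "good_circle a c r" using good_circle_exists[OF a] by blast
  \<comment> \<open>The first entry bounds the spectra of all elements within distance 1 of a, the
    second makes K contain the circle.\<close>
  define M where "M = max ((1 + norm j) * (norm a + 1) + 1) (cmod c + r)"
  define K where "K = {z. 0 \<le> Re z} \<inter> cball 0 M - ball c r"
  have K: "compact K"
    unfolding K_def Diff_eq
    by (intro compact_Int_closed[OF closed_Int_compact[OF closed_halfspace_Re_ge compact_cball]]) (simp add: closed_Compl)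
  have Kres: "z \<in> resolvent_set a" if "z \<in> K" for z
  proof (cases "Re z = 0")
    case False
    then have "0 < Re z" "z \<notin> ball c r" using that by (auto simp: K_def)
    then show ?thesis using g unfolding good_circle_def by blast
  qed (use a in \<open>simp add: hyperbolic_def\<close>)
  have "continuous_on K (R a)"
    using continuous_on_R[OF continuous_on_id, of K a] Kres by simp
  then have "bounded (R a ` K)" using K by (intro compact_imp_bounded compact_continuous_image)
  then obtain m where m: "0 < m" "\<And>z. z \<in> K \<Longrightarrow> norm (R a z) \<le> m"
    unfolding bounded_pos by auto
  \<comment> \<open>The bound 1 goes with the choice of M, 1/(2m) is what
    \<open>inverse_of_perturb\<close> asks for on K, and the last entry brings the integrals within
    e/2 of each other.\<close>
  define d where "d = min 1 (min (1 / (2 * m)) (e / (4 * r * (1 + norm j) * m\<^sup>2)))"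
  have r: "0 < r" by (rule good_circleD(3)[OF g])
  have nj: "0 < 1 + norm j" by (intro add_pos_nonneg) auto
  have d: "0 < d" using m e r nj by (auto simp: d_def)
  show "\<exists>d>0. \<forall>a'\<in>{a. hyperbolic a}. dist a' a < d \<longrightarrow>
      dist (spectral_idempotent commutant j a') (spectral_idempotent commutant j a) < e"
  proof (intro exI[of _ d] conjI ballI impI d)
    fix b assume b: "b \<in> {a. hyperbolic a}" "dist b a < d"
    then have cb: "comm b" by (simp add: hyperbolic_def)
    have nb: "norm (b - a) < d" using b by (simp add: dist_norm)
    have pert: "z \<in> resolvent_set b \<and> norm (R b z - R a z) \<le> 2 * m\<^sup>2 * norm (b - a)" if z: "z \<in> K" for z
    proof -
      have i: "inverse_of (z \<cdot> unit - a) (R a z)"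
        using Kres[OF z] inverse_of_inver by (auto simp: resolvent_set_def R_def)
      have "norm (z \<cdot> unit - b - (z \<cdot> unit - a)) * norm (R a z) \<le> norm (b - a) * m"
        using m(2)[OF z] by (simp add: norm_minus_commute mult_left_mono)
      also have "\<dots> \<le> 1 / (2 * m) * m"
        using nb m by (intro mult_right_mono) (auto simp: d_def)
      also have "\<dots> = 1/2" using m by simp
      finally have s: "norm (z \<cdot> unit - b - (z \<cdot> unit - a)) * norm (R a z) \<le> 1/2" .
      have "norm (R b z - R a z) \<le> 2 * (norm (R a z))\<^sup>2 * norm (b - a)"
        using inverse_of_perturb(2)[OF i s] by (simp add: R_def norm_minus_commute)
      also have "\<dots> \<le> 2 * m\<^sup>2 * norm (b - a)"
        using m(2)[OF z] by (intro mult_right_mono mult_left_mono power_mono) auto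
      finally show ?thesis using inverse_of_perturb(1)[OF i s] by (simp add: resolvent_set_def)
    qed
    have far: "z \<in> resolvent_set b" if "M < cmod z" for z
    proof (rule resolvent_set_far)
      have "norm b \<le> norm a + 1" using nb norm_triangle_sub[of b a] by (simp add: d_def)
      then have "(1 + norm j) * norm b \<le> (1 + norm j) * (norm a + 1)" using nj by (intro mult_left_mono) auto
      then show "(1 + norm j) * norm b < cmod z" using that by (simp add: M_def)
    qed
    have "{z. 0 < Re z} - resolvent_set b \<subseteq> ball c r"
    proof
      fix z assume z: "z \<in> {z. 0 < Re z} - resolvent_set b"
      then have "cmod z \<le> M" using far by force
      then show "z \<in> ball c r" using z pert[of z] by (auto simp: K_def)
    qed
    then have g': "good_circle b c r" using g by (simp add: good_circle_def)
    have inK: "c + circ r t \<in> K" for t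
    proof -
      have "cmod (c + circ r t) \<le> M" using r norm_triangle_ineq[of c "circ r t"] by (simp add: M_def)
      then have "c + circ r t \<in> cball 0 M" unfolding mem_cball_0 .
      moreover have "c + circ r t \<notin> ball c r" using r by (simp add: dist_norm)
      ultimately show ?thesis using good_circleD(2)[OF g, of t] by (simp add: K_def)
    qed
    have "norm (riesz b c r - riesz a c r) \<le> (r * ((1 + norm j) * (2 * m\<^sup>2 * norm (b - a)))) * measure lborel (cbox (0::real) 1)"
    proof (rule has_integral_bound)
      show "((\<lambda>t. integrand b c r t - integrand a c r t) has_integral riesz b c r - riesz a c r) (cbox 0 1)"
        using has_integral_diff[OF integrand_integral[OF g'] integrand_integral[OF g]] by simp
      show "norm (integrand b c r t - integrand a c r t) \<le> r * ((1 + norm j) * (2 * m\<^sup>2 * norm (b - a)))" for t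
      proof -
        have "integrand b c r t - integrand a c r t = circ r t \<cdot> (R b (c + circ r t) - R a (c + circ r t))"
          by (simp add: integrand_def cs.diff_right)
        then have "norm (integrand b c r t - integrand a c r t) \<le>
            r * ((1 + norm j) * norm (R b (c + circ r t) - R a (c + circ r t)))"
          using norm_cs[of "circ r t"] r by simp
        also have "\<dots> \<le> r * ((1 + norm j) * (2 * m\<^sup>2 * norm (b - a)))"
          using pert[OF inK[of t]] r nj by (intro mult_left_mono) auto
        finally show ?thesis .
      qed
      show "0 \<le> r * ((1 + norm j) * (2 * m\<^sup>2 * norm (b - a)))" using r nj by simp
    qed
    also have "\<dots> = (2 * r * (1 + norm j) * m\<^sup>2) * norm (b - a)" by simp
    also have "\<dots> \<le> (2 * r * (1 + norm j) * m\<^sup>2) * (e / (4 * r * (1 + norm j) * m\<^sup>2))"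
      using nb r nj m by (intro mult_left_mono) (auto simp: d_def)
    also have "\<dots> = e / 2"
    proof -
      define D where "D = r * (1 + norm j) * m\<^sup>2"
      have "0 < D" using r nj m by (simp add: D_def)
      then have "2 * D * (e / (4 * D)) = e / 2" by simp
      then show ?thesis by (simp add: D_def mult.assoc)
    qed
    also have "\<dots> < e" using e by simp
    finally show "dist (spectral_idempotent commutant j b) (spectral_idempotent commutant j a) < e"
      by (simp add: spectral_idempotent_eq[OF cb g'] spectral_idempotent_eq[OF ca g] dist_norm)
  qed
qed

text \<open>The resolvent at z is p/(z - 1) + (1 - p)/(z + 1), so the circle of radius 1/2 about 1
  is good and collects the residue p.\<close>

lemma spectral_idempotent_reflection:
  assumes p: "comm p" "p \<odot> p = p"
  shows "spectral_idempotent commutant j (2 *\<^sub>R p - unit) = p"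
proof -
  let ?a = "2 *\<^sub>R p - unit"
  have a: "comm ?a" using p by (intro comm_intros)
  have i: "inverse_of (z \<cdot> unit - ?a) ((1 / (z - 1)) \<cdot> p + (1 / (z + 1)) \<cdot> (unit - p))"
    if z: "z \<noteq> 1" "z \<noteq> -1" for z
  proof -
    have "z + 1 \<noteq> 0" using z(2) by (metis add.right_inverse add_right_cancel add.commute)
    have two: "2 *\<^sub>R x = 2 \<cdot> x" for x by (simp add: cs_def)
    have "z \<cdot> unit - ?a = (z - 1) \<cdot> p + (z + 1) \<cdot> (unit - p)"
      by (simp add: two cs.diff_left cs.add_left cs.diff_right algebra_simps) (simp add: cs_def scaleR_2)
    then show ?thesis
      using z \<open>z + 1 \<noteq> 0\<close> p
      by (simp add: inverse_of_def bilinear cs_mult_left cs_mult_right comm_intros cs_cs cs.diff_right)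
  qed
  have g: "good_circle ?a 1 (1/2)"
    unfolding good_circle_def
  proof (intro conjI)
    show "cball 1 (1/2) \<subseteq> {z. 0 < Re z}"
    proof safe
      fix z assume "z \<in> cball (1::complex) (1/2)"
      then have "Re (1 - z) \<le> 1/2" using complex_Re_le_cmod[of "1 - z"] by (simp add: dist_norm)
      then show "0 < Re z" by simp
    qed
    show "{z. 0 < Re z} - resolvent_set ?a \<subseteq> ball 1 (1/2)"
    proof safe
      fix z assume z: "0 < Re z" "z \<notin> resolvent_set ?a"
      then have "z = 1 \<or> z = -1" using i invertibleI by (auto simp: resolvent_set_def)
      then show "z \<in> ball 1 (1/2)" using z by auto
    qed
  qed simp
  have ne: "1 + circ (1/2) t \<noteq> 1" "1 + circ (1/2) t \<noteq> -1" for t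
  proof -
    have "circ (1/2) t \<noteq> 0" using norm_circ[of "1/2" t] by (metis half_gt_zero less_irrefl less_imp_le norm_zero zero_less_one)
    then show "1 + circ (1/2) t \<noteq> 1" by simp
    show "1 + circ (1/2) t \<noteq> -1"
    proof
      assume *: "1 + circ (1/2) t = -1"
      show False using good_circleD(2)[OF g, of t] unfolding * by simp
    qed
  qed
  have "((\<lambda>t. (circ (1/2) t * (1 / (1 + circ (1/2) t - 1))) \<cdot> p +
      (circ (1/2) t * (1 / (1 + circ (1/2) t - (-1)))) \<cdot> (unit - p)) has_integral 1 \<cdot> p + 0 \<cdot> (unit - p)) {0..1}"
    using has_integral_add[OF
        has_integral_linear[OF circ_integral_inside[of 1 1 "1/2"] cs.bounded_linear_left[of p]]
        has_integral_linear[OF circ_integral_outside[of "1/2" "-1" 1] cs.bounded_linear_left[of "unit - p"]]]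
    by (simp add: o_def del: cs_one)
  moreover have "integrand ?a 1 (1/2) = (\<lambda>t. (circ (1/2) t * (1 / (1 + circ (1/2) t - 1))) \<cdot> p +
      (circ (1/2) t * (1 / (1 + circ (1/2) t - (-1)))) \<cdot> (unit - p))"
    using inver_eq[OF i[OF ne]] by (simp add: fun_eq_iff integrand_def R_def cs.add_right cs_cs)
  ultimately have "(integrand ?a 1 (1/2) has_integral p) {0..1}"
    by (simp only: cs.zero_left cs_one add_0_right)
  then have "riesz ?a 1 (1/2) = p" using has_integral_unique[OF integrand_integral[OF g]] by blast
  then show ?thesis using spectral_idempotent_eq[OF a g] by simp
qed

end

section \<open>The Calkin algebra as a Banach algebra\<close>

lemma bounded_linear_quot: "bounded_linear quot"
  by (rule bounded_linear_intro[of _ 1]) (simp_all add: quot_simps calkin_norm_le)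

text \<open>For a subsequence with steps below 2^-n, the differences lift to operators of norm below
  2^-n. These are summable, and the class of their sum plus the first term is the limit.\<close>

instance calkin :: (banach) banach
proof
  fix X :: "nat \<Rightarrow> 'a calkin"
  assume X: "Cauchy X"
  have "\<exists>r. \<forall>n. (\<forall>m\<ge>r n. dist (X m) (X (r n)) < (1/2) ^ n) \<and> r n < (r (Suc n) :: nat)"
  proof (rule dependent_nat_choice[where P = "\<lambda>n N. \<forall>m\<ge>N. dist (X m) (X N) < (1/2) ^ n"
        and Q = "\<lambda>n x y. x < y"])
    have *: "\<exists>N. \<forall>m\<ge>N. \<forall>k\<ge>N. dist (X m) (X k) < (1/2) ^ n" for n
      using X unfolding Cauchy_def by simp
    show "\<exists>N. \<forall>m\<ge>N. dist (X m) (X N) < (1/2) ^ 0" using *[of 0] by blast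
    show "\<exists>N. (\<forall>m\<ge>N. dist (X m) (X N) < (1/2) ^ Suc n) \<and> x < N" for x n
    proof -
      obtain N where "\<forall>m\<ge>N. \<forall>k\<ge>N. dist (X m) (X k) < (1/2) ^ Suc n" using *[of "Suc n"] by blast
      then show ?thesis by (intro exI[of _ "max N (Suc x)"]) auto
    qed
  qed
  then obtain r where r: "\<And>n m. m \<ge> r n \<Longrightarrow> dist (X m) (X (r n)) < (1/2) ^ n" "\<And>n. r n < r (Suc n)"
    by blast
  have mono: "strict_mono r" using r(2) by (simp add: strict_mono_Suc_iff)
  have "\<exists>D. quot D = X (r (Suc n)) - X (r n) \<and> norm D < (1/2) ^ n" for n
  proof -
    have "norm (X (r (Suc n)) - X (r n)) < (1/2) ^ n"
      using r(1)[of n "r (Suc n)"] r(2)[of n] by (simp add: dist_norm)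
    then obtain A where "X (r (Suc n)) - X (r n) = quot A" "norm A < (1/2) ^ n"
      by (rule calkin_norm_approx)
    then show ?thesis by (intro exI[of _ A]) simp
  qed
  then obtain D where D: "\<And>n. quot (D n) = X (r (Suc n)) - X (r n)" "\<And>n. norm (D n) < (1/2) ^ n"
    by metis
  have "summable (\<lambda>n. (1/2::real) ^ n)" by (rule summable_geometric) simp
  then have "summable D" by (rule summable_comparison_test') (use D(2) less_imp_le in blast)
  then have "(\<lambda>n. quot (D n)) sums quot (suminf D)"
    by (intro bounded_linear.sums[OF bounded_linear_quot] summable_sums)
  then have "(\<lambda>n. X (r n) - X (r 0)) \<longlonglongrightarrow> quot (suminf D)"
    unfolding sums_def D(1) by (simp only: sum_lessThan_telescope[of "\<lambda>n. X (r n)"])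
  then have "(X \<circ> r) \<longlonglongrightarrow> quot (suminf D) + X (r 0)"
    using tendsto_add[OF _ tendsto_const[of "X (r 0)"]] by (fastforce simp: o_def)
  then show "convergent X"
    using Cauchy_converges_subseq[OF X mono] by (auto simp: convergent_def)
qed

interpretation calkin: banach_algebra "(*) :: 'a::banach calkin \<Rightarrow> _" 1
proof -
  interpret bounded_bilinear "(*) :: 'a calkin \<Rightarrow> _" by (rule bounded_bilinear_mult)
  show "banach_algebra ((*) :: 'a calkin \<Rightarrow> _) 1"
    by unfold_locales (simp_all add: mult.assoc norm_mult_ineq)
qed

interpretation operator: banach_algebra "(o\<^sub>L) :: ('a::banach \<Rightarrow>\<^sub>L 'a) \<Rightarrow> _" id_blinfun
proof -
  interpret bounded_bilinear "(o\<^sub>L) :: ('a \<Rightarrow>\<^sub>L 'a) \<Rightarrow> _" by (rule bounded_bilinear_blinfun_compose)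
  show "banach_algebra ((o\<^sub>L) :: ('a \<Rightarrow>\<^sub>L 'a) \<Rightarrow> _) id_blinfun"
    by unfold_locales (auto intro: blinfun_eqI norm_blinfun_compose)
qed

section \<open>Fredholm operators are invertible modulo compact operators\<close>

text \<open>The right inverse on the range comes from the open mapping theorem applied to
  \<open>(x, y) \<mapsto> T x + \<rho> y\<close>, where \<open>\<rho>\<close> projects onto a complement of the range.\<close>

lemma calkin_invertible_if_fredholm:
  fixes T :: "'a::banach \<Rightarrow>\<^sub>L 'a"
  assumes ker: "finite B" "span B = {x. T x = 0}"
    and ran: "finite D" "\<And>x. T x \<in> span D \<Longrightarrow> T x = 0" "\<And>y. \<exists>x. y - T x \<in> span D"
  shows "calkin.invertible (quot T)"
proof -
  obtain \<pi> :: "'a \<Rightarrow>\<^sub>L 'a" where \<pi>: "compact_operator \<pi>" "range (blinfun_apply \<pi>) \<subseteq> span B"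
    "\<And>x. x \<in> span B \<Longrightarrow> \<pi> x = x"
    using finite_rank_projection[OF ker(1)] by blast
  obtain \<rho> :: "'a \<Rightarrow>\<^sub>L 'a" where \<rho>: "range (blinfun_apply \<rho>) \<subseteq> span D" "\<And>x. x \<in> span D \<Longrightarrow> \<rho> x = x"
    using finite_rank_projection[OF ran(1)] by blast
  have bl: "bounded_linear (\<lambda>p. T (fst p) + \<rho> (snd p))"
    by (intro bounded_linear_add blinfun.bounded_linear_right[THEN bounded_linear_compose]
        bounded_linear_fst bounded_linear_snd)
  have "surj (\<lambda>p. T (fst p) + \<rho> (snd p))"
  proof (rule surjI)
    fix y
    have "y - T (SOME x. y - T x \<in> span D) \<in> span D" by (rule someI_ex) (rule ran(3))
    then show "T (fst (SOME x. y - T x \<in> span D, y - T (SOME x. y - T x \<in> span D)))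
      + \<rho> (snd (SOME x. y - T x \<in> span D, y - T (SOME x. y - T x \<in> span D))) = y"
      using \<rho>(2) by simp
  qed
  then obtain M where M: "0 < M" "\<And>y. \<exists>p. T (fst p) + \<rho> (snd p) = y \<and> norm p \<le> M * norm y"
    using open_mapping_bound[OF bl] by blast
  have "\<exists>x c. T x + c = y \<and> c \<in> span D \<and> norm x \<le> M * norm y" for y
  proof -
    obtain p where p: "T (fst p) + \<rho> (snd p) = y" "norm p \<le> M * norm y" using M(2) by blast
    have "\<rho> (snd p) \<in> span D" using \<rho>(1) by blast
    then show ?thesis using p norm_fst_le[of "fst p" "snd p"] by (metis order_trans prod.collapse)
  qed
  then obtain f g where fg: "\<And>y. T (f y) + g y = y" "\<And>y. g y \<in> span D" "\<And>y. norm (f y) \<le> M * norm y"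
    by metis
  \<comment> \<open>The preimage part \<open>f y\<close> is determined up to the kernel of T.
    Removing its image under \<open>\<pi>\<close> gives a value independent of the choice, and this
    makes s linear.\<close>
  define s where "s y = f y - \<pi> (f y)" for y
  have s: "s y = x - \<pi> x" if "T x + c = y" "c \<in> span D" for x y c
  proof -
    have "T (x - f y) = g y - c" using that(1) fg(1)[of y] by (simp add: blinfun.diff_right algebra_simps)
    moreover have "g y - c \<in> span D" using that(2) fg(2) by (intro span_diff)
    ultimately have "T (x - f y) = 0" using ran(2) by metis
    then have "\<pi> (x - f y) = x - f y" using \<pi>(3) ker(2) by blast
    then show ?thesis by (simp add: s_def blinfun.diff_right algebra_simps)
  qed
  have "bounded_linear s"
  proof (rule bounded_linear_intro)
    fix x y r
    show "s (x + y) = s x + s y"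
    proof -
      have "T (f x + f y) + (g x + g y) = x + y"
        using fg(1)[of x] fg(1)[of y] by (simp add: blinfun.add_right algebra_simps)
      from s[OF this span_add[OF fg(2) fg(2)]] show ?thesis
        by (simp add: s_def blinfun.add_right)
    qed
    show "s (r *\<^sub>R x) = r *\<^sub>R s x"
    proof -
      have "T (r *\<^sub>R f x) + r *\<^sub>R g x = r *\<^sub>R x"
        using fg(1)[of x] by (simp add: blinfun.scaleR_right flip: scaleR_add_right)
      from s[OF this span_scale[OF fg(2)]] show ?thesis
        by (simp add: s_def blinfun.scaleR_right scaleR_diff_right)
    qed
    have "norm (s x) \<le> norm (f x) + norm \<pi> * norm (f x)"
      unfolding s_def using norm_triangle_ineq4[of "f x" "\<pi> (f x)"] norm_blinfun[of \<pi> "f x"] by linarith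
    also have "\<dots> \<le> M * norm x + norm \<pi> * (M * norm x)" by (intro add_mono mult_left_mono fg(3)) auto
    finally show "norm (s x) \<le> norm x * (M + norm \<pi> * M)" by (simp add: algebra_simps)
  qed
  then have S: "blinfun_apply (Blinfun s) = s" by (rule bounded_linear_Blinfun_apply)
  have "T (\<pi> x) = 0" for x using \<pi>(2) ker(2) by blast
  then have "T (s y) - y \<in> span D" for y
    using fg(1)[of y] span_neg[OF fg(2)[of y]] by (simp add: s_def blinfun.diff_right) (metis add_diff_cancel_left' diff_0 minus_diff_eq)
  then have "compact_operator ((T o\<^sub>L Blinfun s) - id_blinfun)"
    by (intro compact_operator_finite_rank[OF ran(1)]) (auto simp: S blinfun.diff_left)
  moreover have "(Blinfun s o\<^sub>L T) - id_blinfun = - \<pi>"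
    using s[of _ 0, simplified] by (intro blinfun_eqI) (simp add: S blinfun.diff_left blinfun.minus_left span_zero)
  then have "compact_operator ((Blinfun s o\<^sub>L T) - id_blinfun)"
    using compact_operator_uminus[OF \<pi>(1)] by simp
  ultimately have "calkin.inverse_of (quot T) (quot (Blinfun s))"
    unfolding calkin.inverse_of_def by (simp add: quot_simps(7) quot_eq_iff flip: quot_simps(2))
  then show ?thesis by (rule calkin.invertibleI)
qed

locale complex_structure =
  fixes J :: "'c::banach \<Rightarrow>\<^sub>L 'c"
  assumes J_square: "J o\<^sub>L J = - id_blinfun"
begin

lemma J_J [simp]: "J (J x) = - x"
  using arg_cong[OF J_square, of "\<lambda>A. blinfun_apply A x"] by (simp add: blinfun.minus_left)

definition scale :: "complex \<Rightarrow> 'c \<Rightarrow> 'c" where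
  "scale z x = Re z *\<^sub>R x + Im z *\<^sub>R J x"

sublocale vector_space scale
  by unfold_locales (simp_all add: scale_def blinfun.bilinear_simps algebra_simps)

sublocale operators: complex_algebra "(o\<^sub>L)" id_blinfun J
  by unfold_locales (rule J_square)

sublocale calkin: complex_algebra "(*)" 1 "quot J"
  by unfold_locales (simp only: quot_simps(7) J_square quot_simps(4)[symmetric] quot_simps(2))

text \<open>A complex spanning set B becomes a real one when J B is added. In this way complex
  Fredholm conditions reach \<open>calkin_invertible_if_fredholm\<close>, which is about real
  spans.\<close>

lemma finite_dimensional_real:
  assumes "finite_dimensional scale V"
  shows "\<exists>B. finite B \<and> real_vector.span B = V"
proof -
  obtain B where B: "finite B" "span B = V" using assms by (auto simp: finite_dimensional_def)
  let ?R = "real_vector.span (B \<union> J ` B)"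
  have V: "subspace V" using B(2) subspace_span by blast
  have J: "J x \<in> ?R" if "x \<in> ?R" for x
    using that
  proof (induction rule: real_vector.span_induct_alt)
    case (step c x y)
    have "J x \<in> ?R"
    proof (cases "x \<in> B")
      case False
      then obtain b where "x = J b" "b \<in> B" using step by blast
      then show ?thesis by (simp add: real_vector.span_neg real_vector.span_base)
    qed (simp add: real_vector.span_base)
    then show ?case using step
      by (auto simp: blinfun.bilinear_simps intro: real_vector.span_add real_vector.span_scale)
  qed (simp add: real_vector.span_zero)
  have sR: "subspace ?R"
    using J by (intro subspaceI) (auto simp: scale_def intro!: real_vector.span_add real_vector.span_scale real_vector.span_zero)
  have "V \<subseteq> ?R"
    unfolding B(2)[symmetric] by (intro span_minimal sR) (auto intro: real_vector.span_base)
  moreover have "?R \<subseteq> V"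
  proof (rule real_vector.span_minimal)
    have JV: "J x \<in> V" if "x \<in> V" for x
      using subspace_scale[OF V that, of \<i>] by (simp add: scale_def)
    then show "B \<union> J ` B \<subseteq> V" using B(2) span_superset by blast
    show "real_vector.subspace V"
    proof (rule real_vector.subspaceI)
      show "c *\<^sub>R x \<in> V" if "x \<in> V" for c x
        using subspace_scale[OF V that, of "of_real c"] by (simp add: scale_def)
    qed (use subspace_0[OF V] subspace_add[OF V] in auto)
  qed
  ultimately show ?thesis using B(1) by (intro exI[of _ "B \<union> J ` B"]) auto
qed

lemma calkin_invertible_if_complex_fredholm:
  assumes "fredholm scale UNIV UNIV (blinfun_apply T)"
  shows "calkin.invertible (quot T)"
proof -
  obtain B where B: "finite B" "real_vector.span B = {x. T x = 0}"
    using finite_dimensional_real assms unfolding fredholm_def by auto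
  obtain C where C: "is_complement scale UNIV (range (blinfun_apply T)) C" "finite_dimensional scale C"
    using assms by (auto simp: fredholm_def finite_codimensional_def)
  obtain D where D: "finite D" "real_vector.span D = C" using finite_dimensional_real[OF C(2)] by blast
  show ?thesis
  proof (rule calkin_invertible_if_fredholm[OF B D(1)])
    show "T x = 0" if "T x \<in> real_vector.span D" for x
      using C(1) that D(2) unfolding is_complement_def by blast
    show "\<exists>x. y - T x \<in> real_vector.span D" for y
    proof -
      have "y \<in> {w + c |w c. w \<in> range (blinfun_apply T) \<and> c \<in> C}"
        using C(1) unfolding is_complement_def by blast
      then obtain x c where "y = T x + c" "c \<in> C" by blast
      then show ?thesis by (intro exI[of _ x]) (simp add: D(2))
    qed
  qed
qed

text \<open>A representative A commutes with J up to a compact operator. The average of A and - J A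
  J commutes exactly and has the same class, because J squares to -1.\<close>

lemma average_commutes:
  assumes "X * quot J = quot J * X"
  obtains B where "B o\<^sub>L J = J o\<^sub>L B" "X = quot B"
proof -
  obtain A where A: "X = quot A" by (rule calkin_exhaust)
  define B where "B = (1/2) *\<^sub>R (A - (J o\<^sub>L A o\<^sub>L J))"
  have "B o\<^sub>L J = J o\<^sub>L B"
    by (rule blinfun_eqI) (simp add: B_def blinfun.bilinear_simps)
  moreover have "quot B = X"
  proof -
    have "quot (J o\<^sub>L A o\<^sub>L J) = quot J * X * quot J" by (simp add: A quot_simps)
    also have "\<dots> = X * (quot J * quot J)" using assms by (metis mult.assoc)
    also have "\<dots> = - X" by (simp add: calkin.j_square)
    finally have "quot (A - (J o\<^sub>L A o\<^sub>L J)) = 2 *\<^sub>R X"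
      by (simp add: A scaleR_2 flip: quot_simps(5))
    then show ?thesis by (simp add: B_def flip: quot_simps(6))
  qed
  ultimately show thesis using that by blast
qed

lemma commutant_calkin_carrier:
  "quot ` {T. T o\<^sub>L J = J o\<^sub>L T} = {X. X * quot J = quot J * X}"
proof
  show "{X. X * quot J = quot J * X} \<subseteq> quot ` {T. T o\<^sub>L J = J o\<^sub>L T}"
    using average_commutes by blast
qed (auto simp: quot_simps)

end

section \<open>Relative dimension of projectors\<close>

lemma fredholm_index_cong:
  assumes "\<And>x. x \<in> V \<Longrightarrow> T x = T' x"
  shows "fredholm s V W T = fredholm s V W T'" "fredholm_index s V W T = fredholm_index s V W T'"
proof -
  have "{x \<in> V. T x = 0} = {x \<in> V. T' x = 0}" "T ` V = T' ` V" using assms by auto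
  then show "fredholm s V W T = fredholm s V W T'" "fredholm_index s V W T = fredholm_index s V W T'"
    by (simp_all add: fredholm_def fredholm_index_def)
qed

lemma operator_inverse_apply:
  assumes "operator.inverse_of A B"
  shows "blinfun_apply A (B x) = x" "blinfun_apply B (A x) = x"
proof -
  have "A o\<^sub>L B = id_blinfun" "B o\<^sub>L A = id_blinfun"
    using assms by (simp_all add: operator.inverse_of_def)
  from this[THEN arg_cong[of _ _ "\<lambda>C. blinfun_apply C x"]]
  show "A (B x) = x" "B (A x) = x" by simp_all
qed

text \<open>The common ground of real and complex scalars: a field in which every real multiple is
  available as a scalar multiple.\<close>

locale scalar_space =
  fixes E :: "('k::field, 'a::banach, 'c) kspace"
  assumes vector_space: "vector_space (scal E)"
    and real_scalar: "\<exists>k. \<forall>x. scal E k x = r *\<^sub>R x"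
begin

sublocale vector_space "scal E"
  by (rule vector_space)

lemma operator_scale: "A \<in> operators E \<Longrightarrow> A (scal E k x) = scal E k (A x)"
  by (simp add: operators_def)

lemma operator_linear: "A \<in> operators E \<Longrightarrow> Vector_Spaces.linear (scal E) (scal E) (blinfun_apply A)"
  by unfold_locales (simp_all add: blinfun.add_right operator_scale)

lemma scale_real: "scal E k (r *\<^sub>R x) = r *\<^sub>R scal E k x"
proof -
  obtain l where "\<And>x. scal E l x = r *\<^sub>R x" using real_scalar by blast
  then show ?thesis by (metis scale_left_commute)
qed

lemma operators_intros:
  "0 \<in> operators E" "id_blinfun \<in> operators E"
  "A \<in> operators E \<Longrightarrow> B \<in> operators E \<Longrightarrow> A + B \<in> operators E"
  "A \<in> operators E \<Longrightarrow> B \<in> operators E \<Longrightarrow> A - B \<in> operators E"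
  "A \<in> operators E \<Longrightarrow> r *\<^sub>R A \<in> operators E"
  "A \<in> operators E \<Longrightarrow> B \<in> operators E \<Longrightarrow> (A o\<^sub>L B) \<in> operators E"
  by (auto simp: operators_def blinfun.bilinear_simps scale_right_distrib scale_right_diff_distrib scale_real)

lemma operators_inverse:
  assumes "A \<in> operators E" "operator.inverse_of A B"
  shows "B \<in> operators E"
proof -
  note inv = operator_inverse_apply[OF assms(2)]
  have "B (scal E k x) = scal E k (B x)" for k x
  proof -
    have "B (scal E k (A (B x))) = B (A (scal E k (B x)))" using assms(1) by (simp add: operator_scale)
    then show ?thesis by (simp add: inv)
  qed
  then show ?thesis by (simp add: operators_def)
qed

lemma projectorsD:
  assumes "Q \<in> projectors E"
  shows "Q \<in> operators E" "Q o\<^sub>L Q = Q" "Q (Q x) = Q x" "x \<in> range (blinfun_apply Q) \<longleftrightarrow> Q x = x"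
proof -
  show Q: "Q \<in> operators E" "Q o\<^sub>L Q = Q" using assms by (auto simp: projectors_def)
  show QQ: "Q (Q x) = Q x" for x using arg_cong[OF Q(2), of "\<lambda>A. blinfun_apply A x"] by simp
  show "x \<in> range (blinfun_apply Q) \<longleftrightarrow> Q x = x" using QQ by (metis rangeE rangeI)
qed

lemma subspace_range:
  assumes "A \<in> operators E"
  shows "subspace (range (blinfun_apply A))"
proof -
  interpret A: Vector_Spaces.linear "scal E" "scal E" "blinfun_apply A"
    by (rule operator_linear[OF assms])
  show ?thesis by (rule A.subspace_image) simp
qed

lemma finite_dimensional_if_real:
  assumes "finite B" "real_vector.span B = V" "subspace V"
  shows "finite_dimensional (scal E) V"
proof -
  have sub: "real_vector.subspace (span B)"
  proof (rule real_vector.subspaceI)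
    fix c :: real and x assume "x \<in> span B"
    moreover obtain k where "\<And>x. scal E k x = c *\<^sub>R x" using real_scalar by blast
    ultimately show "c *\<^sub>R x \<in> span B" using span_scale by metis
  qed (auto intro: span_zero span_add)
  have "V \<subseteq> span B"
    using real_vector.span_minimal[OF span_superset sub] assms(2) by blast
  moreover have "span B \<subseteq> V"
    using span_minimal[OF _ assms(3)] assms(2) real_vector.span_superset by blast
  ultimately show ?thesis using assms(1) by (auto simp: finite_dimensional_def)
qed

text \<open>Extended by the identity on the kernel of Q, the map B becomes t = 1 - (Q - B), to which
  the Riesz decomposition applies. Its finite-dimensional part N lies in V, and B permutes the
  remaining part R of V bijectively.\<close>

lemma index_compact_perturbation:
  assumes Q: "Q \<in> projectors E" and B: "B \<in> operators E" "B o\<^sub>L Q = B" "Q o\<^sub>L B = B"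
    and K: "compact_operator (Q - B)"
  defines "V \<equiv> range (blinfun_apply Q)"
  shows "fredholm (scal E) V V (blinfun_apply B)" "fredholm_index (scal E) V V (blinfun_apply B) = 0"
proof -
  note Q' = projectorsD[OF Q]
  have QB: "Q (B x) = B x" for x
    using arg_cong[OF B(3), of "\<lambda>A. blinfun_apply A x"] by simp
  define t where "t x = x - (Q - B) x" for x
  have tx: "t x = x - Q x + B x" for x by (simp add: t_def blinfun.diff_left)
  have teq: "(\<lambda>x. x - (Q - B) x) = t" by (rule ext) (simp add: t_def)
  obtain n D where nD: "finite D" "real_vector.span D = {x. (t ^^ n) x = 0}"
    "\<And>x. (t ^^ n) x = 0 \<Longrightarrow> x \<in> range (t ^^ n) \<Longrightarrow> x = 0"
    "\<And>x. \<exists>y. (t ^^ n) (x - (t ^^ n) y) = 0"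
    "t ` range (t ^^ n) = range (t ^^ n)" "inj_on t (range (t ^^ n))"
    using riesz_decomposition[OF K] unfolding teq by metis
  \<comment> \<open>The component outside V is unchanged by t. Hence kernel vectors of its powers
    lie in V, and t x in V forces x in V.\<close>
  have Qt: "t x - Q (t x) = x - Q x" for x by (simp add: tx blinfun.bilinear_simps Q' QB)
  have Qtn: "(t ^^ m) x - Q ((t ^^ m) x) = x - Q x" for m x
    by (induction m) (simp_all add: Qt)
  have lt: "Vector_Spaces.linear (scal E) (scal E) t"
    using B(1) Q'(1)
    by unfold_locales (simp_all add: tx blinfun.add_right operator_scale algebra_simps scale_right_distrib scale_right_diff_distrib)
  have ltn: "Vector_Spaces.linear (scal E) (scal E) (t ^^ m)" for m
  proof (induction m)
    case (Suc m)
    interpret a: Vector_Spaces.linear "scal E" "scal E" "t ^^ m" by fact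
    interpret b: Vector_Spaces.linear "scal E" "scal E" t by (rule lt)
    show ?case by unfold_locales (simp_all add: a.add b.add a.scale b.scale)
  qed (unfold_locales, simp_all)
  interpret tn: Vector_Spaces.linear "scal E" "scal E" "t ^^ n" by (rule ltn)
  define N R where "N = {x. (t ^^ n) x = 0}" and "R = range (t ^^ n) \<inter> V"
  have V: "subspace V" unfolding V_def by (rule subspace_range[OF Q'(1)])
  have N: "subspace N" unfolding N_def by (rule tn.subspace_kernel)
  have R: "subspace R" unfolding R_def by (intro subspace_inter V tn.subspace_image) simp
  have VQ: "x \<in> V \<longleftrightarrow> Q x = x" for x unfolding V_def by (rule Q'(4))
  have NV: "N \<subseteq> V"
  proof
    fix x assume "x \<in> N"
    then show "x \<in> V" using Qtn[of n x] by (simp add: N_def VQ)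
  qed
  have tB: "t x = B x" if "x \<in> V" for x using that by (simp add: tx VQ)
  have c: "is_complement (scal E) V R N"
  proof (rule is_complementI[OF V N NV])
    show "R \<subseteq> V" by (simp add: R_def)
    show "0 \<in> R" by (rule subspace_0[OF R])
    show "x = 0" if "x \<in> R" "x \<in> N" for x using that nD(3) by (simp add: R_def N_def)
    show "\<exists>w\<in>R. v - w \<in> N" if v: "v \<in> V" for v
    proof -
      obtain y where y: "(t ^^ n) (v - (t ^^ n) y) = 0" using nD(4) by blast
      then have 1: "v - (t ^^ n) y \<in> N" by (simp add: N_def)
      then have "v - (v - (t ^^ n) y) \<in> V" using NV v subspace_diff[OF V] by blast
      then have "(t ^^ n) y \<in> R" by (simp add: R_def)
      then show ?thesis using 1 by blast
    qed
  qed
  have BR: "blinfun_apply B ` R = R"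
  proof
    show "blinfun_apply B ` R \<subseteq> R"
    proof
      fix z assume "z \<in> blinfun_apply B ` R"
      then obtain x where x: "z = t x" "x \<in> range (t ^^ n)" "x \<in> V" using tB by (auto simp: R_def)
      then have "z \<in> range (t ^^ n)" using nD(5) by blast
      moreover have "z \<in> V" using x Qt[of x] by (simp add: VQ)
      ultimately show "z \<in> R" by (simp add: R_def)
    qed
    show "R \<subseteq> blinfun_apply B ` R"
    proof
      fix z assume z: "z \<in> R"
      then have "z \<in> t ` range (t ^^ n)" using nD(5) by (simp add: R_def)
      then obtain x where x: "z = t x" "x \<in> range (t ^^ n)" by blast
      have "x \<in> V" using Qt[of x] z x(1) by (simp add: VQ R_def)
      then show "z \<in> blinfun_apply B ` R" using x tB by (auto simp: R_def)
    qed
  qed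
  have injB: "inj_on (blinfun_apply B) R"
    using nD(6) tB by (auto simp: R_def inj_on_def)
  have "finite_dimensional (scal E) N"
    using finite_dimensional_if_real[OF nD(1,2)] N by (simp add: N_def)
  moreover have "blinfun_apply B ` V \<subseteq> V" using QB by (auto simp: VQ)
  ultimately show "fredholm (scal E) V V (blinfun_apply B)" "fredholm_index (scal E) V V (blinfun_apply B) = 0"
    using fredholm_splitting[OF operator_linear[OF B(1)] V c _ R _ BR injB] by auto
qed

text \<open>Followed by Q, the map A becomes a compact perturbation of the identity of the range of
  Q, of index 0. The product formula then determines the index of A. Several choices of A yield the
  algebraic rules for relative dimensions below.\<close>

lemma index_perturbation:
  assumes Q: "Q \<in> projectors E" and S: "S \<in> projectors E" and QS: "quot Q = quot S"
    and A: "A \<in> operators E" "quot A = quot Q" "\<And>x. S (A (Q x)) = A (Q x)"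
  shows "fredholm (scal E) (range (blinfun_apply Q)) (range (blinfun_apply S)) (blinfun_apply A)" (is ?F)
    and "fredholm_index (scal E) (range (blinfun_apply Q)) (range (blinfun_apply S)) (blinfun_apply A)
      = - relative_dimension E S Q" (is ?I)
proof -
  note Q' = projectorsD[OF Q] and S' = projectorsD[OF S]
  \<comment> \<open>Stated for arbitrary data because it is also applied with Q and S exchanged and
    with Q as the map. The kernel of A lies in that of Q A Q, and its range contains that of S A Q
    S.\<close>
  have F: "fredholm (scal E) (range (blinfun_apply Q)) (range (blinfun_apply S)) (blinfun_apply A)
    \<and> (let B = Q o\<^sub>L A o\<^sub>L Q in fredholm (scal E) (range (blinfun_apply Q)) (range (blinfun_apply Q)) (blinfun_apply B)
      \<and> fredholm_index (scal E) (range (blinfun_apply Q)) (range (blinfun_apply Q)) (blinfun_apply B) = 0)"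
    if Q: "Q \<in> projectors E" and S: "S \<in> projectors E" and QS: "quot Q = quot S"
    and A: "A \<in> operators E" "quot A = quot Q" "\<And>x. S (A (Q x)) = A (Q x)" for Q S A
  proof -
    note Q' = projectorsD[OF Q] and S' = projectorsD[OF S]
    have qq: "quot Q * quot Q = quot Q" by (simp add: quot_simps Q'(2))
    define B C where "B = Q o\<^sub>L A o\<^sub>L Q" and "C = S o\<^sub>L A o\<^sub>L Q o\<^sub>L S"
    have "quot B = quot Q" using qq A(2) by (simp add: B_def flip: quot_simps(7))
    then have cB: "compact_operator (Q - B)" by (metis quot_eq_iff)
    have "quot C = quot S" using qq A(2) QS by (simp add: C_def flip: quot_simps(7))
    then have cC: "compact_operator (S - C)" by (metis quot_eq_iff)
    have B: "B \<in> operators E" "B o\<^sub>L Q = B" "Q o\<^sub>L B = B"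
      using Q' A(1) by (auto simp: B_def intro!: operators_intros blinfun_eqI)
    have C: "C \<in> operators E" "C o\<^sub>L S = C" "S o\<^sub>L C = C"
      using Q' S' A(1) by (auto simp: C_def intro!: operators_intros blinfun_eqI)
    note iB = index_compact_perturbation[OF Q B cB] and iC = index_compact_perturbation[OF S C cC]
    let ?V = "range (blinfun_apply Q)" and ?W = "range (blinfun_apply S)"
    have "fredholm (scal E) ?V ?W (blinfun_apply A)"
    proof (rule fredholm_between[OF operator_linear[OF A(1)] subspace_range[OF Q'(1)] subspace_range[OF S'(1)]])
      show "blinfun_apply A ` ?V \<subseteq> ?W"
      proof (rule image_subsetI)
        fix x assume "x \<in> ?V"
        then have "Q x = x" using Q'(4) by blast
        then have "S (A x) = A x" using A(3)[of x] by simp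
        then show "A x \<in> ?W" using S'(4) by blast
      qed
      show "finite_dimensional (scal E) {x \<in> ?V. B x = 0}" using iB(1) by (simp add: fredholm_def)
      show "{x \<in> ?V. A x = 0} \<subseteq> {x \<in> ?V. B x = 0}" using Q'(3) by (auto simp: B_def)
      show "finite_codimensional (scal E) ?W (blinfun_apply C ` ?W)" using iC(1) by (simp add: fredholm_def)
      show "blinfun_apply C ` ?W \<subseteq> blinfun_apply A ` ?V" using A(3) by (auto simp: C_def)
      have "blinfun_apply C ` ?W = range (blinfun_apply (C o\<^sub>L S))" by auto
      then show "subspace (blinfun_apply C ` ?W)"
        using subspace_range[OF operators_intros(6)[OF C(1) S'(1)]] by simp
    qed
    then show ?thesis using iB by (simp add: B_def Let_def)
  qed
  let ?V = "range (blinfun_apply Q)" and ?W = "range (blinfun_apply S)"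
  let ?B = "Q o\<^sub>L A o\<^sub>L Q"
  show ?F using F[OF Q S QS A] by blast
  moreover have FQ: "fredholm (scal E) ?W ?V (blinfun_apply Q)"
    using F[OF S Q QS[symmetric] Q'(1) QS] Q'(3) by simp
  moreover have B: "fredholm (scal E) ?V ?V (blinfun_apply ?B)" "fredholm_index (scal E) ?V ?V (blinfun_apply ?B) = 0"
    using F[OF Q S QS A] by (simp_all add: Let_def)
  have eq: "Q (A x) = ?B x" if "x \<in> ?V" for x using that Q'(4) by simp
  have AV: "blinfun_apply A ` ?V \<subseteq> ?W"
  proof (rule image_subsetI)
    fix x assume "x \<in> ?V"
    then have "Q x = x" using Q'(4) by blast
    then have "S (A x) = A x" using A(3)[of x] by simp
    then show "A x \<in> ?W" using S'(4) by blast
  qed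
  have "fredholm_index (scal E) ?V ?V (\<lambda>x. Q (A x)) =
      fredholm_index (scal E) ?V ?W (blinfun_apply A) + fredholm_index (scal E) ?W ?V (blinfun_apply Q)"
    using calculation B(1) fredholm_index_cong(1)[of ?V "\<lambda>x. Q (A x)" "blinfun_apply ?B", OF eq]
    by (intro fredholm_index_compose operator_linear A(1) Q'(1) subspace_range S'(1) AV) auto
  then show ?I
    using B(2) fredholm_index_cong(2)[of ?V "\<lambda>x. Q (A x)" "blinfun_apply ?B" "scal E" ?V, OF eq]
    unfolding relative_dimension_def by linarith
qed

lemma relative_dimension_fredholm:
  assumes "Q \<in> projectors E" "R \<in> projectors E" "quot Q = quot R"
  shows "fredholm (scal E) (range (blinfun_apply Q)) (range (blinfun_apply R)) (blinfun_apply R)"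
  using index_perturbation(1)[OF assms] projectorsD[OF assms(2)] assms(3) by simp

lemma relative_dimension_sym:
  assumes "Q \<in> projectors E" "R \<in> projectors E" "quot Q = quot R"
  shows "relative_dimension E Q R = - relative_dimension E R Q"
  using index_perturbation(2)[OF assms projectorsD(1)[OF assms(2)]] projectorsD(3)[OF assms(2)] assms(3)
  by (simp add: relative_dimension_def)

lemma relative_dimension_self: "Q \<in> projectors E \<Longrightarrow> relative_dimension E Q Q = 0"
  using relative_dimension_sym[of Q Q] by simp

text \<open>The composition S R maps the range of Q to that of S and agrees with Q modulo compact
  operators. So \<open>index_perturbation\<close> gives its index, and the product formula splits
  the same index.\<close>

lemma relative_dimension_add:
  assumes Q: "Q \<in> projectors E" and R: "R \<in> projectors E" and S: "S \<in> projectors E"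
    and q: "quot Q = quot R" "quot R = quot S"
  shows "relative_dimension E Q S = relative_dimension E Q R + relative_dimension E R S"
proof -
  note Q' = projectorsD[OF Q] and R' = projectorsD[OF R] and S' = projectorsD[OF S]
  let ?V = "range (blinfun_apply Q)" and ?W = "range (blinfun_apply R)" and ?U = "range (blinfun_apply S)"
  have qS: "quot Q = quot S" using q by simp
  have "quot (S o\<^sub>L R) = quot Q" using q S'(2) by (simp add: flip: quot_simps(7)) (simp add: quot_simps(7))
  note ip = index_perturbation[OF Q S qS operators_intros(6)[OF S'(1) R'(1)] this]
  have eq: "blinfun_apply (S o\<^sub>L R) = (\<lambda>x. S (R x))" by auto
  have F: "fredholm (scal E) ?V ?U (\<lambda>x. S (R x))"
    and I: "fredholm_index (scal E) ?V ?U (\<lambda>x. S (R x)) = - relative_dimension E S Q"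
    using ip S'(3) unfolding eq by auto
  have "fredholm_index (scal E) ?V ?U (\<lambda>x. S (R x)) = relative_dimension E Q R + relative_dimension E R S"
    unfolding relative_dimension_def
    by (rule fredholm_index_compose[OF operator_linear[OF R'(1)] operator_linear[OF S'(1)]
          subspace_range[OF Q'(1)] subspace_range[OF R'(1)] subspace_range[OF S'(1)] _ _
          relative_dimension_fredholm[OF Q R q(1)] relative_dimension_fredholm[OF R S q(2)] F]) auto
  then show ?thesis using I relative_dimension_sym[OF Q S qS] by simp
qed

lemma relative_dimension_conjugate:
  assumes Q: "Q \<in> projectors E" and R: "R \<in> projectors E" and q: "quot Q = quot R"
    and U: "U \<in> operators E" "operator.inverse_of U U'"
  shows "relative_dimension E (U o\<^sub>L Q o\<^sub>L U') (U o\<^sub>L R o\<^sub>L U') = relative_dimension E Q R"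
proof -
  note Q' = projectorsD[OF Q] and R' = projectorsD[OF R]
  have UU': "U (U' x) = x" "U' (U x) = x" for x
    by (rule operator_inverse_apply[OF U(2)])+
  have rng: "range (blinfun_apply (U o\<^sub>L A o\<^sub>L U')) = blinfun_apply U ` range (blinfun_apply A)" for A
  proof
    show "blinfun_apply U ` range (blinfun_apply A) \<subseteq> range (blinfun_apply (U o\<^sub>L A o\<^sub>L U'))"
    proof
      fix y assume "y \<in> blinfun_apply U ` range (blinfun_apply A)"
      then obtain x where "y = (U o\<^sub>L A o\<^sub>L U') (U x)" by (auto simp: UU')
      then show "y \<in> range (blinfun_apply (U o\<^sub>L A o\<^sub>L U'))" by blast
    qed
  qed auto
  have "inj (blinfun_apply U)" using UU'(2) by (metis injI)
  then show ?thesis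
    unfolding relative_dimension_def rng
    by (intro fredholm_index_conjugate operator_linear U(1) R'(1) subspace_range Q'(1)
        relative_dimension_fredholm[OF Q R q]) (auto simp: UU')
qed

text \<open>The intertwiner \<open>R Q + (1 - R) (1 - Q)\<close> of two projectors, written as a perturbation of 1.\<close>

definition intertwiner :: "('a \<Rightarrow>\<^sub>L 'a) \<Rightarrow> ('a \<Rightarrow>\<^sub>L 'a) \<Rightarrow> ('a \<Rightarrow>\<^sub>L 'a)" where
  "intertwiner Q R = id_blinfun - ((2 *\<^sub>R R - id_blinfun) o\<^sub>L (R - Q))"

lemma intertwiner_apply:
  assumes "R \<in> projectors E"
  shows "intertwiner Q R x = x - R x - Q x + 2 *\<^sub>R R (Q x)"
  using projectorsD(3)[OF assms]
  by (simp add: intertwiner_def blinfun.bilinear_simps algebra_simps scaleR_2)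

lemma intertwiner:
  assumes "Q \<in> projectors E" "R \<in> projectors E"
  shows "intertwiner Q R o\<^sub>L Q = R o\<^sub>L intertwiner Q R" "intertwiner Q R \<in> operators E"
    "Q x = x \<Longrightarrow> intertwiner Q R x = R x"
proof -
  show "intertwiner Q R o\<^sub>L Q = R o\<^sub>L intertwiner Q R"
    by (rule blinfun_eqI)
      (simp add: intertwiner_apply[OF assms(2)] projectorsD(3)[OF assms(1)] projectorsD(3)[OF assms(2)]
        blinfun.bilinear_simps scaleR_2)
  show "intertwiner Q R \<in> operators E"
    unfolding intertwiner_def using assms projectorsD(1) by (intro operators_intros) auto
  show "Q x = x \<Longrightarrow> intertwiner Q R x = R x"
    by (simp add: intertwiner_apply[OF assms(2)] scaleR_2)
qed

lemma intertwiner_invertible: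
  assumes "norm ((2 *\<^sub>R R - id_blinfun) o\<^sub>L (R - Q)) < 1"
  shows "operator.invertible (intertwiner Q R)"
  unfolding intertwiner_def operator.invertible_def by (rule operator.neumann[OF assms])

text \<open>On the range of Q the intertwiner coincides with R. Being invertible and carrying Q to
  R, it makes R a bijection between the two ranges.\<close>

lemma relative_dimension_close:
  assumes Q: "Q \<in> projectors E" and R: "R \<in> projectors E"
    and small: "norm ((2 *\<^sub>R R - id_blinfun) o\<^sub>L (R - Q)) < 1"
  shows "relative_dimension E Q R = 0"
proof -
  note Q' = projectorsD[OF Q] and R' = projectorsD[OF R]
  let ?u = "intertwiner Q R"
  note i = intertwiner[OF Q R]
  obtain v where v: "operator.inverse_of ?u v"
    using intertwiner_invertible[OF small] by (auto simp: operator.invertible_def)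
  have uv: "?u (v x) = x" "v (?u x) = x" for x
    by (rule operator_inverse_apply[OF v])+
  have uQ: "?u (Q x) = R (?u x)" for x using arg_cong[OF i(1), of "\<lambda>A. blinfun_apply A x"] by simp
  have Ru: "R (Q x) = ?u (Q x)" for x using i(3)[of "Q x"] Q'(3) by simp
  have "blinfun_apply R ` range (blinfun_apply Q) = range (blinfun_apply R)"
  proof
    show "range (blinfun_apply R) \<subseteq> blinfun_apply R ` range (blinfun_apply Q)"
    proof
      fix y assume "y \<in> range (blinfun_apply R)"
      then obtain x where "y = R x" by blast
      then have "y = R (Q (v x))" using Ru uQ uv by simp
      then show "y \<in> blinfun_apply R ` range (blinfun_apply Q)" by blast
    qed
  qed auto
  moreover have "inj_on (blinfun_apply R) (range (blinfun_apply Q))"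
  proof (rule inj_onI)
    fix x y assume "x \<in> range (blinfun_apply Q)" "y \<in> range (blinfun_apply Q)" "R x = R y"
    then have "?u x = ?u y" using i(3) Q'(4) by simp
    then show "x = y" using uv(2) by metis
  qed
  ultimately show ?thesis
    unfolding relative_dimension_def
    by (intro fredholm_bij(2) operator_linear R'(1) subspace_range Q'(1))
qed

lemma conjugate_projector:
  assumes "Q \<in> projectors E" "U \<in> operators E" "operator.inverse_of U U'"
  shows "U o\<^sub>L Q o\<^sub>L U' \<in> projectors E"
proof -
  have "U' (U x) = x" for x
    by (rule operator_inverse_apply[OF assms(3)])
  then have "(U o\<^sub>L Q o\<^sub>L U') o\<^sub>L (U o\<^sub>L Q o\<^sub>L U') = U o\<^sub>L Q o\<^sub>L U'"
    using projectorsD(3)[OF assms(1)] by (intro blinfun_eqI) simp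
  then show ?thesis
    using assms operators_inverse[OF assms(2,3)] projectorsD(1)[OF assms(1)]
    by (auto simp: projectors_def intro: operators_intros)
qed

text \<open>Near t0 the intertwiner of \<open>\<alpha> t0\<close> and \<open>\<alpha> t\<close> is
  an invertible operator close to 1. Conjugation by it moves \<open>\<alpha> t0\<close> exactly to
  \<open>\<alpha> t\<close> and \<open>\<beta> t0\<close> to a projector close to
  \<open>\<beta> t\<close>, so the relative dimension is locally constant.\<close>

lemma relative_dimension_constant:
  assumes \<alpha>: "continuous_on {0..1} \<alpha>" "\<And>t. t \<in> {0..1} \<Longrightarrow> \<alpha> t \<in> projectors E"
    and \<beta>: "continuous_on {0..1} \<beta>" "\<And>t. t \<in> {0..1} \<Longrightarrow> \<beta> t \<in> projectors E"
    and q: "\<And>t. t \<in> {0..1} \<Longrightarrow> quot (\<alpha> t) = quot (\<beta> t)"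
  shows "relative_dimension E (\<alpha> 0) (\<beta> 0) = relative_dimension E (\<alpha> 1) (\<beta> (1::real))"
proof -
  define f where "f t = relative_dimension E (\<alpha> t) (\<beta> t)" for t
  have "\<forall>\<^sub>F t in at t0 within {0..1}. f t = f t0" if t0: "t0 \<in> {0..1}" for t0
  proof -
    let ?F = "at t0 within {0..1}"
    have a: "(\<alpha> \<longlongrightarrow> \<alpha> t0) ?F" and b: "(\<beta> \<longlongrightarrow> \<beta> t0) ?F"
      using \<alpha>(1) \<beta>(1) t0 by (auto simp: continuous_on_def)
    note comp = operator.tendsto
    define u where "u t = intertwiner (\<alpha> t0) (\<alpha> t)" for t
    have small: "((\<lambda>t. norm ((2 *\<^sub>R \<alpha> t - id_blinfun) o\<^sub>L (\<alpha> t - \<alpha> t0))) \<longlongrightarrow> 0) ?F"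
      by (rule tendsto_eq_intros comp a refl | simp)+
    then have ev1: "\<forall>\<^sub>F t in ?F. norm ((2 *\<^sub>R \<alpha> t - id_blinfun) o\<^sub>L (\<alpha> t - \<alpha> t0)) < 1"
      by (rule order_tendstoD) simp
    have u: "(u \<longlongrightarrow> id_blinfun) ?F"
      unfolding u_def intertwiner_def by (rule tendsto_eq_intros comp a refl | simp)+
    have "operator.invertible (id_blinfun :: 'a \<Rightarrow>\<^sub>L 'a)"
      by (rule operator.invertibleI[of _ id_blinfun]) (simp add: operator.inverse_of_def)
    then have "isCont operator.inver (id_blinfun :: 'a \<Rightarrow>\<^sub>L 'a)"
      using operator.continuous_on_inver[where 'a='a]
      by (simp add: continuous_on_eq_continuous_at operator.open_invertible)
    moreover have "operator.inver id_blinfun = (id_blinfun :: 'a \<Rightarrow>\<^sub>L 'a)"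
      by (rule operator.inver_eq) (simp add: operator.inverse_of_def)
    ultimately have iu: "((\<lambda>t. operator.inver (u t)) \<longlongrightarrow> id_blinfun) ?F"
      using isCont_tendsto_compose[OF _ u, of operator.inver] by simp
    \<comment> \<open>The image of \<open>\<beta> t0\<close> under the same conjugation. It tends to
      \<open>\<beta> t0\<close>, as \<open>\<beta> t\<close> does, so the two are eventually close
      enough to have relative dimension 0.\<close>
    define \<gamma> where "\<gamma> t = u t o\<^sub>L \<beta> t0 o\<^sub>L operator.inver (u t)" for t
    have "((\<lambda>t. norm ((2 *\<^sub>R \<beta> t - id_blinfun) o\<^sub>L (\<beta> t - \<gamma> t))) \<longlongrightarrow> 0) ?F"
      unfolding \<gamma>_def by (rule tendsto_eq_intros comp a b u iu refl | simp)+
    then have ev2: "\<forall>\<^sub>F t in ?F. norm ((2 *\<^sub>R \<beta> t - id_blinfun) o\<^sub>L (\<beta> t - \<gamma> t)) < 1"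
      by (rule order_tendstoD) simp
    have ev3: "\<forall>\<^sub>F t in ?F. t \<in> {0..1}" by (simp add: eventually_at_filter)
    show ?thesis
      using ev1 ev2 ev3
    proof eventually_elim
      case (elim t)
      note P = \<alpha>(2)[OF elim(3)] \<beta>(2)[OF elim(3)] \<alpha>(2)[OF t0] \<beta>(2)[OF t0]
      have inv: "operator.inverse_of (u t) (operator.inver (u t))"
        unfolding u_def by (intro operator.inverse_of_inver intertwiner_invertible elim(1))
      have uop: "u t \<in> operators E" unfolding u_def by (rule intertwiner(2)[OF P(3,1)])
      have "u t o\<^sub>L \<alpha> t0 o\<^sub>L operator.inver (u t) = \<alpha> t o\<^sub>L (u t o\<^sub>L operator.inver (u t))"
        using intertwiner(1)[OF P(3,1)] by (simp add: u_def operator.assoc)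
      then have at: "u t o\<^sub>L \<alpha> t0 o\<^sub>L operator.inver (u t) = \<alpha> t"
        using inv by (simp add: operator.inverse_of_def)
      have g: "\<gamma> t \<in> projectors E" unfolding \<gamma>_def by (rule conjugate_projector[OF P(4) uop inv])
      have qg: "quot (\<alpha> t) = quot (\<gamma> t)"
        unfolding \<gamma>_def at[symmetric] using q[OF t0] by (simp flip: quot_simps(7))
      have "relative_dimension E (\<alpha> t) (\<gamma> t) = f t0"
        unfolding \<gamma>_def f_def at[symmetric]
        by (rule relative_dimension_conjugate[OF P(3,4) q[OF t0] uop inv])
      moreover have "relative_dimension E (\<gamma> t) (\<beta> t) = 0"
        by (rule relative_dimension_close[OF g P(2) elim(2)])
      moreover have "f t = relative_dimension E (\<alpha> t) (\<gamma> t) + relative_dimension E (\<gamma> t) (\<beta> t)"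
        unfolding f_def using relative_dimension_add[OF P(1) g P(2) qg] qg q[OF elim(3)] by simp
      ultimately show "f t = f t0" by simp
    qed
  qed
  then have "continuous_on {0..1} (\<lambda>t. real_of_int (f t))"
    unfolding continuous_on_def
    by (intro ballI tendsto_eventually) (auto elim: eventually_mono)
  moreover have "connected {0..1::real}" by simp
  ultimately have "(\<lambda>t. real_of_int (f t)) constant_on {0..1}"
    by (intro continuous_discrete_range_constant) (auto intro!: exI[of _ 1])
  then obtain y where "\<And>t. t \<in> {0..1} \<Longrightarrow> real_of_int (f t) = y" unfolding constant_on_def by blast
  from this[of 0] this[of 1] show ?thesis by (simp add: f_def)
qed

end

section \<open>Lifting paths of idempotents of the Calkin algebra\<close>

text \<open>The retraction of the line to the unit interval; it turns a path on {0..1} into a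
  bounded continuous function on the whole line.\<close>

definition clamp01 :: "real \<Rightarrow> real" where
  "clamp01 t = max 0 (min 1 t)"

lemma clamp01_simps [simp]:
  "0 \<le> clamp01 t" "clamp01 t \<le> 1" "clamp01 (clamp01 t) = clamp01 t" "0 \<le> t \<Longrightarrow> t \<le> 1 \<Longrightarrow> clamp01 t = t"
  by (simp_all add: clamp01_def)

lemma continuous_on_clamp01 [continuous_intros]: "continuous_on S clamp01"
  unfolding clamp01_def by (intro continuous_intros)

text \<open>Approximate lifts are glued from lifts of finitely many values by a partition of unity.\<close>

lemma approximate_path_lift:
  fixes f :: "real \<Rightarrow> 'a::banach calkin"
  assumes f: "continuous_on {0..1} f" "\<And>t. t \<in> {0..1} \<Longrightarrow> norm (f t) < d" and e: "0 < e"
  obtains g where "continuous_on {0..1} g" "\<And>t. t \<in> {0..1} \<Longrightarrow> norm (g t) \<le> d"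
    "\<And>t. t \<in> {0..1} \<Longrightarrow> norm (f t - quot (g t)) \<le> e"
proof -
  have "uniformly_continuous_on {0..1} f" using f(1) by (intro compact_uniformly_continuous) auto
  then obtain \<delta> where \<delta>: "0 < \<delta>" "\<And>s t. s \<in> {0..1} \<Longrightarrow> t \<in> {0..1} \<Longrightarrow> dist s t < \<delta> \<Longrightarrow> dist (f s) (f t) < e"
    using e unfolding uniformly_continuous_on_def by metis
  have "\<exists>T. finite T \<and> T \<subseteq> {0..1} \<and> {0..1::real} \<subseteq> (\<Union>k\<in>T. ball k \<delta>)"
  proof (rule compactE_image[OF compact_Icc, of "{0..1}" "\<lambda>k. ball k \<delta>"])
    show "{0..1} \<subseteq> (\<Union>k\<in>{0..1::real}. ball k \<delta>)" using \<delta>(1) by force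
  qed auto
  then obtain T :: "real set" where T: "finite T" "T \<subseteq> {0..1}" "{0..1} \<subseteq> (\<Union>k\<in>T. ball k \<delta>)"
    by blast
  have "\<exists>x. quot x = f k \<and> norm x < d" if k: "k \<in> {0..1}" for k
  proof -
    obtain A where "f k = quot A" "norm A < d" by (rule calkin_norm_approx[OF f(2)[OF k]])
    then show ?thesis by (intro exI[of _ A]) simp
  qed
  then obtain x where x: "\<And>k. k \<in> {0..1} \<Longrightarrow> quot (x k) = f k" "\<And>k. k \<in> {0..1} \<Longrightarrow> norm (x k) < d"
    by metis
  \<comment> \<open>Hat functions around the sample points: where the weight of k is nonzero, t is
    within \<open>\<delta>\<close> of k, and so f t is within e of f k.\<close>
  define w where "w k t = max 0 (\<delta> - dist t k)" for k t :: real
  define W where "W t = (\<Sum>k\<in>T. w k t)" for t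
  have w0: "0 \<le> w k t" for k t by (simp add: w_def)
  have W: "0 < W t" if t: "t \<in> {0..1}" for t
  proof -
    obtain k where "k \<in> T" "dist k t < \<delta>" using t T(3) by auto
    then show ?thesis unfolding W_def
      using T(1) w0 by (intro sum_pos2[of T k]) (auto simp: w_def dist_commute)
  qed
  have w_sum: "(\<Sum>k\<in>T. w k t / W t) = 1" if "t \<in> {0..1}" for t
    using W[OF that] by (simp add: W_def flip: sum_divide_distrib)
  define g where "g t = (\<Sum>k\<in>T. (w k t / W t) *\<^sub>R x k)" for t
  show thesis
  proof
    have cw: "continuous_on {0..1} (w k)" for k unfolding w_def by (intro continuous_intros)
    have cW: "continuous_on {0..1} W" unfolding W_def by (intro continuous_intros cw)
    show "continuous_on {0..1} g"
      unfolding g_def by (intro continuous_intros cw cW) (use W in force)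
    fix t :: real assume t: "t \<in> {0..1}"
    have wW: "0 \<le> w k t / W t" for k using w0 W[OF t] by simp
    have "norm (g t) \<le> (\<Sum>k\<in>T. (w k t / W t) * d)"
      unfolding g_def
    proof (rule sum_norm_le)
      fix k assume "k \<in> T"
      then have "norm (x k) \<le> d" using x(2) T(2) by (meson less_imp_le subsetD)
      then show "norm ((w k t / W t) *\<^sub>R x k) \<le> (w k t / W t) * d"
        using wW[of k] by (simp only: norm_scaleR abs_of_nonneg mult_left_mono)
    qed
    also have "\<dots> = d" by (simp only: w_sum[OF t] mult_1 flip: sum_distrib_right)
    finally show "norm (g t) \<le> d" .
    interpret q: bounded_linear "quot :: ('a \<Rightarrow>\<^sub>L 'a) \<Rightarrow> _" by (rule bounded_linear_quot)
    have "f t = (\<Sum>k\<in>T. (w k t / W t) *\<^sub>R f t)"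
      using w_sum[OF t] by (simp flip: scaleR_sum_left)
    moreover have "quot (g t) = (\<Sum>k\<in>T. (w k t / W t) *\<^sub>R f k)"
      unfolding g_def q.sum using x(1) T(2) by (intro sum.cong refl) (auto simp: q.scaleR)
    ultimately have "f t - quot (g t) = (\<Sum>k\<in>T. (w k t / W t) *\<^sub>R (f t - f k))"
      by (simp add: sum_subtractf scaleR_diff_right)
    also have "norm \<dots> \<le> (\<Sum>k\<in>T. (w k t / W t) * e)"
    proof (rule sum_norm_le)
      fix k assume k: "k \<in> T"
      show "norm ((w k t / W t) *\<^sub>R (f t - f k)) \<le> (w k t / W t) * e"
      proof (cases "dist t k < \<delta>")
        case True
        then have "norm (f t - f k) \<le> e" using \<delta>(2)[of t k] t k T(2) by (auto simp: dist_norm)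
        then show ?thesis using wW[of k] by (simp only: norm_scaleR abs_of_nonneg mult_left_mono)
      next
        case False
        then have "w k t = 0" by (simp add: w_def)
        then show ?thesis by simp
      qed
    qed
    also have "\<dots> = e" by (simp only: w_sum[OF t] mult_1 flip: sum_distrib_right)
    finally show "norm (f t - quot (g t)) \<le> e" .
  qed
qed

instance bcontfun :: (metric_space, banach) banach ..

text \<open>Composition with \<open>quot\<close> is a bounded linear map F between Banach spaces of
  bounded continuous functions. An approximate lift of norm at most 2 norm y leaves at most half of
  norm y as error, and the iteration makes it exact at the price of another factor 2, whence
  4.\<close>

lemma path_lift:
  fixes f :: "real \<Rightarrow> 'a::banach calkin"
  assumes f: "continuous_on {0..1} f" "\<And>t. t \<in> {0..1} \<Longrightarrow> norm (f t) \<le> d"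
  obtains g where "continuous_on {0..1} g" "\<And>t. t \<in> {0..1} \<Longrightarrow> norm (g t) \<le> 4 * d"
    "\<And>t. t \<in> {0..1} \<Longrightarrow> quot (g t) = f t"
proof -
  have cq: "continuous_on S (\<lambda>t. quot (g t))" if "continuous_on S g" for S and g :: "real \<Rightarrow> 'a \<Rightarrow>\<^sub>L 'a"
    using bounded_linear.continuous_on[OF bounded_linear_quot that] .
  define F :: "(real \<Rightarrow>\<^sub>C ('a \<Rightarrow>\<^sub>L 'a)) \<Rightarrow> (real \<Rightarrow>\<^sub>C 'a calkin)" where
    "F g = Bcontfun (\<lambda>t. quot (apply_bcontfun g t))" for g
  have F: "apply_bcontfun (F g) t = quot (apply_bcontfun g t)" for g t
  proof -
    have "(\<lambda>t. quot (apply_bcontfun g t)) \<in> bcontfun"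
      by (rule bcontfun_normI[of _ "norm g"])
        (auto intro!: cq order_trans[OF calkin_norm_le norm_bounded])
    then show ?thesis by (simp add: F_def Bcontfun_inverse)
  qed
  have lF: "bounded_linear F"
  proof (rule bounded_linear_intro[of _ 1])
    show "norm (F g) \<le> norm g * 1" for g
      by (rule norm_bound) (auto simp: F intro: order_trans[OF calkin_norm_le norm_bounded])
  qed (auto intro!: bcontfun_eqI simp: F quot_simps)
  \<comment> \<open>The functions determined by their values on {0..1}. Approximate lifts are
    available over this interval, so the iteration has to stay among these functions.\<close>
  define V where "V = {y :: real \<Rightarrow>\<^sub>C 'a calkin. \<forall>t. apply_bcontfun y t = apply_bcontfun y (clamp01 t)}"
  have approx: "\<exists>x. norm x \<le> 2 * norm y \<and> y - F x \<in> V \<and> norm (y - F x) \<le> norm y / 2" if y: "y \<in> V" for y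
  proof (cases "y = 0")
    case True
    have "F 0 = 0" by (rule bcontfun_eqI) (simp add: F quot_simps)
    then show ?thesis using True y by (intro exI[of _ 0]) simp
  next
    case False
    then have ny: "0 < norm y" by simp
    have "norm (apply_bcontfun y t) < 2 * norm y" for t
      using norm_bounded[of y t] ny by linarith
    then obtain g where g: "continuous_on {0..1} g" "\<And>t. t \<in> {0..1} \<Longrightarrow> norm (g t) \<le> 2 * norm y"
      "\<And>t. t \<in> {0..1} \<Longrightarrow> norm (apply_bcontfun y t - quot (g t)) \<le> norm y / 2"
      using approximate_path_lift[of "apply_bcontfun y" "2 * norm y" "norm y / 2"] ny
      by (metis continuous_on_apply_bcontfun half_gt_zero)
    have "(\<lambda>t. g (clamp01 t)) \<in> bcontfun"
      using g(2) by (intro bcontfun_normI[of _ "2 * norm y"] continuous_on_compose2[OF g(1)] continuous_intros) auto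
    then have x: "apply_bcontfun (Bcontfun (\<lambda>t. g (clamp01 t))) t = g (clamp01 t)" for t
      by (simp add: Bcontfun_inverse)
    let ?x = "Bcontfun (\<lambda>t. g (clamp01 t))"
    have "norm ?x \<le> 2 * norm y" by (rule norm_bound) (simp add: x g(2))
    moreover have yc: "apply_bcontfun y t = apply_bcontfun y (clamp01 t)" for t using y by (simp add: V_def)
    then have "y - F ?x \<in> V" unfolding V_def by (simp add: F x)
    moreover have "norm (y - F ?x) \<le> norm y / 2"
    proof (rule norm_bound)
      fix t
      show "norm (apply_bcontfun (y - F ?x) t) \<le> norm y / 2"
        using g(3)[of "clamp01 t"] yc[of t] by (simp add: F x)
    qed
    ultimately show ?thesis by blast
  qed
  have fb: "(\<lambda>t. f (clamp01 t)) \<in> bcontfun"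
    using f(2) by (intro bcontfun_normI[of _ d] continuous_on_compose2[OF f(1)] continuous_intros) auto
  define y where "y = Bcontfun (\<lambda>t. f (clamp01 t))"
  have y: "apply_bcontfun y t = f (clamp01 t)" for t unfolding y_def using fb by (simp add: Bcontfun_inverse)
  have "y \<in> V" by (simp add: V_def y)
  have "\<exists>x. F x = y \<and> norm x \<le> 2 * 2 * norm y"
    by (rule preimage_from_approximation[where V = V, OF lF _ approx \<open>y \<in> V\<close>]) simp_all
  then obtain x where x: "F x = y" "norm x \<le> 2 * 2 * norm y" by blast
  have "norm y \<le> d" by (rule norm_bound) (simp add: y f(2))
  then have nx: "norm (apply_bcontfun x t) \<le> 4 * d" for t
    using x(2) norm_bounded[of x t] by linarith
  show thesis
  proof
    show "quot (apply_bcontfun x t) = f t" if "t \<in> {0..1}" for t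
      using F[of x t] x(1) y[of t] that by simp
  qed (use nx in auto)
qed

text \<open>Where f vanishes at an end, the lift there has class 0. Subtracting the segment between
  these end values, with 0 in place of the others, leaves the classes unchanged and adds at most 8 d
  to the bound 4 d.\<close>

lemma path_lift_endpoints:
  fixes f :: "real \<Rightarrow> 'a::banach calkin"
  assumes f: "continuous_on {0..1} f" "\<And>t. t \<in> {0..1} \<Longrightarrow> norm (f t) \<le> d"
  obtains g where "continuous_on {0..1} g" "\<And>t. t \<in> {0..1} \<Longrightarrow> norm (g t) \<le> 12 * d"
    "\<And>t. t \<in> {0..1} \<Longrightarrow> quot (g t) = f t" "f 0 = 0 \<Longrightarrow> g 0 = 0" "f 1 = 0 \<Longrightarrow> g 1 = 0"
proof -
  obtain g where g: "continuous_on {0..1} g" "\<And>t. t \<in> {0..1} \<Longrightarrow> norm (g t) \<le> 4 * d"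
    "\<And>t. t \<in> {0..1} \<Longrightarrow> quot (g t) = f t"
    by (rule path_lift[OF f]) (assumption | blast)+
  define a where "a = (if f 0 = 0 then g 0 else 0)"
  define b where "b = (if f 1 = 0 then g 1 else 0)"
  have d: "0 \<le> d" using order_trans[OF norm_ge_zero f(2)[of 0]] by simp
  have q: "quot a = 0" "quot b = 0" using g(3)[of 0] g(3)[of 1] by (auto simp: a_def b_def quot_simps)
  have n: "norm a \<le> 4 * d" "norm b \<le> 4 * d" using g(2)[of 0] g(2)[of 1] d by (auto simp: a_def b_def)
  show thesis
  proof
    let ?g = "\<lambda>t. g t - ((1 - t) *\<^sub>R a + t *\<^sub>R b)"
    show "continuous_on {0..1} ?g" by (intro continuous_intros g(1))
    fix t :: real assume t: "t \<in> {0..1}"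
    have "norm ((1 - t) *\<^sub>R a + t *\<^sub>R b) \<le> (1 - t) * norm a + t * norm b"
      using t norm_triangle_ineq[of "(1 - t) *\<^sub>R a" "t *\<^sub>R b"] by simp
    also have "\<dots> \<le> 1 * (4 * d) + 1 * (4 * d)" using t n d by (intro add_mono mult_mono) auto
    finally show "norm (?g t) \<le> 12 * d"
      using norm_triangle_ineq4[of "g t" "(1 - t) *\<^sub>R a + t *\<^sub>R b"] g(2)[OF t] by linarith
    show "quot (?g t) = f t"
      using g(3)[OF t] q by (simp flip: quot_simps(3) quot_simps(5) quot_simps(6))
  next
    show "f 0 = 0 \<Longrightarrow> g 0 - ((1 - 0) *\<^sub>R a + 0 *\<^sub>R b) = 0" by (simp add: a_def)
    show "f 1 = 0 \<Longrightarrow> g 1 - ((1 - 1) *\<^sub>R a + 1 *\<^sub>R b) = 0" by (simp add: b_def)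
  qed
qed

text \<open>\<open>av\<close> is the identity for real E, and the average of A and \<open>- J A J\<close> for complex E, where J is
  multiplication by the imaginary unit.\<close>

locale averaged_space = scalar_space E for E :: "('k::field, 'a::banach, 'c) kspace" +
  fixes av :: "('a \<Rightarrow>\<^sub>L 'a) \<Rightarrow> ('a \<Rightarrow>\<^sub>L 'a)"
  assumes av_linear: "bounded_linear av"
    and av_operators: "av A \<in> operators E"
    and av_id: "A \<in> operators E \<Longrightarrow> av A = A"
    and av_compact: "compact_operator A \<Longrightarrow> compact_operator (av A)"
begin

text \<open>A differs by a compact operator from some B in \<open>operators E\<close>. The map
  \<open>av\<close> keeps that difference compact and fixes B.\<close>

lemma quot_av:
  assumes "quot A \<in> calkin_algebra E"
  shows "quot (av A) = quot A"
proof -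
  interpret av: bounded_linear av by (rule av_linear)
  obtain B where B: "quot A = quot B" "B \<in> operators E" using assms by (auto simp: calkin_algebra_def)
  then have "compact_operator (av (A - B))" by (intro av_compact) (simp add: quot_eq_iff)
  then have "quot (av A) = quot (av B)" by (simp add: quot_eq_iff av.diff)
  then show ?thesis using B av_id by simp
qed

lemma calkin_projectorsD: "e \<in> calkin_projectors E \<Longrightarrow> e \<in> calkin_algebra E" "e \<in> calkin_projectors E \<Longrightarrow> e * e = e"
  by (auto simp: calkin_projectors_def)

lemma calkin_algebra_intros:
  "x \<in> calkin_algebra E \<Longrightarrow> y \<in> calkin_algebra E \<Longrightarrow> x + y \<in> calkin_algebra E"
  "x \<in> calkin_algebra E \<Longrightarrow> y \<in> calkin_algebra E \<Longrightarrow> x - y \<in> calkin_algebra E"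
  "x \<in> calkin_algebra E \<Longrightarrow> y \<in> calkin_algebra E \<Longrightarrow> x * y \<in> calkin_algebra E"
  "x \<in> calkin_algebra E \<Longrightarrow> r *\<^sub>R x \<in> calkin_algebra E"
  "1 \<in> calkin_algebra E"
  unfolding calkin_algebra_def by (auto simp: quot_simps(3,5,6,7) intro!: imageI operators_intros)
    (metis quot_simps(2) image_eqI operators_intros(2))

lemma quot_projector: "Q \<in> projectors E \<Longrightarrow> quot Q \<in> calkin_projectors E"
  using projectorsD[of Q] by (auto simp: calkin_projectors_def calkin_algebra_def quot_simps)

section \<open>Lifts along paths and homotopies, and their index\<close>

lemma is_liftD:
  assumes "is_lift E a \<alpha>"
  shows "continuous_on {0..1} \<alpha>" "\<And>t. t \<in> {0..1} \<Longrightarrow> \<alpha> t \<in> projectors E" "\<And>t. t \<in> {0..1} \<Longrightarrow> quot (\<alpha> t) = a t"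
  using assms by (auto simp: is_lift_def path_def path_image_def)

lemma is_liftI:
  assumes "continuous_on {0..1} \<alpha>" "\<And>t. t \<in> {0..1} \<Longrightarrow> \<alpha> t \<in> projectors E" "\<And>t. t \<in> {0..1} \<Longrightarrow> quot (\<alpha> t) = a t"
  shows "is_lift E a \<alpha>"
  using assms by (auto simp: is_lift_def path_def path_image_def)

text \<open>One d serves all paths, because a homotopy is lifted by repeating this step a number of
  times that is fixed in advance.\<close>

lemma lift_close_exists:
  "\<exists>d>0. \<forall>a b \<alpha>. is_lift E a \<alpha> \<longrightarrow> continuous_on {0..1} b \<longrightarrow> (\<forall>t\<in>{0..1}. b t \<in> calkin_projectors E) \<longrightarrow>
     (\<forall>t\<in>{0..1}. norm ((2 *\<^sub>R b t - 1) * (b t - a t)) \<le> d) \<longrightarrow>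
     (\<exists>\<beta>. is_lift E b \<beta> \<and> (b 0 = a 0 \<longrightarrow> \<beta> 0 = \<alpha> 0) \<and> (b 1 = a 1 \<longrightarrow> \<beta> 1 = \<alpha> 1))"
proof -
  interpret av: bounded_linear av by (rule av_linear)
  obtain K where K: "0 < K" "\<And>x. norm (av x) \<le> norm x * K" using av.pos_bounded by blast
  \<comment> \<open>Lifting may enlarge the norm 12 times and \<open>av\<close> at most K times, so
    \<open>av (g t)\<close> has norm at most 1/2 and the Neumann argument applies.\<close>
  define d where "d = 1 / (24 * K)"
  have d: "0 < d" "12 * d * K < 1" using K by (auto simp: d_def)
  have "\<exists>\<beta>. is_lift E b \<beta> \<and> (b 0 = a 0 \<longrightarrow> \<beta> 0 = \<alpha> 0) \<and> (b 1 = a 1 \<longrightarrow> \<beta> 1 = \<alpha> 1)"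
    if \<alpha>: "is_lift E a \<alpha>" and b: "continuous_on {0..1} b" "\<forall>t\<in>{0..1}. b t \<in> calkin_projectors E"
      and small: "\<forall>t\<in>{0..1}. norm ((2 *\<^sub>R b t - 1) * (b t - a t)) \<le> d" for a b \<alpha>
  proof -
    note \<alpha>' = is_liftD[OF \<alpha>]
    have ap: "a t \<in> calkin_projectors E" if "t \<in> {0..1}" for t
      using quot_projector[OF \<alpha>'(2)[OF that]] \<alpha>'(3)[OF that] by simp
    have "continuous_on {0..1} (\<lambda>t. quot (\<alpha> t))"
      by (rule bounded_linear.continuous_on[OF bounded_linear_quot \<alpha>'(1)])
    then have ca: "continuous_on {0..1} a" by (rule continuous_on_eq) (rule \<alpha>'(3))
    \<comment> \<open>\<open>1 + f t\<close> is the intertwiner of a t and b t. Only the small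
      summand is lifted, so that the lift of the whole stays near 1.\<close>
    define f where "f t = - ((2 *\<^sub>R b t - 1) * (b t - a t))" for t
    have "continuous_on {0..1} f" unfolding f_def by (intro continuous_intros ca b(1))
    moreover have "norm (f t) \<le> d" if "t \<in> {0..1}" for t using small that by (simp add: f_def)
    ultimately obtain g where g: "continuous_on {0..1} g" "\<And>t. t \<in> {0..1} \<Longrightarrow> norm (g t) \<le> 12 * d"
      "\<And>t. t \<in> {0..1} \<Longrightarrow> quot (g t) = f t" "f 0 = 0 \<Longrightarrow> g 0 = 0" "f 1 = 0 \<Longrightarrow> g 1 = 0"
      using path_lift_endpoints[of f d] by metis
    define U where "U t = id_blinfun - (- av (g t))" for t
    have Uop: "U t \<in> operators E" for t
      using operators_intros(5)[OF av_operators, of "-1"] unfolding U_def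
      by (intro operators_intros(2,4)) simp
    have inv: "operator.inverse_of (U t) (operator.inver (U t))" if "t \<in> {0..1}" for t
    proof -
      have "norm (av (g t)) \<le> 12 * d * K"
        using K(2)[of "g t"] g(2)[OF that] K(1) by (meson mult_right_mono less_imp_le order_trans)
      then have "norm (- av (g t)) < 1" using d(2) by simp
      then show ?thesis unfolding U_def
        by (intro operator.inverse_of_inver) (simp only: operator.invertible_def operator.neumann)
    qed
    have cU: "continuous_on {0..1} U"
      unfolding U_def by (intro continuous_intros av.continuous_on g(1))
    have ciU: "continuous_on {0..1} (\<lambda>t. operator.inver (U t))"
      by (rule continuous_on_compose2[OF operator.continuous_on_inver cU]) (use inv operator.invertibleI in blast)
    define \<beta> where "\<beta> t = U t o\<^sub>L \<alpha> t o\<^sub>L operator.inver (U t)" for t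
    have qU: "quot (U t) = 1 + f t" if t: "t \<in> {0..1}" for t
    proof -
      have "f t \<in> calkin_algebra E"
      proof -
        have "a t \<in> calkin_algebra E" "b t \<in> calkin_algebra E"
          using ap[OF t] b(2) t calkin_projectorsD(1) by auto
        then have "(2 *\<^sub>R b t - 1) * (b t - a t) \<in> calkin_algebra E"
          by (intro calkin_algebra_intros)
        from calkin_algebra_intros(4)[OF this, of "-1"] show ?thesis by (simp add: f_def)
      qed
      then have "quot (av (g t)) = f t" using quot_av[of "g t"] g(3)[OF t] by simp
      then show ?thesis by (simp add: U_def quot_simps(2,3)[symmetric])
    qed
    have lift: "is_lift E b \<beta>"
    proof (rule is_liftI)
      show "continuous_on {0..1} \<beta>"
        unfolding \<beta>_def by (intro operator.continuous_on cU ciU \<alpha>'(1))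
      fix t :: real assume t: "t \<in> {0..1}"
      show "\<beta> t \<in> projectors E"
        unfolding \<beta>_def by (rule conjugate_projector[OF \<alpha>'(2)[OF t] Uop inv[OF t]])
      have bb: "b t * b t = b t" and aa: "a t * a t = a t"
        using b(2) ap t calkin_projectorsD(2) by auto
      have bb': "b t * (b t * x) = b t * x" for x using bb by (metis mult.assoc)
      have "(1 + f t) * a t = b t * (1 + f t)"
        by (simp add: f_def algebra_simps aa bb bb' scaleR_2)
      then have "quot (\<beta> t) = b t * (quot (U t) * quot (operator.inver (U t)))"
        unfolding \<beta>_def using \<alpha>'(3)[OF t] qU[OF t] by (simp add: mult.assoc flip: quot_simps(7))
      also have "quot (U t) * quot (operator.inver (U t)) = 1"
        using inv[OF t] by (simp add: quot_simps(2,7) operator.inverse_of_def)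
      finally show "quot (\<beta> t) = b t" by simp
    qed
    \<comment> \<open>At an end where a and b agree, f is 0 and g was chosen to be 0 as well; there
      U is the identity and the end point of the lift is kept.\<close>
    have unmoved: "\<beta> t = \<alpha> t" if "g t = 0" for t
    proof -
      have "U t = id_blinfun" using that by (simp add: U_def av.zero)
      moreover have "operator.inver id_blinfun = (id_blinfun :: 'a \<Rightarrow>\<^sub>L 'a)"
        by (rule operator.inver_eq) (simp add: operator.inverse_of_def)
      ultimately show ?thesis by (simp add: \<beta>_def)
    qed
    have "b 0 = a 0 \<Longrightarrow> \<beta> 0 = \<alpha> 0" "b 1 = a 1 \<Longrightarrow> \<beta> 1 = \<alpha> 1"
      using unmoved g(4,5) by (auto simp: f_def)
    with lift show ?thesis by blast
  qed
  then show ?thesis using d(1) by blast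
qed

lemma lift_close:
  "\<exists>d>0. \<forall>a b \<alpha>. is_lift E a \<alpha> \<longrightarrow> continuous_on {0..1} b \<longrightarrow>
     (\<forall>t\<in>{0..1}. b t \<in> calkin_projectors E \<and> norm (b t) \<le> M \<and> norm (b t - a t) \<le> d) \<longrightarrow>
     (\<exists>\<beta>. is_lift E b \<beta> \<and> (b 0 = a 0 \<longrightarrow> \<beta> 0 = \<alpha> 0) \<and> (b 1 = a 1 \<longrightarrow> \<beta> 1 = \<alpha> 1))"
proof -
  obtain d where d: "0 < d" and *: "\<forall>a b \<alpha>. is_lift E a \<alpha> \<longrightarrow> continuous_on {0..1} b \<longrightarrow>
     (\<forall>t\<in>{0..1}. b t \<in> calkin_projectors E) \<longrightarrow>
     (\<forall>t\<in>{0..1}. norm ((2 *\<^sub>R b t - 1) * (b t - a t)) \<le> d) \<longrightarrow>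
     (\<exists>\<beta>. is_lift E b \<beta> \<and> (b 0 = a 0 \<longrightarrow> \<beta> 0 = \<alpha> 0) \<and> (b 1 = a 1 \<longrightarrow> \<beta> 1 = \<alpha> 1))"
    using lift_close_exists by auto
  \<comment> \<open>C bounds the norm of \<open>2 *\<^sub>R y - 1\<close> when norm y <= M; the
    absolute value and the last summand keep it positive for every M.\<close>
  define C where "C = 2 * \<bar>M\<bar> + norm (1 :: 'a calkin) + 1"
  have C: "0 < C" unfolding C_def by (intro add_nonneg_pos add_nonneg_nonneg) auto
  have bound: "norm ((2 *\<^sub>R y - 1) * (y - x)) \<le> d"
    if "norm y \<le> M" "norm (y - x) \<le> d / C" for x y :: "'a calkin"
  proof -
    have "norm ((2 *\<^sub>R y - 1) * (y - x)) \<le> norm (2 *\<^sub>R y - 1) * norm (y - x)" by (rule norm_mult_ineq)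
    also have "\<dots> \<le> C * (d / C)"
      using that C d norm_triangle_ineq4[of "2 *\<^sub>R y" 1] by (intro mult_mono) (auto simp: C_def)
    finally show ?thesis using C by simp
  qed
  show ?thesis
  proof (intro exI[of _ "d / C"] conjI allI impI)
    fix a b \<alpha>
    assume "is_lift E a \<alpha>" "continuous_on {0..1} b"
      and b: "\<forall>t\<in>{0..1}. b t \<in> calkin_projectors E \<and> norm (b t) \<le> M \<and> norm (b t - a t) \<le> d / C"
    then show "\<exists>\<beta>. is_lift E b \<beta> \<and> (b 0 = a 0 \<longrightarrow> \<beta> 0 = \<alpha> 0) \<and> (b 1 = a 1 \<longrightarrow> \<beta> 1 = \<alpha> 1)"
      using *[rule_format, of a \<alpha> b] bound by blast
  qed (use C d in simp)
qed

text \<open>The steps of the homotopy \<open>h\<close> are chosen so small that consecutive paths are close.\<close>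

lemma homotopy_lift:
  assumes h: "continuous_on ({0..1} \<times> {0..1}) h" "h ` ({0..1} \<times> {0..1}) \<subseteq> calkin_projectors E"
    and \<alpha>: "is_lift E (\<lambda>t. h (0, t)) \<alpha>"
    and start: "\<And>s. s \<in> {0..1} \<Longrightarrow> h (s, 0) = h (0, 0)"
  shows "\<exists>\<beta>. is_lift E (\<lambda>t. h (1::real, t::real)) \<beta> \<and> \<beta> 0 = \<alpha> 0 \<and>
    ((\<forall>s\<in>{0..1}. h (s, 1) = h (0, 1)) \<longrightarrow> \<beta> 1 = \<alpha> 1)"
proof -
  have cpt: "compact ({0..1::real} \<times> {0..1::real})" by (intro compact_Times) auto
  have "bounded (h ` ({0..1} \<times> {0..1}))"
    using cpt h(1) by (intro compact_imp_bounded compact_continuous_image)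
  then obtain M where M: "\<And>s t. s \<in> {0..1} \<Longrightarrow> t \<in> {0..1} \<Longrightarrow> norm (h (s, t)) \<le> M"
    unfolding bounded_iff by blast
  obtain d where d: "0 < d" and close: "\<forall>a b \<alpha>. is_lift E a \<alpha> \<longrightarrow> continuous_on {0..1} b \<longrightarrow>
     (\<forall>t\<in>{0..1}. b t \<in> calkin_projectors E \<and> norm (b t) \<le> M \<and> norm (b t - a t) \<le> d) \<longrightarrow>
     (\<exists>\<beta>. is_lift E b \<beta> \<and> (b 0 = a 0 \<longrightarrow> \<beta> 0 = \<alpha> 0) \<and> (b 1 = a 1 \<longrightarrow> \<beta> 1 = \<alpha> 1))"
    using lift_close[of M] by auto
  have "uniformly_continuous_on ({0..1} \<times> {0..1}) h"
    by (rule compact_uniformly_continuous[OF h(1) cpt])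
  then obtain \<delta> where \<delta>: "0 < \<delta>" "\<And>x y. x \<in> {0..1} \<times> {0..1} \<Longrightarrow> y \<in> {0..1} \<times> {0..1} \<Longrightarrow>
      dist x y < \<delta> \<Longrightarrow> dist (h x) (h y) < d"
    using d unfolding uniformly_continuous_on_def by metis
  obtain N :: nat where N: "0 < N" "1 / real N < \<delta>"
    using \<delta>(1) by (metis nat_approx_posE zero_less_Suc)
  have "\<exists>\<beta>. is_lift E (\<lambda>t. h (real k / real N, t)) \<beta> \<and> \<beta> 0 = \<alpha> 0 \<and>
      ((\<forall>s\<in>{0..1}. h (s, 1) = h (0, 1)) \<longrightarrow> \<beta> 1 = \<alpha> 1)" if "k \<le> N" for k
    using that
  proof (induction k)
    case 0
    show ?case using \<alpha> by (intro exI[of _ \<alpha>] conjI impI refl) simp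
  next
    case (Suc k)
    then obtain \<beta> where \<beta>: "is_lift E (\<lambda>t. h (real k / real N, t)) \<beta>" "\<beta> 0 = \<alpha> 0"
      "(\<forall>s\<in>{0..1}. h (s, 1) = h (0, 1)) \<longrightarrow> \<beta> 1 = \<alpha> 1" by auto
    let ?s = "real (Suc k) / real N" and ?r = "real k / real N"
    have sr: "?s \<in> {0..1}" "?r \<in> {0..1}" using Suc.prems N by auto
    have "dist ?s ?r < \<delta>" using N by (simp add: dist_real_def diff_divide_distrib[symmetric])
    then have dst: "norm (h (?s, t) - h (?r, t)) \<le> d" if "t \<in> {0..1}" for t
      using \<delta>(2)[of "(?s, t)" "(?r, t)"] sr that by (simp add: dist_Pair_Pair dist_norm)
    have "continuous_on {0..1} (\<lambda>t. h (?s, t))"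
      by (rule continuous_on_compose2[OF h(1)]) (use sr in \<open>auto intro!: continuous_intros\<close>)
    moreover have "\<forall>t\<in>{0..1}. h (?s, t) \<in> calkin_projectors E \<and> norm (h (?s, t)) \<le> M \<and>
        norm (h (?s, t) - h (?r, t)) \<le> d"
      using h(2) M sr dst by blast
    ultimately obtain \<gamma> where \<gamma>: "is_lift E (\<lambda>t. h (?s, t)) \<gamma>"
      "h (?s, 0) = h (?r, 0) \<longrightarrow> \<gamma> 0 = \<beta> 0" "h (?s, 1) = h (?r, 1) \<longrightarrow> \<gamma> 1 = \<beta> 1"
      using close[rule_format, OF \<beta>(1), of "\<lambda>t. h (?s, t)"] by blast
    have "h (?s, 0) = h (?r, 0)" by (simp only: start[OF sr(1)] start[OF sr(2)])
    then have "\<gamma> 0 = \<alpha> 0" using \<gamma>(2) \<beta>(2) by simp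
    moreover have "\<gamma> 1 = \<alpha> 1" if "\<forall>s\<in>{0..1}. h (s, 1) = h (0, 1)"
    proof -
      have "h (?s, 1) = h (?r, 1)" by (simp only: bspec[OF that sr(1)] bspec[OF that sr(2)])
      then show ?thesis using mp[OF \<gamma>(3)] mp[OF \<beta>(3) that] by simp
    qed
    ultimately show ?case using \<gamma>(1) by blast
  qed
  from this[of N] show ?thesis using N(1) by simp
qed

text \<open>The constant lift P of the constant path at a(0) is carried along the homotopy h(s, t) =
  a(s t) from s = 0 to s = 1, where the path is a itself.\<close>

lemma lift_exists:
  assumes a: "path a" "path_image a \<subseteq> calkin_projectors E" and P: "P \<in> projectors E" "quot P = a 0"
  shows "\<exists>\<beta>. is_lift E a \<beta> \<and> \<beta> 0 = P"
proof -
  define h where "h = (\<lambda>(s, t). a (s * t))"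
  have "continuous_on ({0..1} \<times> {0..1}) h"
    unfolding h_def split_def
  proof (rule continuous_on_compose2[of "{0..1}" a])
    show "continuous_on ({0..1} \<times> {0..1}) (\<lambda>x. fst x * snd x :: real)" by (intro continuous_intros)
  qed (use a(1) in \<open>auto simp: path_def mult_le_one\<close>)
  moreover have "h ` ({0..1} \<times> {0..1}) \<subseteq> calkin_projectors E"
  proof safe
    fix s t :: real assume "s \<in> {0..1}" "t \<in> {0..1}"
    then have "s * t \<in> {0..1}" by (simp add: mult_le_one)
    then have "a (s * t) \<in> calkin_projectors E"
      by (intro subsetD[OF a(2)[unfolded path_image_def]] imageI)
    then show "h (s, t) \<in> calkin_projectors E" by (simp add: h_def)
  qed
  moreover have "is_lift E (\<lambda>t. h (0, t)) (\<lambda>_. P)"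
    by (rule is_liftI) (auto simp: h_def P)
  moreover have "h (s, 0) = h (0, 0)" for s by (simp add: h_def)
  ultimately have "\<exists>\<beta>. is_lift E (\<lambda>t. h (1, t)) \<beta> \<and> \<beta> 0 = P"
    using homotopy_lift[of h "\<lambda>_. P"] by meson
  then show ?thesis by (simp add: h_def)
qed

text \<open>Two lifts \<beta> and \<gamma> starting at P satisfy [\<beta>(1) - \<gamma>(1)] =
  [P - P] = 0, as this dimension is constant in time. Additivity then gives the same value for
  both.\<close>

lemma lift_index_eq:
  assumes \<beta>: "is_lift E a \<beta>" "\<beta> 0 = P" and a: "a 0 = a 1"
  shows "lift_index E P a = relative_dimension E (\<beta> 1) P"
  unfolding lift_index_def
proof (rule the_equality)
  show "\<exists>\<beta>'. is_lift E a \<beta>' \<and> \<beta>' 0 = P \<and> relative_dimension E (\<beta> 1) P = relative_dimension E (\<beta>' 1) (\<beta>' 0)"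
    using \<beta> by auto
next
  fix n assume "\<exists>\<gamma>. is_lift E a \<gamma> \<and> \<gamma> 0 = P \<and> n = relative_dimension E (\<gamma> 1) (\<gamma> 0)"
  then obtain \<gamma> where \<gamma>: "is_lift E a \<gamma>" "\<gamma> 0 = P" "n = relative_dimension E (\<gamma> 1) P" by auto
  note b = is_liftD[OF \<beta>(1)] and c = is_liftD[OF \<gamma>(1)]
  have q: "quot (\<beta> t) = quot (\<gamma> t)" if "t \<in> {0..1}" for t using b(3) c(3) that by simp
  have 1: "\<beta> 1 \<in> projectors E" "\<gamma> 1 \<in> projectors E" "P \<in> projectors E" "quot (\<beta> 1) = quot (\<gamma> 1)" "quot (\<gamma> 1) = quot P"
    using b(2)[of 0] b(2)[of 1] c(2)[of 1] \<beta>(2) q[of 1] c(3)[of 1] c(3)[of 0] \<gamma>(2) a by auto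
  have "relative_dimension E (\<beta> 1) (\<gamma> 1) = 0"
    using relative_dimension_constant[OF b(1,2) c(1,2) q] relative_dimension_self[OF 1(3)] \<beta>(2) \<gamma>(2) by simp
  then show "n = relative_dimension E (\<beta> 1) P"
    using relative_dimension_add[OF 1(1,2,3,4,5)] \<gamma>(3) by simp
qed

text \<open>As the homotopy fixes both ends, \<open>homotopy_lift\<close> turns a lift of a into a
  lift of b with the same end points.\<close>

lemma lift_index_homotopic:
  assumes h: "homotopic_paths (calkin_projectors E) a b"
    and P: "P \<in> projectors E" "quot P = a 0" "a 0 = a 1"
  shows "lift_index E P a = lift_index E P b"
proof -
  obtain h :: "real \<times> real \<Rightarrow> 'a calkin" where h: "continuous_on ({0..1} \<times> {0..1}) h" "h \<in> ({0..1} \<times> {0..1}) \<rightarrow> calkin_projectors E"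
    "\<And>x. x \<in> {0..1} \<Longrightarrow> h (0, x) = a x" "\<And>x. x \<in> {0..1} \<Longrightarrow> h (1, x) = b x"
    "\<And>t. t \<in> {0..1} \<Longrightarrow> h (t, 0) = a 0" "\<And>t. t \<in> {0..1} \<Longrightarrow> h (t, 1) = a (1::real)"
    using h unfolding homotopic_paths by (auto simp: pathstart_def pathfinish_def)
  have a: "path a" "path_image a \<subseteq> calkin_projectors E"
    using homotopic_paths_imp_path[OF assms(1)] homotopic_paths_imp_subset[OF assms(1)] by auto
  obtain \<alpha> where \<alpha>: "is_lift E a \<alpha>" "\<alpha> 0 = P" using lift_exists[OF a P(1,2)] by blast
  have "is_lift E (\<lambda>t. h (0, t)) \<alpha>" using is_liftD[OF \<alpha>(1)] h(3) by (intro is_liftI) auto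
  moreover have "h ` ({0..1} \<times> {0..1}) \<subseteq> calkin_projectors E" using h(2) by blast
  moreover have "h (s, 0) = h (0, 0)" "h (s, 1) = h (0, 1)" if "s \<in> {0..1}" for s
    using h(5)[OF that] h(6)[OF that] h(5)[of 0] h(6)[of 0] by simp_all
  ultimately obtain \<beta> where \<beta>: "is_lift E (\<lambda>t. h (1, t)) \<beta>" "\<beta> 0 = \<alpha> 0" "\<beta> 1 = \<alpha> 1"
    using homotopy_lift[OF h(1), of \<alpha>] by blast
  have b: "is_lift E b \<beta>" using is_liftD[OF \<beta>(1)] h(4) by (intro is_liftI) auto
  have "b 0 = b 1" using h(4)[of 0] h(4)[of 1] h(5)[of 1] h(6)[of 1] P(3) by simp
  then show ?thesis using lift_index_eq[OF \<alpha> P(3)] lift_index_eq[OF b, of P] \<beta>(2,3) \<alpha>(2) by simp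
qed

text \<open>Compare the lift of b that continues from \<alpha>(1) with the one that starts at P:
  their relative dimension is constant and equals [\<alpha>(1) - P], the contribution of a.\<close>

lemma lift_index_join:
  assumes a: "path a" "path_image a \<subseteq> calkin_projectors E" "a 0 = quot P" "a 1 = quot P"
    and b: "path b" "path_image b \<subseteq> calkin_projectors E" "b 0 = quot P" "b 1 = quot P"
    and P: "P \<in> projectors E"
  shows "lift_index E P (a +++ b) = lift_index E P a + lift_index E P b"
proof -
  obtain \<alpha> where \<alpha>: "is_lift E a \<alpha>" "\<alpha> 0 = P" using lift_exists[OF a(1,2) P a(3)[symmetric]] by blast
  obtain \<beta> where \<beta>: "is_lift E b \<beta>" "\<beta> 0 = P" using lift_exists[OF b(1,2) P b(3)[symmetric]] by blast
  note \<alpha>' = is_liftD[OF \<alpha>(1)] and \<beta>' = is_liftD[OF \<beta>(1)]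
  have \<alpha>1: "\<alpha> 1 \<in> projectors E" "quot (\<alpha> 1) = quot P" using \<alpha>'(2)[of 1] \<alpha>'(3)[of 1] a(4) by auto
  obtain \<gamma> where \<gamma>: "is_lift E b \<gamma>" "\<gamma> 0 = \<alpha> 1" using lift_exists[OF b(1,2) \<alpha>1(1)] \<alpha>1(2) b(3) by auto
  note \<gamma>' = is_liftD[OF \<gamma>(1)]
  have "is_lift E (a +++ b) (\<alpha> +++ \<gamma>)"
  proof (rule is_liftI)
    have "path (\<alpha> +++ \<gamma>)"
      using \<alpha>'(1) \<gamma>'(1) \<gamma>(2) by (intro path_join_imp) (auto simp: path_def pathstart_def pathfinish_def)
    then show "continuous_on {0..1} (\<alpha> +++ \<gamma>)" by (simp add: path_def)
    fix t :: real assume "t \<in> {0..1}"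
    then show "(\<alpha> +++ \<gamma>) t \<in> projectors E" "quot ((\<alpha> +++ \<gamma>) t) = (a +++ b) t"
      using \<alpha>'(2,3)[of "2 * t"] \<gamma>'(2,3)[of "2 * t - 1"] by (auto simp: joinpaths_def)
  qed
  moreover have "(\<alpha> +++ \<gamma>) 0 = P" "(\<alpha> +++ \<gamma>) 1 = \<gamma> 1" "(a +++ b) 0 = (a +++ b) 1"
    using \<alpha>(2) a b by (simp_all add: joinpaths_def)
  ultimately have 1: "lift_index E P (a +++ b) = relative_dimension E (\<gamma> 1) P"
    using lift_index_eq[of "a +++ b" "\<alpha> +++ \<gamma>" P] by simp
  have q: "quot (\<gamma> t) = quot (\<beta> t)" if "t \<in> {0..1}" for t using \<beta>'(3) \<gamma>'(3) that by simp
  have "relative_dimension E (\<gamma> 1) (\<beta> 1) = relative_dimension E (\<alpha> 1) P"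
    using relative_dimension_constant[OF \<gamma>'(1,2) \<beta>'(1,2) q] \<gamma>(2) \<beta>(2) by simp
  moreover have "relative_dimension E (\<gamma> 1) P = relative_dimension E (\<gamma> 1) (\<beta> 1) + relative_dimension E (\<beta> 1) P"
    using \<gamma>'(2)[of 1] \<beta>'(2)[of 1] P q[of 1] \<beta>'(3)[of 1] b(4) by (intro relative_dimension_add) auto
  ultimately show ?thesis
    using 1 lift_index_eq[OF \<alpha>] lift_index_eq[OF \<beta>] a b by simp
qed

lemma lift_difference:
  assumes Q: "is_lift E a Q" and a: "path a" "path_image a \<subseteq> calkin_projectors E" "a 0 = quot P" "a 1 = quot P"
    and P: "P \<in> projectors E"
  shows "relative_dimension E (Q 0) P - relative_dimension E (Q 1) P = - lift_index E P a"
proof -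
  obtain \<beta> where \<beta>: "is_lift E a \<beta>" "\<beta> 0 = P" using lift_exists[OF a(1,2) P a(3)[symmetric]] by blast
  note Q' = is_liftD[OF Q] and \<beta>' = is_liftD[OF \<beta>(1)]
  have q: "quot (Q t) = quot (\<beta> t)" if "t \<in> {0..1}" for t using \<beta>'(3) Q'(3) that by simp
  have "relative_dimension E (Q 0) P = relative_dimension E (Q 1) (\<beta> 1)"
    using relative_dimension_constant[OF Q'(1,2) \<beta>'(1,2) q] \<beta>(2) by simp
  moreover have "relative_dimension E (Q 1) P = relative_dimension E (Q 1) (\<beta> 1) + relative_dimension E (\<beta> 1) P"
    using Q'(2)[of 1] \<beta>'(2)[of 1] P q[of 1] \<beta>'(3)[of 1] a(4) by (intro relative_dimension_add) auto
  ultimately show ?thesis using lift_index_eq[OF \<beta>] a by simp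
qed

end

section \<open>The positive spectral idempotent modulo compact operators\<close>

text \<open>\<open>res\<close> recovers an operator from its complexification. For real E, \<open>\<Gamma>\<close> consists of the complex
  conjugation, whose fixed points come from E; for complex E it is empty.\<close>

locale extended_space = averaged_space E av
  for E :: "('k::field, 'a::banach, 'c::banach) kspace" and av +
  fixes res :: "('c \<Rightarrow>\<^sub>L 'c) \<Rightarrow> ('a \<Rightarrow>\<^sub>L 'a)" and \<Gamma> :: "('c calkin \<Rightarrow> 'c calkin) set"
  assumes im_square: "im_unit E o\<^sub>L im_unit E = - id_blinfun"
    and cx_linear: "bounded_linear (cx_op E)"
    and cx_compose: "cx_op E (A o\<^sub>L B) = cx_op E A o\<^sub>L cx_op E B"
    and cx_one: "cx_op E id_blinfun = id_blinfun"
    and cx_im: "A \<in> operators E \<Longrightarrow> cx_op E A o\<^sub>L im_unit E = im_unit E o\<^sub>L cx_op E A"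
    and res_linear: "bounded_linear res"
    and res_compact: "compact_operator C \<Longrightarrow> compact_operator (res C)"
    and res_cx: "res (cx_op E A) = A"
    and \<Gamma>_automorphism: "\<sigma> \<in> \<Gamma> \<Longrightarrow> bounded_linear \<sigma> \<and> (\<forall>x y. \<sigma> (x * y) = \<sigma> x * \<sigma> y) \<and> \<sigma> 1 = 1 \<and>
        \<sigma> (quot (im_unit E)) = - quot (im_unit E) \<and> (\<forall>A. \<sigma> (quot (cx_op E A)) = quot (cx_op E A))"
    and descend: "X * quot (im_unit E) = quot (im_unit E) * X \<Longrightarrow> (\<And>\<sigma>. \<sigma> \<in> \<Gamma> \<Longrightarrow> \<sigma> X = X) \<Longrightarrow>
        \<exists>B\<in>operators E. X = quot (cx_op E B)"
begin

sublocale cs: complex_structure "im_unit E"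
  by unfold_locales (rule im_square)

interpretation cx: bounded_linear "cx_op E" by (rule cx_linear)
interpretation res: bounded_linear res by (rule res_linear)

lemma cx_scale_eq: "cx_scale E = cs.scale"
  by (intro ext) (simp add: cx_scale_def cs.scale_def)

lemma cx_operator_monoid_eq: "cx_operator_monoid E = cs.operators.commutant"
  by (simp add: cx_operator_monoid_def cs.operators.commutant_def)

lemma cx_calkin_monoid_eq: "cx_calkin_monoid E = cs.calkin.commutant"
  using cs.commutant_calkin_carrier
  by (simp add: cx_calkin_monoid_def cs.calkin.commutant_def cx_operator_monoid_def)

lemma quot_cx_inj: "quot (cx_op E A) = quot (cx_op E B) \<Longrightarrow> quot A = quot B"
  using res_compact[of "cx_op E A - cx_op E B"] by (simp add: quot_eq_iff res.diff res_cx)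

text \<open>\<open>Psi\<close> is described through the complexification. This bound, which comes
  from \<open>res\<close>, transports continuity of the idempotents back to E.\<close>

lemma norm_quot_le: "\<exists>K. \<forall>A. norm (quot A) \<le> K * norm (quot (cx_op E A))"
proof -
  obtain K where K: "0 < K" "\<And>C. norm (res C) \<le> norm C * K" using res.pos_bounded by blast
  have "norm (quot A) \<le> K * norm (quot (cx_op E A))" for A
  proof (rule field_le_epsilon)
    fix e :: real assume e: "0 < e"
    have "norm (quot (cx_op E A)) < norm (quot (cx_op E A)) + e / K" using e K by simp
    then obtain C where C: "quot (cx_op E A) = quot C" "norm C < norm (quot (cx_op E A)) + e / K"
      by (rule calkin_norm_approx)
    have "compact_operator (res (cx_op E A - C))" using C(1) by (intro res_compact) (simp add: quot_eq_iff)
    then have "quot A = quot (res C)" by (simp add: quot_eq_iff res.diff res_cx)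
    then have "norm (quot A) \<le> norm C * K"
      using K(2)[of C] calkin_norm_le[of "res C"] by simp
    also have "\<dots> \<le> (norm (quot (cx_op E A)) + e / K) * K" using C K by (intro mult_right_mono) auto
    also have "\<dots> = K * norm (quot (cx_op E A)) + e" using K by (simp add: field_simps)
    finally show "norm (quot A) \<le> K * norm (quot (cx_op E A)) + e" .
  qed
  then show ?thesis by blast
qed

lemma comm_cx: "A \<in> operators E \<Longrightarrow> cs.calkin.comm (quot (cx_op E A))"
  using cx_im by (simp add: cs.calkin.comm_def quot_simps)

text \<open>Invertibility modulo compact operators puts the imaginary axis into the resolvent set.
  The sign changes because the Fredholm condition is about A - z and the resolvent about z -
  A.\<close>

lemma hyperbolic_if_ess_hyperbolic:
  assumes "A \<in> ess_hyperbolic E"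
  shows "cs.calkin.hyperbolic (quot (cx_op E A))"
  unfolding cs.calkin.hyperbolic_def
proof (intro conjI allI impI)
  have A: "A \<in> operators E" using assms by (simp add: ess_hyperbolic_def)
  show "cs.calkin.comm (quot (cx_op E A))" by (rule comm_cx[OF A])
  fix z :: complex assume z: "Re z = 0"
  define T where "T = cx_op E A - (Re z *\<^sub>R id_blinfun + Im z *\<^sub>R im_unit E)"
  have "blinfun_apply T = (\<lambda>x. cx_op E A x - cx_scale E z x)"
    by (rule ext) (simp add: T_def cx_scale_def blinfun.bilinear_simps)
  then have "fredholm cs.scale UNIV UNIV (blinfun_apply T)"
    using assms z by (simp add: ess_hyperbolic_def cx_scale_eq)
  then have "calkin.invertible (quot T)" by (rule cs.calkin_invertible_if_complex_fredholm)
  then obtain y where "calkin.inverse_of (quot T) y" by (auto simp: calkin.invertible_def)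
  then have "calkin.inverse_of (- quot T) (- y)" by (simp add: calkin.inverse_of_def)
  moreover have "- quot T = cs.calkin.cs z 1 - quot (cx_op E A)"
  proof -
    have "quot T = quot (cx_op E A) - (Re z *\<^sub>R quot id_blinfun + Im z *\<^sub>R quot (im_unit E))"
      unfolding T_def by (simp only: quot_simps(3,5,6))
    then show ?thesis by (simp add: cs.calkin.cs_def quot_simps(2))
  qed
  ultimately show "z \<in> cs.calkin.resolvent_set (quot (cx_op E A))"
    using calkin.invertibleI by (auto simp: cs.calkin.resolvent_set_def)
qed

definition spi :: "('a \<Rightarrow>\<^sub>L 'a) \<Rightarrow> 'c calkin" where
  "spi A = spectral_idempotent cs.calkin.commutant (quot (im_unit E)) (quot (cx_op E A))"

lemma Psi_eq:
  assumes "B \<in> operators E" "quot (cx_op E B) = spi A"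
  shows "Psi E A = quot B"
  unfolding Psi_def
proof (rule the_equality)
  show "\<exists>B'\<in>operators E. quot B = quot B' \<and> quot (cx_op E B') =
      spectral_idempotent (cx_calkin_monoid E) (quot (im_unit E)) (quot (cx_op E A))"
    using assms by (auto simp: spi_def cx_calkin_monoid_eq)
next
  fix e assume "\<exists>B'\<in>operators E. e = quot B' \<and> quot (cx_op E B') =
      spectral_idempotent (cx_calkin_monoid E) (quot (im_unit E)) (quot (cx_op E A))"
  then obtain B' where "e = quot B'" "quot (cx_op E B') = spi A" by (auto simp: spi_def cx_calkin_monoid_eq)
  then show "e = quot B" using assms(2) quot_cx_inj by metis
qed

text \<open>The spectral idempotent commutes with the imaginary unit and, since the class of
  \<open>cx_op E A\<close> is fixed by \<open>\<Gamma>\<close>, is fixed by it too. This is what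
  \<open>descend\<close> asks for.\<close>

lemma Psi_representative:
  assumes A: "A \<in> ess_hyperbolic E"
  shows "\<exists>B\<in>operators E. Psi E A = quot B \<and> quot (cx_op E B) = spi A"
proof -
  note h = hyperbolic_if_ess_hyperbolic[OF A]
  have "spi A * quot (im_unit E) = quot (im_unit E) * spi A"
    using cs.calkin.spectral_idempotent_properties(1)[OF h] by (simp add: spi_def cs.calkin.comm_def)
  moreover have "\<sigma> (spi A) = spi A" if "\<sigma> \<in> \<Gamma>" for \<sigma>
    unfolding spi_def using \<Gamma>_automorphism[OF that]
    by (intro cs.calkin.spectral_idempotent_invariant[OF h]) auto
  ultimately obtain B where "B \<in> operators E" "spi A = quot (cx_op E B)" using descend by blast
  then show ?thesis using Psi_eq by metis
qed

lemma Psi_mem: "A \<in> ess_hyperbolic E \<Longrightarrow> Psi E A \<in> calkin_projectors E"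
proof -
  assume A: "A \<in> ess_hyperbolic E"
  obtain B where B: "B \<in> operators E" "Psi E A = quot B" "quot (cx_op E B) = spi A"
    using Psi_representative[OF A] by blast
  have "spi A * spi A = spi A"
    using cs.calkin.spectral_idempotent_properties(2)[OF hyperbolic_if_ess_hyperbolic[OF A]] by (simp add: spi_def)
  then have "quot (cx_op E (B o\<^sub>L B)) = quot (cx_op E B)"
    using B(3) by (simp add: cx_compose flip: quot_simps(7))
  then have "quot (B o\<^sub>L B) = quot B" by (rule quot_cx_inj)
  then show "Psi E A \<in> calkin_projectors E"
    using B by (auto simp: calkin_projectors_def calkin_algebra_def quot_simps(7))
qed

lemma continuous_on_Psi: "continuous_on (ess_hyperbolic E) (Psi E)"
proof -
  obtain K where K: "\<And>A. norm (quot A) \<le> K * norm (quot (cx_op E A))" using norm_quot_le by blast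
  have "continuous_on (ess_hyperbolic E) (\<lambda>A. quot (cx_op E A))"
    by (intro bounded_linear.continuous_on[OF bounded_linear_quot] cx.continuous_on continuous_on_id)
  then have "continuous_on (ess_hyperbolic E) spi"
    unfolding spi_def using hyperbolic_if_ess_hyperbolic
    by (intro continuous_on_compose2[OF cs.calkin.continuous_on_spectral_idempotent]) auto
  then have *: "((\<lambda>B. K * norm (spi B - spi A)) \<longlongrightarrow> 0) (at A within ess_hyperbolic E)"
    if "A \<in> ess_hyperbolic E" for A
    using that unfolding continuous_on_def
    by (intro tendsto_mult_right_zero tendsto_norm_zero) (simp add: LIM_zero)
  have le: "norm (Psi E B - Psi E A) \<le> K * norm (spi B - spi A)"
    if AB: "A \<in> ess_hyperbolic E" "B \<in> ess_hyperbolic E" for A B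
  proof -
    obtain A' where A': "Psi E A = quot A'" "quot (cx_op E A') = spi A" using Psi_representative[OF AB(1)] by blast
    obtain B' where B': "Psi E B = quot B'" "quot (cx_op E B') = spi B" using Psi_representative[OF AB(2)] by blast
    have "Psi E B - Psi E A = quot (B' - A')" using A'(1) B'(1) by (simp add: quot_simps(5))
    moreover have "spi B - spi A = quot (cx_op E (B' - A'))"
      by (simp add: cx.diff flip: A'(2) B'(2) quot_simps(5))
    ultimately show ?thesis using K by simp
  qed
  show ?thesis
    unfolding continuous_on_def
  proof
    fix A assume A: "A \<in> ess_hyperbolic E"
    have "((\<lambda>B. Psi E B - Psi E A) \<longlongrightarrow> 0) (at A within ess_hyperbolic E)"
      by (rule Lim_null_comparison[OF _ *[OF A]]) (simp add: eventually_at_filter le[OF A])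
    then show "(Psi E \<longlongrightarrow> Psi E A) (at A within ess_hyperbolic E)" by (simp add: LIM_zero_iff)
  qed
qed

lemma cx_reflection: "cx_op E (2 *\<^sub>R P - id_blinfun) = 2 *\<^sub>R cx_op E P - id_blinfun"
  by (simp only: cx.diff cx.scaleR cx_one)

lemma Psi_reflection:
  assumes P: "P \<in> projectors E"
  shows "Psi E (2 *\<^sub>R P - id_blinfun) = quot P"
proof (rule Psi_eq)
  note P' = projectorsD[OF P]
  show "P \<in> operators E" by (rule P'(1))
  have idem: "quot (cx_op E P) * quot (cx_op E P) = quot (cx_op E P)"
    using P'(2) by (simp add: quot_simps(7) flip: cx_compose)
  have "quot (cx_op E (2 *\<^sub>R P - id_blinfun)) = 2 *\<^sub>R quot (cx_op E P) - 1"
    by (simp only: cx_reflection quot_simps(2)[symmetric] quot_simps(5,6))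
  then show "quot (cx_op E P) = spi (2 *\<^sub>R P - id_blinfun)"
    using cs.calkin.spectral_idempotent_reflection[OF comm_cx[OF P'(1)] idem] by (simp add: spi_def)
qed

text \<open>The value at the base point of the loops, where the spectral flow evaluates
  \<open>pos_projector\<close>.\<close>

lemma pos_projector_reflection:
  assumes P: "P \<in> projectors E"
  shows "pos_projector E (2 *\<^sub>R P - id_blinfun) = P"
proof -
  note P' = projectorsD[OF P]
  have "cs.operators.comm (cx_op E P)" using cx_im[OF P'(1)] by (simp add: cs.operators.comm_def)
  moreover have "cx_op E P o\<^sub>L cx_op E P = cx_op E P" using P'(2) by (simp flip: cx_compose)
  ultimately have *: "spectral_idempotent (cx_operator_monoid E) (im_unit E) (cx_op E (2 *\<^sub>R P - id_blinfun)) = cx_op E P"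
    unfolding cx_operator_monoid_eq cx_reflection by (rule cs.operators.spectral_idempotent_reflection)
  show ?thesis
    unfolding pos_projector_def *
  proof (rule the_equality)
    show "P \<in> operators E \<and> cx_op E P = cx_op E P" using P' by simp
    show "B = P" if "B \<in> operators E \<and> cx_op E B = cx_op E P" for B
      using that res_cx by metis
  qed
qed

end

section \<open>Fundamental groups\<close>

lemma path_class_eq: "homotopic_paths S p q \<Longrightarrow> path_class S p = path_class S q"
  unfolding path_class_def using homotopic_paths_sym homotopic_paths_trans by blast

lemma path_class_self: "p \<in> loops S x \<Longrightarrow> p \<in> path_class S p"
  by (simp add: path_class_def loops_def homotopic_paths_refl)

lemma loops_join: "p \<in> loops S x \<Longrightarrow> q \<in> loops S x \<Longrightarrow> p +++ q \<in> loops S x"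
  using path_image_join_subset[of p q] by (auto simp: loops_def)

text \<open>The product is a union over all pairs of representatives; joining respects homotopy, so
  all the classes in the union coincide.\<close>

lemma path_class_mult:
  assumes "p \<in> loops S x" "q \<in> loops S x"
  shows "path_class S p \<otimes>\<^bsub>fundamental_group S x\<^esub> path_class S q = path_class S (p +++ q)"
proof -
  have *: "path_class S (p' +++ q') = path_class S (p +++ q)"
    if "p' \<in> path_class S p" "q' \<in> path_class S q" for p' q'
    using that assms path_class_eq[OF homotopic_paths_join[of S p p' q q']]
    by (auto simp: path_class_def loops_def)
  have "(\<Union>p'\<in>path_class S p. \<Union>q'\<in>path_class S q. path_class S (p' +++ q')) = path_class S (p +++ q)"
    using * path_class_self[OF assms(1)] path_class_self[OF assms(2)] by blast
  then show ?thesis by (simp add: fundamental_group_def)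
qed

lemma image_eq_constant: "(\<And>x. x \<in> S \<Longrightarrow> f x = c) \<Longrightarrow> a \<in> S \<Longrightarrow> f ` S = {c}"
  by auto

lemma loops_homotopic:
  assumes "p \<in> loops S x" "q \<in> path_class S p"
  shows "q \<in> loops S x"
  using assms homotopic_paths_imp_path[of S p q] homotopic_paths_imp_subset[of S p q]
    homotopic_paths_imp_pathstart[of S p q] homotopic_paths_imp_pathfinish[of S p q]
  by (simp add: loops_def path_class_def)

context extended_space
begin

lemma loops_calkinD:
  assumes "a \<in> loops (calkin_projectors E) (quot P)"
  shows "path a" "path_image a \<subseteq> calkin_projectors E" "a 0 = quot P" "a 1 = quot P"
  using assms by (auto simp: loops_def pathstart_def pathfinish_def)

lemma phi_hom_class:
  assumes P: "P \<in> projectors E" and a: "a \<in> loops (calkin_projectors E) (quot P)"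
  shows "phi_hom E P (path_class (calkin_projectors E) a) = lift_index E P a"
proof -
  note a' = loops_calkinD[OF a]
  have "lift_index E P b = lift_index E P a" if "b \<in> path_class (calkin_projectors E) a" for b
    using lift_index_homotopic[of a b P] that P a' by (simp add: path_class_def)
  from image_eq_constant[OF this path_class_self[OF a]] show ?thesis by (simp add: phi_hom_def)
qed

lemma Psi_loop:
  assumes P: "P \<in> projectors E" and A: "A \<in> loops (ess_hyperbolic E) (2 *\<^sub>R P - id_blinfun)"
  shows "Psi E \<circ> A \<in> loops (calkin_projectors E) (quot P)"
proof -
  have A': "path A" "path_image A \<subseteq> ess_hyperbolic E" using A by (auto simp: loops_def)
  have "path (Psi E \<circ> A)"
    by (rule path_continuous_image[OF A'(1) continuous_on_subset[OF continuous_on_Psi A'(2)]])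
  then show ?thesis
    using A Psi_reflection[OF P] Psi_mem
    by (auto simp: loops_def path_image_compose pathstart_compose pathfinish_compose)
qed

lemma Psi_star_class:
  assumes P: "P \<in> projectors E" and A: "A \<in> loops (ess_hyperbolic E) (2 *\<^sub>R P - id_blinfun)"
  shows "Psi_star E (path_class (ess_hyperbolic E) A) = path_class (calkin_projectors E) (Psi E \<circ> A)"
proof -
  have "path_class (calkin_projectors E) (Psi E \<circ> B) = path_class (calkin_projectors E) (Psi E \<circ> A)"
    if "B \<in> path_class (ess_hyperbolic E) A" for B
  proof -
    have "homotopic_paths (ess_hyperbolic E) A B" using that by (simp add: path_class_def)
    then have "homotopic_paths (calkin_projectors E) (Psi E \<circ> A) (Psi E \<circ> B)"
      by (rule homotopic_paths_continuous_image[OF _ continuous_on_Psi]) (use Psi_mem in auto)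
    then show ?thesis using path_class_eq by metis
  qed
  then show ?thesis using path_class_self[OF A] unfolding Psi_star_def by blast
qed

lemma spectral_flow_eq:
  assumes P: "P \<in> projectors E" and A: "A \<in> loops (ess_hyperbolic E) (2 *\<^sub>R P - id_blinfun)"
  shows "spectral_flow E A = - lift_index E P (Psi E \<circ> A)"
proof -
  note a = loops_calkinD[OF Psi_loop[OF P A]]
  have ends: "pos_projector E (A 0) = P" "pos_projector E (A 1) = P"
    using A pos_projector_reflection[OF P] by (auto simp: loops_def pathstart_def pathfinish_def)
  obtain \<beta> where \<beta>: "is_lift E (Psi E \<circ> A) \<beta>" using lift_exists[OF a(1,2) P a(3)[symmetric]] by blast
  show ?thesis
    unfolding spectral_flow_def ends
  proof (rule the_equality)
    show "\<exists>Q. is_lift E (Psi E \<circ> A) Q \<and> - lift_index E P (Psi E \<circ> A) =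
        relative_dimension E (Q 0) P - relative_dimension E (Q 1) P"
      using lift_difference[OF \<beta> a P] \<beta> by metis
    fix n assume "\<exists>Q. is_lift E (Psi E \<circ> A) Q \<and> n = relative_dimension E (Q 0) P - relative_dimension E (Q 1) P"
    then show "n = - lift_index E P (Psi E \<circ> A)" using lift_difference[OF _ a P] by blast
  qed
qed

lemma sf_hom_class:
  assumes P: "P \<in> projectors E" and A: "A \<in> loops (ess_hyperbolic E) (2 *\<^sub>R P - id_blinfun)"
  shows "sf_hom E (path_class (ess_hyperbolic E) A) =
    - phi_hom E P (Psi_star E (path_class (ess_hyperbolic E) A))"
proof -
  have "spectral_flow E B = - phi_hom E P (Psi_star E (path_class (ess_hyperbolic E) A))"
    if "B \<in> path_class (ess_hyperbolic E) A" for B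
  proof -
    have B: "B \<in> loops (ess_hyperbolic E) (2 *\<^sub>R P - id_blinfun)" by (rule loops_homotopic[OF A that])
    have "path_class (ess_hyperbolic E) A = path_class (ess_hyperbolic E) B"
      using that path_class_eq by (auto simp: path_class_def)
    then show ?thesis
      using spectral_flow_eq[OF P B] phi_hom_class[OF P Psi_loop[OF P B]] Psi_star_class[OF P B] by simp
  qed
  from image_eq_constant[OF this path_class_self[OF A]] show ?thesis by (simp add: sf_hom_def)
qed

text \<open>Multiplicativity of \<open>sf_hom\<close> is obtained from the formula itself, as it is
  minus a composition of two homomorphisms.\<close>

theorem spectral_flow_factorization:
  assumes P: "P \<in> projectors E"
  defines "G \<equiv> fundamental_group (ess_hyperbolic E) (2 *\<^sub>R P - id_blinfun)"
    and "H \<equiv> fundamental_group (calkin_projectors E) (quot P)"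
  shows "sf_hom E \<in> hom G integer_group \<and> phi_hom E P \<in> hom H integer_group \<and> Psi_star E \<in> hom G H \<and>
    (\<forall>c\<in>carrier G. sf_hom E c = - phi_hom E P (Psi_star E c))"
proof (intro conjI)
  have G: "\<exists>A\<in>loops (ess_hyperbolic E) (2 *\<^sub>R P - id_blinfun). c = path_class (ess_hyperbolic E) A"
    if "c \<in> carrier G" for c
    using that by (auto simp: G_def fundamental_group_def)
  have H: "\<exists>a\<in>loops (calkin_projectors E) (quot P). c = path_class (calkin_projectors E) a"
    if "c \<in> carrier H" for c
    using that by (auto simp: H_def fundamental_group_def)
  show sf: "\<forall>c\<in>carrier G. sf_hom E c = - phi_hom E P (Psi_star E c)"
    using G sf_hom_class[OF P] by blast
  have phi_mult: "phi_hom E P (c \<otimes>\<^bsub>H\<^esub> d) = phi_hom E P c + phi_hom E P d"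
    if cd: "c \<in> carrier H" "d \<in> carrier H" for c d
  proof -
    obtain a where a: "a \<in> loops (calkin_projectors E) (quot P)" "c = path_class (calkin_projectors E) a"
      using H[OF cd(1)] by blast
    obtain b where b: "b \<in> loops (calkin_projectors E) (quot P)" "d = path_class (calkin_projectors E) b"
      using H[OF cd(2)] by blast
    have "c \<otimes>\<^bsub>H\<^esub> d = path_class (calkin_projectors E) (a +++ b)"
      unfolding H_def a(2) b(2) by (rule path_class_mult[OF a(1) b(1)])
    then show ?thesis
      using phi_hom_class[OF P loops_join[OF a(1) b(1)]] phi_hom_class[OF P a(1)] phi_hom_class[OF P b(1)]
        lift_index_join[OF loops_calkinD[OF a(1)] loops_calkinD[OF b(1)] P] a(2) b(2) by simp
  qed
  show "phi_hom E P \<in> hom H integer_group"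
    by (rule homI) (auto simp: phi_mult)
  have Psi_carrier: "Psi_star E c \<in> carrier H" if c: "c \<in> carrier G" for c
  proof -
    obtain A where A: "A \<in> loops (ess_hyperbolic E) (2 *\<^sub>R P - id_blinfun)" "c = path_class (ess_hyperbolic E) A"
      using G[OF c] by blast
    show ?thesis
      using Psi_star_class[OF P A(1)] Psi_loop[OF P A(1)] A(2) by (simp add: H_def fundamental_group_def)
  qed
  have Psi_mult: "c \<otimes>\<^bsub>G\<^esub> d \<in> carrier G" "Psi_star E (c \<otimes>\<^bsub>G\<^esub> d) = Psi_star E c \<otimes>\<^bsub>H\<^esub> Psi_star E d"
    if cd: "c \<in> carrier G" "d \<in> carrier G" for c d
  proof -
    obtain A where A: "A \<in> loops (ess_hyperbolic E) (2 *\<^sub>R P - id_blinfun)" "c = path_class (ess_hyperbolic E) A"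
      using G[OF cd(1)] by blast
    obtain B where B: "B \<in> loops (ess_hyperbolic E) (2 *\<^sub>R P - id_blinfun)" "d = path_class (ess_hyperbolic E) B"
      using G[OF cd(2)] by blast
    have cd': "c \<otimes>\<^bsub>G\<^esub> d = path_class (ess_hyperbolic E) (A +++ B)"
      unfolding G_def A(2) B(2) by (rule path_class_mult[OF A(1) B(1)])
    then show "c \<otimes>\<^bsub>G\<^esub> d \<in> carrier G" using loops_join[OF A(1) B(1)] by (simp add: G_def fundamental_group_def)
    show "Psi_star E (c \<otimes>\<^bsub>G\<^esub> d) = Psi_star E c \<otimes>\<^bsub>H\<^esub> Psi_star E d"
      unfolding cd' unfolding A(2) B(2) Psi_star_class[OF P loops_join[OF A(1) B(1)]] Psi_star_class[OF P A(1)]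
        Psi_star_class[OF P B(1)] H_def path_class_mult[OF Psi_loop[OF P A(1)] Psi_loop[OF P B(1)]]
        path_compose_join ..
  qed
  show "Psi_star E \<in> hom G H"
    by (rule homI) (auto simp: Psi_carrier Psi_mult(2))
  show "sf_hom E \<in> hom G integer_group"
    by (rule homI) (auto simp: sf Psi_mult phi_mult Psi_carrier)
qed

end

section \<open>Real and complex Banach spaces\<close>

lemma real_space_simps:
  "scal real_space = (*\<^sub>R)" "operators real_space = UNIV"
  by (auto simp: real_space_def operators_def blinfun.scaleR_right)

definition embed_blinfun :: "'a::real_normed_vector \<Rightarrow>\<^sub>L ('a \<times> 'a)" where
  "embed_blinfun = Blinfun (\<lambda>x. (x, 0))"

definition conj_blinfun :: "('a::real_normed_vector \<times> 'a) \<Rightarrow>\<^sub>L ('a \<times> 'a)" where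
  "conj_blinfun = Blinfun (\<lambda>p. (fst p, - snd p))"

lemma pair_blinfun_apply [simp]:
  "embed_blinfun (x :: 'a::real_normed_vector) = (x, 0)"
  "conj_blinfun (p :: 'a \<times> 'a) = (fst p, - snd p)"
proof -
  have "bounded_linear (\<lambda>x :: 'a. (x, 0 :: 'a))"
    by (intro bounded_linear_Pair bounded_linear_ident bounded_linear_zero)
  from bounded_linear_Blinfun_apply[OF this] show "embed_blinfun x = (x, 0)"
    unfolding embed_blinfun_def by (rule fun_cong)
  have "bounded_linear (\<lambda>p :: 'a \<times> 'a. (fst p, - snd p))"
    by (intro bounded_linear_Pair bounded_linear_fst bounded_linear_minus bounded_linear_snd)
  from bounded_linear_Blinfun_apply[OF this] show "conj_blinfun p = (fst p, - snd p)"
    unfolding conj_blinfun_def by (rule fun_cong)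
qed

lemma im_unit_real_space': "im_unit real_space p = (- snd p, fst p)"
  using im_unit_real_space[of "fst p" "snd p"] by simp

lemma cx_op_real_space': "cx_op real_space A p = (A (fst p), A (snd p))"
  using cx_op_real_space[of A "fst p" "snd p"] by simp

text \<open>Operators on the complexification are 2 x 2 block matrices: \<open>res\<close> reads off
  the upper left block, and conjugation by (x, y) -> (x, -y) singles out the classes that come from
  real operators among the complex linear ones.\<close>

lemma extended_real_space:
  "extended_space (real_space :: (real, 'a::banach, 'a \<times> 'a) kspace) (\<lambda>A. A)
    (\<lambda>C. fst_blinfun o\<^sub>L C o\<^sub>L embed_blinfun) {\<lambda>X. quot conj_blinfun * X * quot conj_blinfun}"
proof -
  let ?E = "real_space :: (real, 'a, 'a \<times> 'a) kspace"
  let ?J = "im_unit ?E"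
  note pair = im_unit_real_space' cx_op_real_space'
  have cc: "conj_blinfun o\<^sub>L conj_blinfun = (id_blinfun :: ('a \<times> 'a) \<Rightarrow>\<^sub>L ('a \<times> 'a))"
    by (rule blinfun_eqI) simp
  have qq: "quot conj_blinfun * quot conj_blinfun = (1 :: ('a \<times> 'a) calkin)"
    by (simp add: quot_simps(2,7) cc)
  have JJ: "?J o\<^sub>L ?J = - id_blinfun" by (rule blinfun_eqI) (simp add: pair blinfun.minus_left prod_eq_iff)
  interpret J: complex_structure ?J by unfold_locales (rule JJ)
  \<comment> \<open>Written with compositions only, the complexification is visibly bounded and
    linear in A.\<close>
  have cx: "cx_op ?E = (\<lambda>A. (embed_blinfun o\<^sub>L A o\<^sub>L fst_blinfun) - (?J o\<^sub>L (embed_blinfun o\<^sub>L A o\<^sub>L (fst_blinfun o\<^sub>L ?J))))"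
    by (intro ext blinfun_eqI) (simp add: pair blinfun.bilinear_simps prod_eq_iff)
  have lin: "bounded_linear (\<lambda>C. A o\<^sub>L C o\<^sub>L B)" for A :: "'y::real_normed_vector \<Rightarrow>\<^sub>L 'z::real_normed_vector"
    and B :: "'w::real_normed_vector \<Rightarrow>\<^sub>L 'x::real_normed_vector"
    by (rule bounded_linear_compose[OF bounded_bilinear.bounded_linear_left[OF bounded_bilinear_blinfun_compose]
          bounded_bilinear.bounded_linear_right[OF bounded_bilinear_blinfun_compose]])
  show ?thesis
  proof (intro extended_space.intro averaged_space.intro scalar_space.intro
      extended_space_axioms.intro averaged_space_axioms.intro)
    show "vector_space (scal ?E)" unfolding real_space_simps by unfold_locales (simp_all add: algebra_simps)
    show "\<exists>k. \<forall>x. scal ?E k x = r *\<^sub>R x" for r by (auto simp: real_space_simps)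
    show "bounded_linear (cx_op ?E)"
      unfolding cx by (intro bounded_linear_sub lin
          bounded_linear_compose[OF bounded_bilinear.bounded_linear_right[OF bounded_bilinear_blinfun_compose]])
    show "cx_op ?E (A o\<^sub>L B) = cx_op ?E A o\<^sub>L cx_op ?E B" for A B
      by (rule blinfun_eqI) (simp add: pair)
    show "cx_op ?E id_blinfun = id_blinfun" by (rule blinfun_eqI) (simp add: pair)
    show "cx_op ?E A o\<^sub>L ?J = ?J o\<^sub>L cx_op ?E A" for A
      by (rule blinfun_eqI) (simp add: pair blinfun.minus_right)
    show "bounded_linear (\<lambda>C :: ('a \<times> 'a) \<Rightarrow>\<^sub>L ('a \<times> 'a). fst_blinfun o\<^sub>L C o\<^sub>L embed_blinfun)" by (rule lin)
    show "compact_operator (fst_blinfun o\<^sub>L C o\<^sub>L embed_blinfun)" if "compact_operator C" for C :: "('a \<times> 'a) \<Rightarrow>\<^sub>L ('a \<times> 'a)"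
      using that by (intro compact_operator_compose_right compact_operator_compose_left)
    show "fst_blinfun o\<^sub>L cx_op ?E A o\<^sub>L embed_blinfun = A" for A by (rule blinfun_eqI) (simp add: pair)
  next
    fix \<sigma> :: "('a \<times> 'a) calkin \<Rightarrow> ('a \<times> 'a) calkin"
    assume "\<sigma> \<in> {\<lambda>X. quot conj_blinfun * X * quot conj_blinfun}"
    then have \<sigma>: "\<sigma> = (\<lambda>X. quot conj_blinfun * X * quot conj_blinfun)" by simp
    have 1: "bounded_linear \<sigma>"
      unfolding \<sigma> by (intro bounded_linear_mult_const bounded_linear_const_mult bounded_linear_ident)
    have 2: "\<sigma> (x * y) = \<sigma> x * \<sigma> y" for x y
    proof -
      have "\<sigma> x * \<sigma> y = quot conj_blinfun * x * (quot conj_blinfun * quot conj_blinfun) * y * quot conj_blinfun"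
        by (simp only: \<sigma> mult.assoc)
      then show ?thesis by (simp add: qq) (simp add: \<sigma> mult.assoc)
    qed
    have "conj_blinfun o\<^sub>L ?J o\<^sub>L conj_blinfun = - ?J"
      by (rule blinfun_eqI) (simp add: pair blinfun.minus_left)
    then have 3: "\<sigma> (quot ?J) = - quot ?J" by (simp add: \<sigma> quot_simps(4,7))
    have "conj_blinfun o\<^sub>L cx_op ?E A o\<^sub>L conj_blinfun = cx_op ?E A" for A
      by (rule blinfun_eqI) (simp add: pair blinfun.minus_right)
    then have 4: "\<sigma> (quot (cx_op ?E A)) = quot (cx_op ?E A)" for A by (simp add: \<sigma> quot_simps(7))
    show "bounded_linear \<sigma> \<and> (\<forall>x y. \<sigma> (x * y) = \<sigma> x * \<sigma> y) \<and> \<sigma> 1 = 1 \<and>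
        \<sigma> (quot ?J) = - quot ?J \<and> (\<forall>A. \<sigma> (quot (cx_op ?E A)) = quot (cx_op ?E A))"
      using 1 2 3 4 by (simp add: \<sigma> qq)
  next
    fix X :: "('a \<times> 'a) calkin"
    assume X: "X * quot ?J = quot ?J * X"
      and "\<And>\<sigma>. \<sigma> \<in> {\<lambda>X. quot conj_blinfun * X * quot conj_blinfun} \<Longrightarrow> \<sigma> X = X"
    then have \<sigma>X: "quot conj_blinfun * X * quot conj_blinfun = X" by blast
    obtain C where C: "C o\<^sub>L ?J = ?J o\<^sub>L C" "X = quot C" using J.average_commutes[OF X] by blast
    have CJ: "C (?J x) = ?J (C x)" for x
      using arg_cong[OF C(1), of "\<lambda>A. blinfun_apply A x"] by simp
    \<comment> \<open>Averaging over conjugation keeps the class of C and removes its imaginary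
      part; what is left is a diagonal block matrix with B in both places.\<close>
    define D where "D = (1/2) *\<^sub>R (C + (conj_blinfun o\<^sub>L C o\<^sub>L conj_blinfun))"
    have "quot (C + (conj_blinfun o\<^sub>L C o\<^sub>L conj_blinfun)) = 2 *\<^sub>R X"
      using \<sigma>X C(2) by (simp add: scaleR_2 flip: quot_simps(3) quot_simps(7))
    then have D: "X = quot D" by (simp add: D_def flip: quot_simps(6))
    define B where "B = fst_blinfun o\<^sub>L D o\<^sub>L embed_blinfun"
    have D1: "D (x, 0) = (B x, 0)" for x
      by (simp add: B_def D_def blinfun.bilinear_simps prod_eq_iff)
    \<comment> \<open>Commutation with the imaginary unit determines the second column of C from the
      first.\<close>
    have C2: "C (0, y) = (- snd (C (y, 0)), fst (C (y, 0)))" "C (0, - y) = (snd (C (y, 0)), - fst (C (y, 0)))" for y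
      using CJ[of "(y, 0)"] CJ[of "(- y, 0)"] blinfun.minus_right[of C "(y, 0)"] by (simp_all add: pair)
    have "C (- y, 0) = - C (y, 0)" for y using blinfun.minus_right[of C "(y, 0)"] by simp
    then have D2: "D (0, y) = (0, B y)" for y
      by (simp add: B_def D_def blinfun.bilinear_simps prod_eq_iff C2 flip: scaleR_2)
    have "D = cx_op ?E B"
    proof (rule blinfun_eqI)
      fix p
      have "D p = D (fst p, 0) + D (0, snd p)" by (simp flip: blinfun.add_right)
      then show "D p = cx_op ?E B p" by (simp add: D1 D2 pair)
    qed
    then show "\<exists>B\<in>operators ?E. X = quot (cx_op ?E B)" using D by (auto simp: real_space_simps)
  qed (auto simp: real_space_simps JJ)
qed

context complex_banach_space
begin

lemma im_unit_apply: "im_unit (complex_space s) x = s \<i> x"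
  by (rule im_unit_complex_space)

lemma scale_Re_Im: "s z x = Re z *\<^sub>R x + Im z *\<^sub>R s \<i> x"
proof -
  have "s z x = s (of_real (Re z) + of_real (Im z) * \<i>) x"
    by (simp add: complex_eq mult.commute)
  then show ?thesis by (simp only: scale_left_distrib scale_of_real flip: scale_scale)
qed

lemma operators_complex_space:
  "A \<in> operators (complex_space s) \<longleftrightarrow> A o\<^sub>L im_unit (complex_space s) = im_unit (complex_space s) o\<^sub>L A"
proof
  assume "A \<in> operators (complex_space s)"
  then show "A o\<^sub>L im_unit (complex_space s) = im_unit (complex_space s) o\<^sub>L A"
    by (intro blinfun_eqI) (simp add: im_unit_apply, simp add: operators_def complex_space_def)
next
  assume c: "A o\<^sub>L im_unit (complex_space s) = im_unit (complex_space s) o\<^sub>L A"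
  have "A (s \<i> x) = s \<i> (A x)" for x
    using arg_cong[OF c, of "\<lambda>B. blinfun_apply B x"] by (simp add: im_unit_apply)
  then have "A (s z x) = s z (A x)" for z x
    by (simp add: scale_Re_Im[of z] blinfun.bilinear_simps)
  then show "A \<in> operators (complex_space s)" by (simp add: operators_def complex_space_def)
qed

text \<open>Complex linear means commuting with multiplication by the imaginary unit. Thus the
  averaged representative of a class that commutes with it is already an operator on E, and
  \<open>\<Gamma>\<close> is empty.\<close>

lemma extended_complex_space:
  "extended_space (complex_space s)
    (\<lambda>A. (1/2) *\<^sub>R (A - (im_unit (complex_space s) o\<^sub>L A o\<^sub>L im_unit (complex_space s)))) (\<lambda>C. C) {}"
proof -
  let ?E = "complex_space s"
  let ?J = "im_unit ?E"
  have JJ: "?J o\<^sub>L ?J = - id_blinfun"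
    using scale_of_real[of "- 1"] by (intro blinfun_eqI) (simp add: im_unit_apply blinfun.minus_left)
  interpret J: complex_structure ?J by unfold_locales (rule JJ)
  have cx: "cx_op ?E = (\<lambda>A. A)" and sc: "scal ?E = s" by (simp_all add: complex_space_def)
  show ?thesis
  proof (intro extended_space.intro averaged_space.intro scalar_space.intro
      extended_space_axioms.intro averaged_space_axioms.intro)
    show "vector_space (scal ?E)" unfolding sc by (rule vector_space_axioms)
    show "\<exists>k. \<forall>x. scal ?E k x = r *\<^sub>R x" for r using scale_of_real by (auto simp: sc)
    show "bounded_linear (\<lambda>A. (1/2) *\<^sub>R (A - (?J o\<^sub>L A o\<^sub>L ?J)))"
      by (intro bounded_linear_scaleR_right[THEN bounded_linear_compose] bounded_linear_sub bounded_linear_ident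
          bounded_linear_compose[OF bounded_bilinear.bounded_linear_left[OF bounded_bilinear_blinfun_compose]
          bounded_bilinear.bounded_linear_right[OF bounded_bilinear_blinfun_compose]])
    show "(1/2) *\<^sub>R (A - (?J o\<^sub>L A o\<^sub>L ?J)) \<in> operators ?E" for A
      unfolding operators_complex_space by (rule blinfun_eqI) (simp add: blinfun.bilinear_simps)
    show "(1/2) *\<^sub>R (A - (?J o\<^sub>L A o\<^sub>L ?J)) = A" if "A \<in> operators ?E" for A
    proof (rule blinfun_eqI)
      fix x
      have "?J (A (?J x)) = - A x"
        using arg_cong[OF that[unfolded operators_complex_space], of "\<lambda>B. ?J (blinfun_apply B x)"] by simp
      then show "((1/2) *\<^sub>R (A - (?J o\<^sub>L A o\<^sub>L ?J))) x = A x"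
        by (simp add: blinfun.bilinear_simps flip: scaleR_2)
    qed
    show "compact_operator ((1/2) *\<^sub>R (A - (?J o\<^sub>L A o\<^sub>L ?J)))" if "compact_operator A" for A
      using that by (intro compact_operator_scaleR compact_operator_diff compact_operator_compose_right
          compact_operator_compose_left)
    show "\<exists>B\<in>operators ?E. X = quot (cx_op ?E B)" if "X * quot ?J = quot ?J * X" for X
      using J.average_commutes[OF that] by (metis cx operators_complex_space)
  qed (auto simp: cx JJ operators_complex_space)
qed

end

theorem theorem2p3:
  fixes s :: "complex \<Rightarrow> 'b::banach \<Rightarrow> 'b"
  shows
    "(\<forall>P \<in> projectors (real_space :: (real, 'a::banach, 'a \<times> 'a) kspace).
        let E = (real_space :: (real, 'a, 'a \<times> 'a) kspace);
            G = fundamental_group (ess_hyperbolic E) (2 *\<^sub>R P - id_blinfun);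
            H = fundamental_group (calkin_projectors E) (quot P)
        in sf_hom E \<in> hom G integer_group \<and>
           phi_hom E P \<in> hom H integer_group \<and>
           Psi_star E \<in> hom G H \<and>
           (\<forall>c \<in> carrier G. sf_hom E c = - phi_hom E P (Psi_star E c))) \<and>
     (complex_banach_space s \<longrightarrow>
      (\<forall>P \<in> projectors (complex_space s).
        let E = complex_space s;
            G = fundamental_group (ess_hyperbolic E) (2 *\<^sub>R P - id_blinfun);
            H = fundamental_group (calkin_projectors E) (quot P)
        in sf_hom E \<in> hom G integer_group \<and>
           phi_hom E P \<in> hom H integer_group \<and>
           Psi_star E \<in> hom G H \<and>
           (\<forall>c \<in> carrier G. sf_hom E c = - phi_hom E P (Psi_star E c))))"
  unfolding Let_def
  by (rule conjI; intro ballI impI)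
    (rule extended_space.spectral_flow_factorization[OF extended_real_space]
      extended_space.spectral_flow_factorization[OF complex_banach_space.extended_complex_space]; assumption)+

end
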